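(* Let $\Omega$ be a bounded domain in $\mathbb{C}^n$ and let $M$ be a complex manifold with positive-definite Bergman metric; denote the Bergman metrics of $\Omega$ and $M$ by $\beta_\Omega$ and $\beta_M$. Suppose that $\Omega$ has a pole $p$ of the Bochner connection $\nabla^p$, i.e. there is a point $p\in\Omega$ such that the Bergman representative map $\mathrm{rep}_p:\Omega\to\mathbb{C}^n$ is one-to-one. If there is a surjective holomorphic map $f:\Omega\to M$ satisfying $f^*\beta_M=\beta_\Omega$, then $f$ is a biholomorphism.
   Context: Bergman metric of a manifold: let $M$ be a complex manifold of dimension $m$, $A^2(M)$ the Hilbert space of holomorphic $m$-forms $f$ on $M$ with $|\int_M f\wedge\overline f|<\infty$, and $\{\phi_j\}_{j\ge0}$ a complete orthonormal system. The Bergman kernel form is $K(z,\overline w)=\sum_{j\ge0}\phi_j(z)\wedge\overline{\phi_j(w)}$, a holomorphic $2m$-form on $M\times\overline M$ ($\overline M$ the conjugate manifold). Suppose that $K(z,\overline z)\neq0$ for all $z\in M$ and write, in local coordinates on $U\subset M$, $K(z,\overline z)=K^*_U(z,\overline z)\,dz_1\wedge\cdots\wedge dz_m\wedge d\overline{z_1}\wedge\cdots\wedge d\overline{z_m}$. Then $$\beta_M=\sum_{j,k}\frac{\partial^2\log K^*_U(z,\overline z)}{\partial z_j\partial\overline{z_k}}\,dz_j\otimes d\overline{z_k}$$ is independent of the coordinates; it is called the Bergman metric of $M$ when it is positive-definite at every point. For a bounded domain $\Omega\subset\mathbb{C}^n$ with Bergman kernel function $K(z,\overline w)$, one has $\beta_\Omega=\sum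 g_{j\overline k}(z)\,dz_j\otimes d\overline{z_k}$ with $g_{j\overline k}(z)=\partial^2\log K(z,\overline z)/\partial z_j\partial\overline{z_k}$, which is always positive-definite. Let $g^{\overline k j}(p)$ be the $(k,j)$-th entry of the inverse of the matrix $(g_{j\overline k}(p))$. The Bergman representative map at $p\in\Omega$ is $\mathrm{rep}_p(z)=(\zeta_1(z),\dots,\zeta_n(z))$ with $$\zeta_j(z)=\sum_{k=1}^n g^{\overline k j}(p)\left\{\frac{\partial}{\partial\overline{w_k}}\Big|_{w=p}\log K(z,\overline w)-\frac{\partial}{\partial\overline{w_k}}\Big|_{w=p}\log K(w,\overline w)\right\},$$ where $\frac{\partial}{\partial\overline{w_k}}\log K(z,\overline w)$ means $\frac{\partial K(z,\overline w)}{\partial\overline{w_k}}/K(z,\overline w)$. The condition "$\mathrm{rep}_p:\Omega\to\mathbb{C}^n$ is one-to-one" includes that $\mathrm{rep}_p$ is a well-defined holomorphic map on all of $\Omega$. *)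

theory Defs
  imports "HOL-Analysis.Analysis"
begin

section \<open>Several complex variables\<close>

definition holo_fun :: "(complex ^ 'n \<Rightarrow> complex) \<Rightarrow> (complex ^ 'n) set \<Rightarrow> bool" where
  "holo_fun f S \<longleftrightarrow>
     (\<forall>z\<in>S. \<exists>f'. (f has_derivative f') (at z) \<and> (\<forall>c v. f' (c *s v) = c * f' v))"

definition holo_map :: "(complex ^ 'n \<Rightarrow> complex ^ 'm) \<Rightarrow> (complex ^ 'n) set \<Rightarrow> bool" where
  "holo_map F S \<longleftrightarrow> (\<forall>i. holo_fun (\<lambda>z. F z $ i) S)"

text \<open>The Wirtinger derivatives \<open>\<partial>/\<partial>z\<^sub>j\<close> and \<open>\<partial>/\<partial>(conjugate of z\<^sub>j)\<close>; \<open>axis j 1\<close> and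
  \<open>axis j \<i>\<close> are the real coordinate directions of \<open>x\<^sub>j\<close> and \<open>y\<^sub>j\<close> for \<open>z\<^sub>j = x\<^sub>j + \<i> y\<^sub>j\<close>.\<close>

definition wirtinger :: "'n \<Rightarrow> (complex ^ 'n \<Rightarrow> complex) \<Rightarrow> complex ^ 'n \<Rightarrow> complex" where
  "wirtinger j F z =
     (frechet_derivative F (at z) (axis j 1) - \<i> * frechet_derivative F (at z) (axis j \<i>)) / 2"

definition wirtinger_bar :: "'n \<Rightarrow> (complex ^ 'n \<Rightarrow> complex) \<Rightarrow> complex ^ 'n \<Rightarrow> complex" where
  "wirtinger_bar j F z =
     (frechet_derivative F (at z) (axis j 1) + \<i> * frechet_derivative F (at z) (axis j \<i>)) / 2"

definition complex_hessian :: "(complex ^ 'n \<Rightarrow> complex) \<Rightarrow> complex ^ 'n \<Rightarrow> complex ^ 'n ^ 'n" where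
  "complex_hessian F z = (\<chi> j k. wirtinger j (wirtinger_bar k F) z)"

text \<open>The value of the tensor \<open>\<Sum> g\<^sub>j\<^sub>k dz\<^sub>j \<otimes> (conjugate of dz\<^sub>k)\<close> on the pair \<open>(u, v)\<close>.\<close>

definition tensor_eval :: "complex ^ 'n ^ 'n \<Rightarrow> complex ^ 'n \<Rightarrow> complex ^ 'n \<Rightarrow> complex" where
  "tensor_eval g u v = (\<Sum>j\<in>UNIV. \<Sum>k\<in>UNIV. g $ j $ k * u $ j * cnj (v $ k))"

definition positive_definite :: "complex ^ 'n ^ 'n \<Rightarrow> bool" where
  "positive_definite g \<longleftrightarrow>
     (\<forall>v. v \<noteq> 0 \<longrightarrow> Im (tensor_eval g v v) = 0 \<and> Re (tensor_eval g v v) > 0)"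

text \<open>A complete orthonormal system of the space \<open>H\<close> with inner product \<open>ip\<close>, as a set rather than
  a sequence, so that finite-dimensional (even trivial) \<open>H\<close> is covered. Elements of \<open>H\<close> will be
  determined only up to values outside the relevant domain, so vanishing is expressed by
  \<open>ip f f = 0\<close>.\<close>

definition complete_orthonormal_system ::
    "('f \<Rightarrow> 'f \<Rightarrow> complex) \<Rightarrow> 'f set \<Rightarrow> 'f set \<Rightarrow> bool" where
  "complete_orthonormal_system ip H B \<longleftrightarrow>
     B \<subseteq> H \<and>
     (\<forall>\<phi>\<in>B. \<forall>\<psi>\<in>B. ip \<phi> \<psi> = (if \<phi> = \<psi> then 1 else 0)) \<and>
     (\<forall>f\<in>H. (\<forall>\<phi>\<in>B. ip f \<phi> = 0) \<longrightarrow> ip f f = 0)"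


section \<open>Bounded domains\<close>

definition bounded_domain :: "(complex ^ 'n) set \<Rightarrow> bool" where
  "bounded_domain \<Omega> \<longleftrightarrow> open \<Omega> \<and> connected \<Omega> \<and> \<Omega> \<noteq> {} \<and> bounded \<Omega>"

definition domain_A2 :: "(complex ^ 'n) set \<Rightarrow> (complex ^ 'n \<Rightarrow> complex) set" where
  "domain_A2 \<Omega> = {f. holo_fun f \<Omega> \<and> set_integrable lborel \<Omega> (\<lambda>z. (cmod (f z))\<^sup>2)}"

definition domain_inner ::
    "(complex ^ 'n) set \<Rightarrow> (complex ^ 'n \<Rightarrow> complex) \<Rightarrow> (complex ^ 'n \<Rightarrow> complex) \<Rightarrow> complex" where
  "domain_inner \<Omega> f g = (LINT z:\<Omega>|lborel. f z * cnj (g z))"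

text \<open>\<open>domain_kernel \<Omega> z w\<close> is \<open>K(z, conjugate of w)\<close>: the second argument is \<open>w\<close> itself and the
  function is antiholomorphic in it. It does not depend on the chosen orthonormal system.\<close>

definition domain_kernel :: "(complex ^ 'n) set \<Rightarrow> complex ^ 'n \<Rightarrow> complex ^ 'n \<Rightarrow> complex" where
  "domain_kernel \<Omega> z w =
     (\<Sum>\<^sub>\<infinity>\<phi>\<in>(SOME B. complete_orthonormal_system (domain_inner \<Omega>) (domain_A2 \<Omega>) B).
        \<phi> z * cnj (\<phi> w))"

text \<open>The diagonal values of the kernel are nonnegative reals, so \<open>Ln\<close> is the real logarithm here.\<close>

definition domain_metric :: "(complex ^ 'n) set \<Rightarrow> complex ^ 'n \<Rightarrow> complex ^ 'n ^ 'n" where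
  "domain_metric \<Omega> z = complex_hessian (\<lambda>w. Ln (domain_kernel \<Omega> w w)) z"

definition bergman_rep :: "(complex ^ 'n) set \<Rightarrow> complex ^ 'n \<Rightarrow> complex ^ 'n \<Rightarrow> complex ^ 'n" where
  "bergman_rep \<Omega> p z =
     (\<chi> j. \<Sum>k\<in>UNIV. matrix_inv (domain_metric \<Omega> p) $ k $ j *
        (wirtinger_bar k (\<lambda>w. domain_kernel \<Omega> z w) p / domain_kernel \<Omega> z p
         - wirtinger_bar k (\<lambda>w. Ln (domain_kernel \<Omega> w w)) p))"

text \<open>As division by zero is total in HOL, well-definedness of the representative map on all of
  \<open>\<Omega>\<close> is made explicit as \<open>K(\<cdot>, conjugate of p)\<close> having no zeros.\<close>

definition bochner_pole :: "(complex ^ 'n) set \<Rightarrow> complex ^ 'n \<Rightarrow> bool" where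
  "bochner_pole \<Omega> p \<longleftrightarrow>
     p \<in> \<Omega> \<and>
     (\<forall>z\<in>\<Omega>. domain_kernel \<Omega> z p \<noteq> 0) \<and>
     holo_map (bergman_rep \<Omega> p) \<Omega> \<and>
     inj_on (bergman_rep \<Omega> p) \<Omega>"


section \<open>Complex manifolds\<close>

type_synonym ('a, 'm) chart = "'a set \<times> ('a \<Rightarrow> complex ^ 'm)"

definition complex_manifold :: "'a topology \<Rightarrow> ('a, 'm::finite) chart set \<Rightarrow> bool" where
  "complex_manifold X A \<longleftrightarrow>
     Hausdorff_space X \<and> second_countable X \<and>
     (\<Union>(U, \<phi>)\<in>A. U) = topspace X \<and>
     (\<forall>(U, \<phi>)\<in>A. openin X U \<and> open (\<phi> ` U) \<and>
        homeomorphic_map (subtopology X U) (top_of_set (\<phi> ` U)) \<phi>) \<and>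
     (\<forall>(U, \<phi>)\<in>A. \<forall>(V, \<psi>)\<in>A. holo_map (\<psi> \<circ> inv_into U \<phi>) (\<phi> ` (U \<inter> V)))"

definition manifold_holomorphic ::
    "'a topology \<Rightarrow> ('a, 'n::finite) chart set \<Rightarrow> 'b topology \<Rightarrow> ('b, 'm::finite) chart set
      \<Rightarrow> ('a \<Rightarrow> 'b) \<Rightarrow> bool" where
  "manifold_holomorphic X A Y B f \<longleftrightarrow>
     continuous_map X Y f \<and>
     (\<forall>(U, \<phi>)\<in>A. \<forall>(V, \<psi>)\<in>B. holo_map (\<psi> \<circ> f \<circ> inv_into U \<phi>) (\<phi> ` (U \<inter> f -` V)))"

definition biholomorphism ::
    "'a topology \<Rightarrow> ('a, 'n::finite) chart set \<Rightarrow> 'b topology \<Rightarrow> ('b, 'm::finite) chart set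
      \<Rightarrow> ('a \<Rightarrow> 'b) \<Rightarrow> bool" where
  "biholomorphism X A Y B f \<longleftrightarrow>
     manifold_holomorphic X A Y B f \<and>
     (\<exists>g. manifold_holomorphic Y B X A g \<and>
        (\<forall>x\<in>topspace X. g (f x) = x) \<and> (\<forall>y\<in>topspace Y. f (g y) = y))"

definition domain_atlas :: "(complex ^ 'n) set \<Rightarrow> (complex ^ 'n, 'n) chart set" where
  "domain_atlas \<Omega> = {(\<Omega>, id)}"


section \<open>Forms of top degree and their integrals\<close>

text \<open>Forms of degree \<open>(m,0)\<close> and \<open>(m,m)\<close> on an \<open>m\<close>-dimensional manifold are given by their
  coefficients: \<open>\<omega> c x\<close> is the coefficient at the point \<open>x\<close> with respect to
  \<open>dz\<^sub>1 \<and> \<dots> \<and> dz\<^sub>m\<close>, respectively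
  \<open>dz\<^sub>1 \<and> \<dots> \<and> dz\<^sub>m \<and> (conjugate of dz\<^sub>1) \<and> \<dots> \<and> (conjugate of dz\<^sub>m)\<close>, for the coordinates of
  the chart \<open>c\<close>. Only charts of the atlas and points in their domains matter.\<close>

type_synonym ('a, 'm) top_form = "('a, 'm) chart \<Rightarrow> 'a \<Rightarrow> complex"

definition chart_inv :: "('a, 'm) chart \<Rightarrow> complex ^ 'm \<Rightarrow> 'a" where
  "chart_inv c = inv_into (fst c) (snd c)"

text \<open>Change of coordinates: \<open>dw\<^sub>1 \<and> \<dots> \<and> dw\<^sub>m = det (\<partial>w\<^sub>i/\<partial>z\<^sub>j) dz\<^sub>1 \<and> \<dots> \<and> dz\<^sub>m\<close>, with \<open>z\<close> and \<open>w\<close>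
  the coordinates of \<open>c\<close> and \<open>d\<close>. The derivative of the transition map is complex linear, so
  \<open>matrix\<close> yields the complex Jacobian matrix.\<close>

definition holomorphic_top_form :: "('a, 'm::finite) chart set \<Rightarrow> ('a, 'm) top_form \<Rightarrow> bool" where
  "holomorphic_top_form A \<omega> \<longleftrightarrow>
     (\<forall>c\<in>A. holo_fun (\<omega> c \<circ> chart_inv c) (snd c ` fst c)) \<and>
     (\<forall>c\<in>A. \<forall>d\<in>A. \<forall>x\<in>fst c \<inter> fst d.
        \<omega> c x =
          \<omega> d x * det (matrix (frechet_derivative (snd d \<circ> chart_inv c) (at (snd c x)))))"

definition wedge_cnj :: "('a, 'm) top_form \<Rightarrow> ('a, 'm) top_form \<Rightarrow> ('a, 'm) top_form" where
  "wedge_cnj \<omega> \<eta> = (\<lambda>c x. \<omega> c x * cnj (\<eta> c x))"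

text \<open>The integral of an \<open>(m,m)\<close>-form is computed by cutting the manifold into countably many
  disjoint Borel pieces, each inside a chart domain. A countable cover by chart domains exists by
  second countability, and the result does not depend on its choice.\<close>

definition chart_cover :: "'a topology \<Rightarrow> ('a, 'm::finite) chart set \<Rightarrow> nat \<Rightarrow> ('a, 'm) chart" where
  "chart_cover X A = (SOME c. range c \<subseteq> A \<and> (\<Union>k. fst (c k)) = topspace X)"

definition chart_piece ::
    "'a topology \<Rightarrow> ('a, 'm::finite) chart set \<Rightarrow> nat \<Rightarrow> (complex ^ 'm) set" where
  "chart_piece X A k =
     snd (chart_cover X A k) ` (fst (chart_cover X A k) - (\<Union>i<k. fst (chart_cover X A i)))"

definition form_integrable ::
    "'a topology \<Rightarrow> ('a, 'm::finite) chart set \<Rightarrow> ('a, 'm) top_form \<Rightarrow> bool" where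
  "form_integrable X A \<theta> \<longleftrightarrow>
     (\<Sum>k. \<integral>\<^sup>+z\<in>chart_piece X A k.
        ennreal (cmod (\<theta> (chart_cover X A k) (chart_inv (chart_cover X A k) z))) \<partial>lborel) < \<infinity>"

text \<open>The constant factor is
  \<open>dz\<^sub>1 \<and> \<dots> \<and> dz\<^sub>m \<and> (conjugate of dz\<^sub>1) \<and> \<dots> \<and> (conjugate of dz\<^sub>m)
    = (-1)\<^bsup>m(m-1)/2\<^esup> (-2\<i>)\<^bsup>m\<^esup> dx\<^sub>1 \<and> dy\<^sub>1 \<and> \<dots> \<and> dx\<^sub>m \<and> dy\<^sub>m\<close>.\<close>

definition form_integral ::
    "'a topology \<Rightarrow> ('a, 'm::finite) chart set \<Rightarrow> ('a, 'm) top_form \<Rightarrow> complex" where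
  "form_integral X A \<theta> =
     (-1) ^ (CARD('m) * (CARD('m) - 1) div 2) * (- 2 * \<i>) ^ CARD('m) *
     (\<Sum>k. LINT z:chart_piece X A k|lborel.
        \<theta> (chart_cover X A k) (chart_inv (chart_cover X A k) z))"


section \<open>The Bergman metric of a complex manifold\<close>

definition manifold_A2 ::
    "'a topology \<Rightarrow> ('a, 'm::finite) chart set \<Rightarrow> ('a, 'm) top_form set" where
  "manifold_A2 X A = {\<omega>. holomorphic_top_form A \<omega> \<and> form_integrable X A (wedge_cnj \<omega> \<omega>)}"

text \<open>The factor \<open>\<i>\<^bsup>m\<^sup>2\<^esup>\<close> makes the inner product positive: \<open>\<omega>\<close> has square norm
  \<open>\<bar>\<integral> \<omega> \<and> (conjugate of \<omega>)\<bar>\<close>.\<close>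

definition manifold_inner ::
    "'a topology \<Rightarrow> ('a, 'm::finite) chart set \<Rightarrow> ('a, 'm) top_form \<Rightarrow> ('a, 'm) top_form \<Rightarrow> complex"
  where
  "manifold_inner X A \<omega> \<eta> = \<i> ^ (CARD('m)\<^sup>2) * form_integral X A (wedge_cnj \<omega> \<eta>)"

text \<open>\<open>manifold_kernel X A c d x y\<close> is the coefficient of the Bergman kernel form at \<open>(x, y)\<close> with
  respect to the coordinates of the chart \<open>c\<close> at \<open>x\<close> and the conjugates of those of \<open>d\<close> at \<open>y\<close>.\<close>

definition manifold_kernel ::
    "'a topology \<Rightarrow> ('a, 'm::finite) chart set \<Rightarrow> ('a, 'm) chart \<Rightarrow> ('a, 'm) chart
      \<Rightarrow> 'a \<Rightarrow> 'a \<Rightarrow> complex" where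
  "manifold_kernel X A c d x y =
     (\<Sum>\<^sub>\<infinity>\<omega>\<in>(SOME B. complete_orthonormal_system (manifold_inner X A) (manifold_A2 X A) B).
        \<omega> c x * cnj (\<omega> d y))"

definition manifold_metric ::
    "'a topology \<Rightarrow> ('a, 'm::finite) chart set \<Rightarrow> ('a, 'm) chart \<Rightarrow> 'a \<Rightarrow> complex ^ 'm ^ 'm" where
  "manifold_metric X A c x =
     complex_hessian
       (\<lambda>\<zeta>. Ln (manifold_kernel X A c c (chart_inv c \<zeta>) (chart_inv c \<zeta>))) (snd c x)"

definition has_bergman_metric :: "'a topology \<Rightarrow> ('a, 'm::finite) chart set \<Rightarrow> bool" where
  "has_bergman_metric X A \<longleftrightarrow>
     (\<forall>c\<in>A. \<forall>x\<in>fst c. manifold_kernel X A c c x x \<noteq> 0) \<and>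
     (\<forall>c\<in>A. \<forall>x\<in>fst c. positive_definite (manifold_metric X A c x))"

text \<open>\<open>f\<^sup>*\<beta>\<^sub>M = \<beta>\<^sub>\<Omega>\<close>, evaluated on all pairs of holomorphic tangent vectors of \<open>\<Omega>\<close>; the metric of
  \<open>M\<close> and the differential of \<open>f\<close> are expressed in any chart around the image point.\<close>

definition preserves_bergman_metric ::
    "(complex ^ 'n) set \<Rightarrow> 'a topology \<Rightarrow> ('a, 'm::finite) chart set \<Rightarrow> (complex ^ 'n \<Rightarrow> 'a) \<Rightarrow> bool"
  where
  "preserves_bergman_metric \<Omega> X A f \<longleftrightarrow>
     (\<forall>z\<in>\<Omega>. \<forall>c\<in>A. f z \<in> fst c \<longrightarrow>
        (\<forall>u v. tensor_eval (manifold_metric X A c (f z))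
                 (frechet_derivative (snd c \<circ> f) (at z) u)
                 (frechet_derivative (snd c \<circ> f) (at z) v)
               = tensor_eval (domain_metric \<Omega> z) u v))"

end

theory Submission
  imports Defs "HOL-Complex_Analysis.Conformal_Mappings"
begin

text \<open>Calabi's rigidity argument. Let \<open>\<phi>\<close> and \<open>\<omega>\<close> be the orthonormal bases of the Bergman spaces of
  \<open>\<Omega>\<close> and \<open>M\<close>. In a chart on which the kernel of \<open>M\<close> is known to be holomorphic, equality of the
  metrics makes the difference of the logarithms of the two kernels pluriharmonic, so that
  \<open>\<Sum> \<omega>\<^sub>j(f z) (conjugate of \<omega>\<^sub>j(f w)) = l(z) (conjugate of l(w)) K(z, w)\<close> locally. Hence
  \<open>\<omega>\<^sub>j \<circ> f = l \<xi>\<^sub>j\<close> locally, where the functions \<open>\<xi>\<^sub>j\<close> extend to all of \<open>\<Omega>\<close> (Riesz representation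
  in the Hilbert space with kernel \<open>K\<close>) and \<open>\<Sum> \<xi>\<^sub>j(z) (conjugate of \<xi>\<^sub>j(w)) = K(z, w)\<close> everywhere. By the
  identity theorem the vectors \<open>(\<omega>\<^sub>j(f z))\<close> and \<open>(\<xi>\<^sub>j(z))\<close> are proportional for every \<open>z\<close>. If
  \<open>f z = f w\<close>, then \<open>\<xi>(z)\<close> and \<open>\<xi>(w)\<close>, hence \<open>\<phi>(z)\<close> and \<open>\<phi>(w)\<close>, are proportional; since the
  constants and the coordinate functions are square integrable on \<open>\<Omega>\<close>, this forces \<open>z = w\<close>.
  The infinitesimal version of the same argument shows that \<open>f\<close> is an immersion.\<close>

section \<open>Holomorphic functions of several variables\<close>

text \<open>The factor \<open>l\<close> and the good chart exist only near one point and do not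
  continue along \<Omega>. The proportionality is therefore recorded by the minors
  \<open>\<omega>\<^sub>j(f z) \<xi>\<^sub>k(z) - \<omega>\<^sub>k(f z) \<xi>\<^sub>j(z)\<close>:
  they are holomorphic in every chart, free of \<open>l\<close>, and only pick up a Jacobian factor
  under a change of chart. For this the \<open>\<xi>\<^sub>j\<close> must live on all of \<Omega>.
  Their extension needs no Hilbert space completion: finite combinations of the functions
  \<open>K(\<cdot>, w)\<close> with \<open>w\<close> near one point are defined everywhere, and a
  minimizing sequence of them converges at every \<open>z\<close>, because the squared norm of
  evaluation at \<open>z\<close> is at most \<open>K(z, z)\<close>. Minors yield a factor of
  proportionality only between nonzero vectors: \<open>(\<omega>\<^sub>j(f z))\<close> is nonzero
  since the kernel of \<open>M\<close> does not vanish on the diagonal,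
  \<open>(\<xi>\<^sub>j(z))\<close> since \<open>K(z, z) \<noteq> 0\<close>. Orthonormal systems are
  sets of unknown cardinality, so the series are unordered sums, and limits of holomorphic functions
  are taken along arbitrary filters.\<close>

abbreviation fd :: "(complex ^ 'n \<Rightarrow> 'b::real_normed_vector) \<Rightarrow> complex ^ 'n \<Rightarrow> complex ^ 'n \<Rightarrow> 'b" where
  "fd f z \<equiv> frechet_derivative f (at z)"

section \<open>Calculus of complex differentiable functions and maps\<close>

lemma norm_vector_smult: "norm (c *s v) = cmod c * norm (v :: complex ^ 'n)"
  by (simp add: norm_vec_def L2_set_def norm_mult power_mult_distrib flip: sum_distrib_left)
     (simp add: real_sqrt_mult)

lemma scaleR_eq_smult: "r *\<^sub>R v = complex_of_real r *s (v :: complex ^ 'n)"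
  by (simp add: vec_eq_iff scaleR_conv_of_real[where 'a = complex])

lemma bounded_linear_smult_left: "bounded_linear (\<lambda>t. t *s (v :: complex ^ 'n))"
  by (rule bounded_linear_intro[where K = "norm v"])
     (auto simp: norm_vector_smult vector_sadd_rdistrib vec_eq_iff)

lemma bounded_linear_smult_right: "bounded_linear (\<lambda>v. t *s (v :: complex ^ 'n))"
  by (rule bounded_linear_intro[where K = "cmod t"])
     (auto simp: norm_vector_smult vector_add_ldistrib scaleR_eq_smult mult_ac)

lemma holo_fun_has_derivative:
  assumes "holo_fun f S" "z \<in> S"
  shows "(f has_derivative fd f z) (at z)"
  using assms unfolding holo_fun_def by (metis frechet_derivative_at)

lemma holo_fun_smult:
  assumes "holo_fun f S" "z \<in> S"
  shows "fd f z (c *s v) = c * fd f z v"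
  using assms unfolding holo_fun_def by (metis frechet_derivative_at)

lemma holo_funI:
  assumes "\<And>z. z \<in> S \<Longrightarrow> \<exists>f'. (f has_derivative f') (at z) \<and> (\<forall>c v. f' (c *s v) = c * f' v)"
  shows "holo_fun f S"
  using assms unfolding holo_fun_def by blast

lemma holo_fun_subset: "holo_fun f S \<Longrightarrow> T \<subseteq> S \<Longrightarrow> holo_fun f T"
  unfolding holo_fun_def by blast

lemma holo_fun_cong:
  assumes "holo_fun f S" "open S" "\<And>z. z \<in> S \<Longrightarrow> f z = g z"
  shows "holo_fun g S"
  using assms unfolding holo_fun_def
  by (metis has_derivative_transform_within_open)

text \<open>Holds without differentiability: both sides are the same choice from the same
  predicate.\<close>

lemma fd_cong:
  assumes "open S" "z \<in> S" "\<And>w. w \<in> S \<Longrightarrow> f w = g w"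
  shows "fd f z = fd g z"
proof -
  have "(f has_derivative D) (at z) = (g has_derivative D) (at z)" for D
    using has_derivative_transform_within_open[OF _ assms(1,2)] assms(3) by metis
  then show ?thesis unfolding frechet_derivative_def by simp
qed

lemma holo_fun_linear:
  assumes "bounded_linear f" "\<And>c v. f (c *s v) = c * f v"
  shows "holo_fun f S"
  by (rule holo_funI) (use assms bounded_linear_imp_has_derivative in blast)

lemma holo_fun_nth: "holo_fun (\<lambda>z. z $ i) S"
  by (rule holo_fun_linear) (simp_all add: bounded_linear_vec_nth)

lemma holo_fun_const: "holo_fun (\<lambda>z. c) S"
  by (rule holo_funI) (auto intro!: exI[of _ "\<lambda>_. 0"])

lemma holo_fun_add:
  assumes "holo_fun f S" "holo_fun g S"
  shows "holo_fun (\<lambda>z. f z + g z) S"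
  by (rule holo_funI, rule exI, rule conjI,
      rule has_derivative_add[OF holo_fun_has_derivative[OF assms(1)] holo_fun_has_derivative[OF assms(2)]])
     (simp_all add: holo_fun_smult[OF assms(1)] holo_fun_smult[OF assms(2)] algebra_simps)

lemma holo_fun_mult:
  assumes "holo_fun f S" "holo_fun g S"
  shows "holo_fun (\<lambda>z. f z * g z) S"
  by (rule holo_funI, rule exI, rule conjI,
      rule has_derivative_mult[OF holo_fun_has_derivative[OF assms(1)] holo_fun_has_derivative[OF assms(2)]])
     (simp_all add: holo_fun_smult[OF assms(1)] holo_fun_smult[OF assms(2)] algebra_simps)

lemma holo_fun_diff:
  assumes "holo_fun f S" "holo_fun g S"
  shows "holo_fun (\<lambda>z. f z - g z) S"
  using holo_fun_add[OF assms(1) holo_fun_mult[OF holo_fun_const[of "-1"] assms(2)]] by simp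

lemma holo_fun_sum:
  assumes "\<And>i. i \<in> I \<Longrightarrow> holo_fun (f i) S"
  shows "holo_fun (\<lambda>z. \<Sum>i\<in>I. f i z) S"
  using assms
  by (induction I rule: infinite_finite_induct) (auto intro: holo_fun_const holo_fun_add)

lemma holo_fun_continuous_on: "holo_fun f S \<Longrightarrow> continuous_on S f"
  by (meson continuous_at_imp_continuous_on has_derivative_continuous holo_fun_has_derivative)

lemma holo_fun_outer:
  assumes "holo_fun f S" "open T" "g holomorphic_on T" "f ` S \<subseteq> T"
  shows "holo_fun (\<lambda>z. g (f z)) S"
proof (rule holo_funI)
  fix z assume z: "z \<in> S"
  have "(g has_field_derivative deriv g (f z)) (at (f z))"
    using assms z by (auto intro: holomorphic_derivI)
  then have "((\<lambda>z. g (f z)) has_derivative (\<lambda>v. deriv g (f z) * fd f z v)) (at z)"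
    using diff_chain_at[OF holo_fun_has_derivative[OF assms(1) z], of g "(*) (deriv g (f z))"]
    by (simp add: has_field_derivative_def o_def)
  then show "\<exists>f'. ((\<lambda>z. g (f z)) has_derivative f') (at z) \<and> (\<forall>c v. f' (c *s v) = c * f' v)"
    using holo_fun_smult[OF assms(1) z] by (intro exI[of _ "\<lambda>v. deriv g (f z) * fd f z v"]) simp
qed

lemma holo_map_has_derivative:
  fixes F :: "complex ^ 'n \<Rightarrow> complex ^ 'm"
  assumes "holo_map F S" "z \<in> S"
  shows "(F has_derivative fd F z) (at z)" and "fd F z (c *s v) = c *s fd F z v"
    and "fd F z v $ i = fd (\<lambda>z. F z $ i) z v"
proof -
  have h: "holo_fun (\<lambda>z. F z $ i) S" for i using assms by (simp add: holo_map_def)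
  have D: "(F has_derivative (\<lambda>v. \<chi> i. fd (\<lambda>z. F z $ i) z v)) (at z)"
    unfolding has_derivative_componentwise_within[of F]
  proof
    fix b :: "complex ^ 'm" assume "b \<in> Basis"
    then obtain i u where b: "b = axis i u" unfolding Basis_vec_def by auto
    show "((\<lambda>x. F x \<bullet> b) has_derivative (\<lambda>x. (\<chi> i. fd (\<lambda>z. F z $ i) z x) \<bullet> b)) (at z)"
      unfolding b inner_axis
      using has_derivative_inner_left[OF holo_fun_has_derivative[OF h assms(2)]] by simp
  qed
  then show "(F has_derivative fd F z) (at z)"
    using frechet_derivative_at by metis
  have e: "fd F z = (\<lambda>v. \<chi> i. fd (\<lambda>z. F z $ i) z v)"
    using D frechet_derivative_at by metis
  show "fd F z (c *s v) = c *s fd F z v"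
    unfolding e using holo_fun_smult[OF h assms(2)] by (simp add: vec_eq_iff)
  show "fd F z v $ i = fd (\<lambda>z. F z $ i) z v" unfolding e by simp
qed

lemma holo_fun_compose:
  assumes "holo_map F S" "holo_fun g T" "F ` S \<subseteq> T"
  shows "holo_fun (\<lambda>z. g (F z)) S"
    and "z \<in> S \<Longrightarrow> fd (\<lambda>z. g (F z)) z v = fd g (F z) (fd F z v)"
proof -
  have D: "((\<lambda>z. g (F z)) has_derivative (\<lambda>v. fd g (F z) (fd F z v))) (at z)" if "z \<in> S" for z
    using diff_chain_at[OF holo_map_has_derivative(1)[OF assms(1) that]
        holo_fun_has_derivative[OF assms(2)]] that assms(3)
    by (auto simp: o_def)
  show "holo_fun (\<lambda>z. g (F z)) S"
  proof (rule holo_funI, rule exI, rule conjI, rule D, assumption)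
    fix z assume z: "z \<in> S"
    with assms(3) have "F z \<in> T" by auto
    with z show "\<forall>c v. fd g (F z) (fd F z (c *s v)) = c * fd g (F z) (fd F z v)"
      using holo_map_has_derivative(2)[OF assms(1) z] holo_fun_smult[OF assms(2)] by simp
  qed
  show "z \<in> S \<Longrightarrow> fd (\<lambda>z. g (F z)) z v = fd g (F z) (fd F z v)"
    using frechet_derivative_at[OF D] by metis
qed

lemma holo_map_continuous_on: "holo_map f S \<Longrightarrow> continuous_on S f"
  by (meson continuous_at_imp_continuous_on has_derivative_continuous holo_map_has_derivative(1))

text \<open>Complex lines are the bridge to the one-variable theory; complex linearity of
  \<open>fd\<close> turns the derivative in direction \<open>v\<close> into a complex derivative in
  \<open>t\<close>.\<close>

lemma holo_fun_line:
  assumes "holo_fun f S" "z + t *s v \<in> S"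
  shows "((\<lambda>t. f (z + t *s v)) has_field_derivative fd f (z + t *s v) v) (at t)"
proof -
  have "((\<lambda>t. z + t *s v) has_derivative (\<lambda>t. t *s v)) (at t)"
    by (auto intro!: derivative_eq_intros bounded_linear.has_derivative[OF bounded_linear_smult_left])
  from diff_chain_at[OF this holo_fun_has_derivative[OF assms]]
  show ?thesis
    by (simp add: has_field_derivative_def o_def holo_fun_smult[OF assms] mult_commute_abs)
qed

lemma holo_fun_line_holomorphic:
  assumes "holo_fun f S" "\<And>t. t \<in> T \<Longrightarrow> z + t *s v \<in> S"
  shows "(\<lambda>t. f (z + t *s v)) holomorphic_on T"
  using holo_fun_line[OF assms(1)] assms(2)
  by (meson field_differentiable_def field_differentiable_at_within holomorphic_onI)

section \<open>Cauchy estimates, limits of holomorphic functions, and holomorphy of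
  derivatives\<close>

lemma Cauchy_estimates_at_0:
  assumes g: "g holomorphic_on ball 0 R" and "R > 0" and C: "\<And>t. t \<in> ball 0 R \<Longrightarrow> cmod (g t) \<le> C"
  shows "cmod (deriv g 0) \<le> 2 * C / R"
    and "cmod t < R / 2 \<Longrightarrow> cmod (g t - g 0 - deriv g 0 * t) \<le> 8 * C / R\<^sup>2 * (cmod t)\<^sup>2"
proof -
  \<comment> \<open>A disc of radius \<open>R/2\<close> around any point of
    \<open>ball 0 (R/2)\<close> stays in \<open>ball 0 R\<close>. The case \<open>n = 1\<close> at 0
    gives the constant \<open>2 * C / R\<close>, the case \<open>n = 2\<close> on the whole
    half-size disc gives the Taylor constant \<open>8 * C / R\<^sup>2\<close>.\<close>
  have est: "cmod ((deriv ^^ n) g x) \<le> fact n * C / (R/2) ^ n" if "x \<in> ball 0 (R/2)" for n x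
  proof (rule Cauchy_inequality)
    have "cball x (R/2) \<subseteq> ball 0 R" 
    proof
      fix y assume "y \<in> cball x (R/2)"
      then show "y \<in> ball 0 R" using that norm_triangle_ineq[of x "y - x"]
        by (auto simp: dist_norm norm_minus_commute)
    qed
    then show "g holomorphic_on ball x (R/2)" "continuous_on (cball x (R/2)) g"
      using g by (meson holomorphic_on_subset ball_subset_cball holomorphic_on_imp_continuous_on continuous_on_subset)+
    show "cmod (g y) \<le> C" if "cmod (x - y) = R/2" for y
      using \<open>cball x (R/2) \<subseteq> ball 0 R\<close> that C by (auto simp: dist_norm subset_iff)
  qed (use \<open>R > 0\<close> in auto)
  show "cmod (deriv g 0) \<le> 2 * C / R" using est[of 0 1] \<open>R > 0\<close> by (simp add: field_simps)
  assume t: "cmod t < R / 2"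
  have "cmod ((deriv ^^ 0) g t - (\<Sum>i\<le>1. (deriv ^^ i) g 0 * (t - 0) ^ i / fact i))
      \<le> (8 * C / R\<^sup>2) * cmod (t - 0) ^ Suc 1 / fact 1"
  proof (rule complex_Taylor[where S = "ball 0 (R/2)"])
    fix i x assume x: "x \<in> ball (0::complex) (R/2)"
    have "(deriv ^^ i) g holomorphic_on ball 0 R"
      using g by (intro holomorphic_higher_deriv) auto
    moreover have "x \<in> ball 0 R" using x \<open>R > 0\<close> by auto
    ultimately show "((deriv ^^ i) g has_field_derivative (deriv ^^ Suc i) g x) (at x within ball 0 (R / 2))"
      using holomorphic_derivI[of _ "ball 0 R" x] by (simp add: has_field_derivative_at_within)
    show "cmod ((deriv ^^ Suc 1) g x) \<le> 8 * C / R\<^sup>2"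
      using est[OF x, of 2] by (simp add: eval_nat_numeral field_simps)
  qed (use t \<open>R > 0\<close> in auto)
  then show "cmod (g t - g 0 - deriv g 0 * t) \<le> 8 * C / R\<^sup>2 * (cmod t)\<^sup>2"
    by (simp add: power2_eq_square algebra_simps)
qed

text \<open>The one-variable estimates on the slice \<open>t \<mapsto> x + t *s v\<close>. The
  constants depend on \<open>f\<close> only through the bound \<open>C\<close>; this uniformity is
  what makes limits work.\<close>

lemma
  fixes f :: "complex ^ 'n \<Rightarrow> complex"
  assumes f: "holo_fun f (ball x R)" and "R > 0" and C: "\<And>y. y \<in> ball x R \<Longrightarrow> cmod (f y) \<le> C"
  shows Cauchy_estimate_fd: "cmod (fd f x v) \<le> 2 * C / R * norm v"
    and Cauchy_estimate_fd2: "norm v < R / 2 \<Longrightarrow> cmod (f (x + v) - f x - fd f x v) \<le> 8 * C / R\<^sup>2 * (norm v)\<^sup>2"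
proof -
  define g where "g = (\<lambda>t. f (x + t *s v))"
  have fx: "(f has_derivative fd f x) (at x)" using holo_fun_has_derivative[OF f] \<open>R > 0\<close> by simp
  have fd0: "fd f x 0 = 0" using has_derivative_bounded_linear[OF fx] by (simp add: linear_0 bounded_linear.linear)
  have "cmod (fd f x v) \<le> 2 * C / R * norm v \<and>
    (norm v < R / 2 \<longrightarrow> cmod (f (x + v) - f x - fd f x v) \<le> 8 * C / R\<^sup>2 * (norm v)\<^sup>2)"
  proof (cases "v = 0")
    case True then show ?thesis using fd0 by simp
  next
    case False
    \<comment> \<open>The slice parameter may run up to \<open>R / norm v\<close>. The second
      estimate is read off at \<open>t = 1\<close>, which lies within half that radius when
      \<open>norm v < R / 2\<close>.\<close>
    define \<rho> where "\<rho> = R / norm v"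
    have \<rho>: "\<rho> > 0" using False \<open>R > 0\<close> by (simp add: \<rho>_def)
    have mem: "x + t *s v \<in> ball x R" if "t \<in> ball 0 \<rho>" for t
      using that False by (simp add: \<rho>_def dist_norm norm_vector_smult field_simps)
    have hol: "g holomorphic_on ball 0 \<rho>" unfolding g_def
      by (rule holo_fun_line_holomorphic[OF f mem])
    have C': "cmod (g t) \<le> C" if "t \<in> ball 0 \<rho>" for t unfolding g_def using C mem that by blast
    have d: "deriv g 0 = fd f x v"
      using holo_fun_line[OF f, of x 0 v] \<open>R > 0\<close> unfolding g_def by (simp add: DERIV_imp_deriv)
    note e = Cauchy_estimates_at_0[OF hol \<rho> C']
    have "cmod (fd f x v) \<le> 2 * C / R * norm v" using e(1) by (simp add: d \<rho>_def)
    moreover have "cmod (f (x + v) - f x - fd f x v) \<le> 8 * C / R\<^sup>2 * (norm v)\<^sup>2" if "norm v < R / 2"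
      using e(2)[of 1] that False unfolding d by (simp add: g_def \<rho>_def power_divide field_simps)
    ultimately show ?thesis by blast
  qed
  then show "cmod (fd f x v) \<le> 2 * C / R * norm v"
    and "norm v < R / 2 \<Longrightarrow> cmod (f (x + v) - f x - fd f x v) \<le> 8 * C / R\<^sup>2 * (norm v)\<^sup>2" by auto
qed

lemma has_derivative_quadratic:
  assumes "bounded_linear D" "r > 0"
    and "\<And>v. norm v < r \<Longrightarrow> norm (f (x + v) - f x - D v) \<le> B * (norm v)\<^sup>2"
  shows "(f has_derivative D) (at x)"
proof (rule has_derivativeI_sandwich[where e = r and H = "\<lambda>y. B * norm (y - x)"])
  fix y assume "y \<noteq> x" "dist y x < r"
  then show "norm (f y - f x - D (y - x)) / norm (y - x) \<le> B * norm (y - x)"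
    using assms(3)[of "y - x"] by (simp add: dist_norm field_simps power2_eq_square)
next
  have "((\<lambda>y. B * norm (y - x)) \<longlongrightarrow> B * norm (x - x)) (at x)" by (intro tendsto_intros)
  then show "((\<lambda>y. B * norm (y - x)) \<longlongrightarrow> 0) (at x)" by simp
qed (use assms in auto)

text \<open>The quadratic remainder bound is uniform in \<open>n\<close>, so a difference quotient
  with one fixed small step approximates all derivatives \<open>fd (f n) x v\<close> at once.
  Pointwise convergence of the quotients then makes the derivatives a Cauchy filter, and the
  remainder bound survives in the limit and shows that \<open>g\<close> is differentiable. An
  arbitrary filter \<open>F\<close> is allowed so that the result covers both sequences and the
  finite subsets of an index set.\<close>

proposition holo_fun_limit:
  fixes f :: "'i \<Rightarrow> complex ^ 'n \<Rightarrow> complex"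
  assumes F: "F \<noteq> bot"
    and bdd: "\<And>x. x \<in> S \<Longrightarrow> \<exists>R>0. \<exists>C. ball x R \<subseteq> S \<and>
        (\<forall>\<^sub>F n in F. holo_fun (f n) (ball x R) \<and> (\<forall>y\<in>ball x R. cmod (f n y) \<le> C))"
    and lim: "\<And>x. x \<in> S \<Longrightarrow> ((\<lambda>n. f n x) \<longlongrightarrow> g x) F"
  shows "holo_fun g S"
    and "x \<in> S \<Longrightarrow> ((\<lambda>n. fd (f n) x v) \<longlongrightarrow> fd g x v) F"
proof -
  have "\<exists>A. (g has_derivative A) (at x) \<and> (\<forall>c v. A (c *s v) = c * A v) \<and>
     (\<forall>v. ((\<lambda>n. fd (f n) x v) \<longlongrightarrow> A v) F)" if x: "x \<in> S" for x
  proof -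
    obtain R C where R: "R > 0" and RS: "ball x R \<subseteq> S"
      and ev: "\<forall>\<^sub>F n in F. holo_fun (f n) (ball x R) \<and> (\<forall>y\<in>ball x R. cmod (f n y) \<le> C)"
      using bdd[OF x] by blast
    have est: "cmod (f n (x + v) - f n x - fd (f n) x v) \<le> 8 * C / R\<^sup>2 * (norm v)\<^sup>2"
      if "holo_fun (f n) (ball x R) \<and> (\<forall>y\<in>ball x R. cmod (f n y) \<le> C)" "norm v < R / 2" for n v
      using Cauchy_estimate_fd2[OF _ R _ that(2)] that(1) by blast
    have "C \<ge> 0" 
      using eventually_happens[OF ev] F R by (metis centre_in_ball norm_ge_zero order_trans)
    have "\<exists>l. ((\<lambda>n. fd (f n) x v) \<longlongrightarrow> l) F" for v
    proof -
      have "cauchy_filter (filtermap (\<lambda>n. fd (f n) x v) F)"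
        unfolding cauchy_filter_metric_filtermap
      proof (intro allI impI)
        fix e :: real assume e: "e > 0"
        define B where "B = 8 * C / R\<^sup>2 * (norm v)\<^sup>2"
        have "B \<ge> 0" using \<open>C \<ge> 0\<close> by (simp add: B_def)
        \<comment> \<open>The first bound forces \<open>s * B \<le> e / 4\<close>, the second keeps
          \<open>s *\<^sub>R v\<close> within \<open>R / 2\<close>; adding 1 guards the denominators
          when \<open>B\<close> or \<open>v\<close> vanishes.\<close>
        define s where "s = min (e / (4 * (B + 1))) (R / (2 * (norm v + 1)))"
        have s: "s > 0" using e R \<open>B \<ge> 0\<close> by (simp add: s_def add_nonneg_pos)
        have "s * (norm v + 1) \<le> R / 2"
        proof -
          have "s * (norm v + 1) \<le> R / (2 * (norm v + 1)) * (norm v + 1)"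
            by (intro mult_right_mono) (auto simp: s_def)
          also have "\<dots> = R / 2" by (simp add: divide_simps) (use norm_ge_zero[of v] in linarith)
          finally show ?thesis .
        qed
        then have sv: "norm (s *\<^sub>R v) < R / 2" using s by (simp add: algebra_simps)
        have "s * B \<le> e / 4"
        proof -
          have "s * B \<le> (e / (4 * (B + 1))) * B" using \<open>B \<ge> 0\<close>
            by (intro mult_right_mono) (auto simp: s_def)
          also have "\<dots> \<le> e / 4" using \<open>B \<ge> 0\<close> e by (simp add: field_simps)
          finally show ?thesis .
        qed
        \<comment> \<open>The values at the two end points of the step are within
          \<open>s * e / 16\<close> of their limits. The error budget below is then two remainders
          of \<open>s * e / 4\<close> and a difference below \<open>s * e / 4\<close>, in all less
          than \<open>s * e\<close>.\<close>
        define P where "P n \<longleftrightarrow> (holo_fun (f n) (ball x R) \<and> (\<forall>y\<in>ball x R. cmod (f n y) \<le> C))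
            \<and> dist (f n (x + s *\<^sub>R v)) (g (x + s *\<^sub>R v)) < s * e / 16 \<and> dist (f n x) (g x) < s * e / 16" for n
        have "x + s *\<^sub>R v \<in> S" using RS sv R by (auto simp: dist_norm)
        then have "\<forall>\<^sub>F n in F. P n"
          unfolding P_def
          by (intro eventually_conj[OF ev] eventually_conj[OF tendstoD[OF lim] tendstoD[OF lim]])
             (use x s e in auto)
        moreover have "dist (fd (f n) x v) (fd (f m) x v) < e" if n: "P n" and m: "P m" for n m
        proof -
          define d where "d k = f k (x + s *\<^sub>R v) - f k x" for k
          have lin: "fd (f k) x (s *\<^sub>R v) = s *\<^sub>R fd (f k) x v" if "P k" for k
            using holo_fun_has_derivative[of "f k" "ball x R" x] that R
            by (simp add: P_def has_derivative_linear linear_cmul)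
          have a: "cmod (d k - s *\<^sub>R fd (f k) x v) \<le> s * (s * B)" if "P k" for k
            using est[of k "s *\<^sub>R v"] that sv lin[OF that]
            by (simp add: P_def d_def B_def power2_eq_square mult_ac)
          have b: "cmod (d n - d m) < s * e / 4"
          proof -
            have "dist (f n (x + s *\<^sub>R v)) (f m (x + s *\<^sub>R v)) < s * e / 8"
              using n m dist_triangle2[of "f n (x + s *\<^sub>R v)" "f m (x + s *\<^sub>R v)" "g (x + s *\<^sub>R v)"]
              unfolding P_def by linarith
            moreover have "dist (f n x) (f m x) < s * e / 8"
              using n m dist_triangle2[of "f n x" "f m x" "g x"] unfolding P_def by linarith
            moreover have "cmod (d n - d m) \<le> dist (f n (x + s *\<^sub>R v)) (f m (x + s *\<^sub>R v)) + dist (f n x) (f m x)"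
              unfolding d_def dist_norm
              using norm_triangle_ineq4[of "f n (x + s *\<^sub>R v) - f m (x + s *\<^sub>R v)" "f n x - f m x"]
              by (simp add: algebra_simps)
            ultimately show ?thesis by linarith
          qed
          have "cmod (s *\<^sub>R fd (f n) x v - s *\<^sub>R fd (f m) x v)
             \<le> cmod (d n - s *\<^sub>R fd (f n) x v) + cmod (d m - s *\<^sub>R fd (f m) x v) + cmod (d n - d m)"
          proof -
            have "cmod (X - Y) \<le> cmod (d n - X) + cmod (d m - Y) + cmod (d n - d m)" for X Y by norm
            then show ?thesis .
          qed
          also have "\<dots> < 2 * (s * (s * B)) + s * e / 4" using a[OF n] a[OF m] b by linarith
          also have "\<dots> \<le> 2 * (s * (e / 4)) + s * e / 4"
            using \<open>s * B \<le> e / 4\<close> s by (intro add_right_mono mult_left_mono) auto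
          also have "\<dots> < s * e" using s e by (simp add: field_simps)
          finally have "s * cmod (fd (f n) x v - fd (f m) x v) < s * e"
            using s by (simp flip: scaleR_diff_right)
          then show ?thesis using s by (simp add: dist_norm)
        qed
        ultimately show "\<exists>P. eventually P F \<and> (\<forall>xa y. P xa \<and> P y \<longrightarrow> dist (fd (f xa) x v) (fd (f y) x v) < e)"
          by blast
      qed
      then have "convergent_filter (filtermap (\<lambda>n. fd (f n) x v) F)"
        by (rule cauchy_filter_convergent)
      then show ?thesis by (auto simp: convergent_filter_iff filterlim_def)
    qed
    then obtain A where A: "\<And>v. ((\<lambda>n. fd (f n) x v) \<longlongrightarrow> A v) F" by metis
    have lin_ev: "\<forall>\<^sub>F n in F. (f n has_derivative fd (f n) x) (at x) \<and> (\<forall>c v. fd (f n) x (c *s v) = c * fd (f n) x v)"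
      using ev by eventually_elim (use R in \<open>auto intro: holo_fun_has_derivative holo_fun_smult\<close>)
    have Asm: "A (c *s v) = c * A v" for c v
    proof (rule tendsto_unique[OF F A])
      have "((\<lambda>n. c * fd (f n) x v) \<longlongrightarrow> c * A v) F" by (intro tendsto_intros A)
      then show "((\<lambda>n. fd (f n) x (c *s v)) \<longlongrightarrow> c * A v) F"
        by (rule Lim_transform_eventually) (rule eventually_mono[OF lin_ev], simp)
    qed
    have Aadd: "A (u + v) = A u + A v" for u v
    proof (rule tendsto_unique[OF F A])
      have "((\<lambda>n. fd (f n) x u + fd (f n) x v) \<longlongrightarrow> A u + A v) F" by (intro tendsto_intros A)
      then show "((\<lambda>n. fd (f n) x (u + v)) \<longlongrightarrow> A u + A v) F"
        by (rule Lim_transform_eventually)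
           (rule eventually_mono[OF lin_ev], metis has_derivative_linear linear_add)
    qed
    have "linear A" by (rule linearI) (simp_all add: Aadd scaleR_eq_smult Asm scaleR_conv_of_real)
    then have "bounded_linear A" by (simp add: linear_conv_bounded_linear)
    moreover have "cmod (g (x + v) - g x - A v) \<le> 8 * C / R\<^sup>2 * (norm v)\<^sup>2" if v: "norm v < R / 2" for v
    proof (rule tendsto_upperbound)
      have "x + v \<in> S" using RS v R by (auto simp: dist_norm)
      then show "((\<lambda>n. cmod (f n (x + v) - f n x - fd (f n) x v)) \<longlongrightarrow> cmod (g (x + v) - g x - A v)) F"
        by (intro tendsto_intros lim x A)
      show "\<forall>\<^sub>F n in F. cmod (f n (x + v) - f n x - fd (f n) x v) \<le> 8 * C / R\<^sup>2 * (norm v)\<^sup>2"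
        using ev by eventually_elim (rule est[OF _ v])
    qed (rule F)
    ultimately have "(g has_derivative A) (at x)"
      using R by (intro has_derivative_quadratic[where r = "R/2" and B = "8 * C / R\<^sup>2"]) auto
    then show ?thesis using Asm A by blast
  qed note * = this
  show "holo_fun g S" by (rule holo_funI) (use * in blast)
  show "((\<lambda>n. fd (f n) x v) \<longlongrightarrow> fd g x v) F" if "x \<in> S"
    using *[OF that] frechet_derivative_at by metis
qed

lemma holo_map_translate: "holo_map (\<lambda>z. z + c) S"
  unfolding holo_map_def by (simp add: holo_fun_add holo_fun_nth holo_fun_const)

text \<open>Difference quotients with step \<open>s n\<close> are themselves holomorphic and
  converge pointwise to the derivative; the Cauchy estimates for \<open>f\<close> bound them
  locally, so \<open>holo_fun_limit\<close> applies.\<close>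

lemma holo_fun_fd:
  fixes f :: "complex ^ 'n \<Rightarrow> complex"
  assumes f: "holo_fun f S" and S: "open S"
  shows "holo_fun (\<lambda>z. fd f z v) S"
proof -
  define s where "s n = 1 / real (Suc n)" for n
  have s: "s n > 0" for n by (simp add: s_def)
  have slim: "s \<longlonglongrightarrow> 0" unfolding s_def using LIMSEQ_inverse_real_of_nat by (simp add: inverse_eq_divide)
  define q where "q n z = (f (z + s n *\<^sub>R v) - f z) /\<^sub>R s n" for n z
  show ?thesis
  proof (rule holo_fun_limit(1)[of sequentially, where f = q])
    fix x assume x: "x \<in> S"
    have "continuous (at x) f"
      using holo_fun_has_derivative[OF f x] has_derivative_continuous by blast
    then obtain d1 where d1: "d1 > 0" "\<And>y. dist y x < d1 \<Longrightarrow> dist (f y) (f x) < 1"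
      by (metis continuous_at_eps_delta zero_less_one)
    obtain d2 where d2: "d2 > 0" "ball x d2 \<subseteq> S" using S x openE by blast
    \<comment> \<open>A third, so that a ball of radius \<open>2*r\<close> around any point of
      \<open>ball x r\<close> lies in \<open>ball x (3*r)\<close>, where \<open>f\<close> is bounded
      by \<open>C\<close>.\<close>
    define r where "r = min d1 d2 / 3"
    have r: "r > 0" using d1 d2 by (simp add: r_def)
    have sub: "ball x (3*r) \<subseteq> S" using d2 by (auto simp: r_def)
    define C where "C = cmod (f x) + 1"
    have C: "cmod (f y) \<le> C" if "y \<in> ball x (3*r)" for y
    proof -
      have "dist (f y) (f x) < 1" using that by (intro d1) (auto simp: r_def dist_commute)
      then show ?thesis unfolding C_def dist_norm by norm
    qed
    have "C \<ge> 0" by (simp add: C_def)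
    have "\<forall>\<^sub>F n in sequentially. norm (s n *\<^sub>R v) < r"
    proof -
      have "(\<lambda>n. norm (s n *\<^sub>R v)) \<longlonglongrightarrow> norm (0 *\<^sub>R v)" by (intro tendsto_intros slim)
      then show ?thesis using r by (intro order_tendstoD(2)) auto
    qed
    then have ev: "\<forall>\<^sub>F n in sequentially. holo_fun (q n) (ball x r) \<and>
        (\<forall>y\<in>ball x r. cmod (q n y) \<le> C / r * norm v + 2 * C / r\<^sup>2 * (norm v)\<^sup>2)"
    proof eventually_elim
      case (elim n)
      have in3: "y + w \<in> ball x (3*r)" if "y \<in> ball x r" "norm w < 2*r" for y w
      proof -
        have "dist x (y + w) \<le> dist x y + norm w" unfolding dist_norm by norm
        then show ?thesis using that by simp
      qed
      have "holo_fun (\<lambda>z. f (z + s n *\<^sub>R v)) (ball x r)"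
        by (rule holo_fun_compose(1)[OF holo_map_translate f]) (use in3 elim sub r in fastforce)
      moreover have "holo_fun f (ball x r)" using f sub r by (auto intro!: holo_fun_subset[OF f])
      ultimately have 1: "holo_fun (q n) (ball x r)"
        unfolding q_def scaleR_conv_of_real by (intro holo_fun_mult holo_fun_diff holo_fun_const)
      have 2: "cmod (q n y) \<le> C / r * norm v + 2 * C / r\<^sup>2 * (norm v)\<^sup>2" if y: "y \<in> ball x r" for y
      proof -
        have bs: "ball y (2*r) \<subseteq> ball x (3*r)"
        proof
          fix w assume "w \<in> ball y (2*r)"
          then show "w \<in> ball x (3*r)" using in3[OF y, of "w - y"] by (simp add: dist_norm norm_minus_commute)
        qed
        have hf: "holo_fun f (ball y (2*r))" using bs sub holo_fun_subset[OF f] by blast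
        have D: "cmod (fd f y (s n *\<^sub>R v)) \<le> 2 * C / (2*r) * norm (s n *\<^sub>R v)"
          by (rule Cauchy_estimate_fd[OF hf]) (use r C bs in auto)
        have "cmod (f (y + s n *\<^sub>R v) - f y - fd f y (s n *\<^sub>R v)) \<le> 8 * C / (2*r)\<^sup>2 * (norm (s n *\<^sub>R v))\<^sup>2"
          by (rule Cauchy_estimate_fd2[OF hf]) (use r C bs elim in auto)
        moreover have "cmod (a - b) \<le> cmod d + cmod (a - b - d)" for a b d :: complex by norm
        ultimately have "cmod (f (y + s n *\<^sub>R v) - f y) \<le>
           2 * C / (2*r) * norm (s n *\<^sub>R v) + 8 * C / (2*r)\<^sup>2 * (norm (s n *\<^sub>R v))\<^sup>2"
          using D by (meson add_mono order_trans)
        also have "\<dots> = s n * (C / r * norm v + s n * (2 * C / r\<^sup>2 * (norm v)\<^sup>2))"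
          using s[of n] r by (simp add: field_simps power2_eq_square)
        also have "\<dots> \<le> s n * (C / r * norm v + 1 * (2 * C / r\<^sup>2 * (norm v)\<^sup>2))"
          using s[of n] \<open>C \<ge> 0\<close> by (intro mult_left_mono add_left_mono mult_right_mono) (auto simp: s_def)
        finally have "cmod (f (y + s n *\<^sub>R v) - f y) \<le> s n * (C / r * norm v + 2 * C / r\<^sup>2 * (norm v)\<^sup>2)"
          by simp
        then have "inverse (s n) * cmod (f (y + s n *\<^sub>R v) - f y) \<le> inverse (s n) * (s n * (C / r * norm v + 2 * C / r\<^sup>2 * (norm v)\<^sup>2))"
          by (rule mult_left_mono) (use s[of n] in simp)
        also have "\<dots> = C / r * norm v + 2 * C / r\<^sup>2 * (norm v)\<^sup>2" using s[of n] by (simp add: mult.assoc[symmetric])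
        finally show ?thesis unfolding q_def norm_scaleR using s[of n] by simp
      qed
      show ?case using 1 2 by blast
    qed
    have "ball x r \<subseteq> S" using sub r by auto
    then show "\<exists>R>0. \<exists>C. ball x R \<subseteq> S \<and> (\<forall>\<^sub>F n in sequentially. holo_fun (q n) (ball x R) \<and> (\<forall>y\<in>ball x R. cmod (q n y) \<le> C))"
      using ev r by blast
    have "((\<lambda>t. f (x + t *s v)) has_field_derivative fd f x v) (at 0)"
      using holo_fun_line[OF f, of x 0 v] x by simp
    then have "((\<lambda>t. (f (x + t *s v) - f x) / t) \<longlongrightarrow> fd f x v) (at 0)"
      by (simp add: has_field_derivative_iff)
    moreover have "filterlim (\<lambda>n. complex_of_real (s n)) (at 0) sequentially"
      unfolding filterlim_at using tendsto_of_real[OF slim, where 'a = complex] s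
      by (auto simp: less_imp_neq[OF s, symmetric])
    ultimately have "(\<lambda>n. (f (x + complex_of_real (s n) *s v) - f x) / complex_of_real (s n)) \<longlonglongrightarrow> fd f x v"
      by (rule filterlim_compose)
    then show "(\<lambda>n. q n x) \<longlonglongrightarrow> fd f x v"
      by (simp add: q_def scaleR_eq_smult scaleR_conv_of_real divide_inverse mult.commute)
  qed auto
qed

section \<open>Identity theorems\<close>

lemma open_line_set: "open S \<Longrightarrow> open {t. a + t *s v \<in> S}" for a v :: "complex ^ 'n"
  using continuous_open_preimage[of UNIV "\<lambda>t. a + t *s v" S]
    continuous_on_add[OF continuous_on_const linear_continuous_on[OF bounded_linear_smult_left]]
  by (auto simp: vimage_def)

lemma convex_line_set:
  assumes "convex S" shows "convex {t. a + t *s (v :: complex ^ 'n) \<in> S}"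
proof (rule convexI)
  fix x y :: complex and u w :: real
  assume *: "x \<in> {t. a + t *s v \<in> S}" "y \<in> {t. a + t *s v \<in> S}" "u \<ge> 0" "w \<ge> 0" "u + w = 1"
  have "u *\<^sub>R (a + x *s v) + w *\<^sub>R (a + y *s v) \<in> S"
    using * by (intro convexD[OF assms]) auto
  also have "u *\<^sub>R (a + x *s v) + w *\<^sub>R (a + y *s v) = (u + w) *\<^sub>R a + (u *\<^sub>R x + w *\<^sub>R y) *s v"
    by (simp add: vec_eq_iff algebra_simps scaleR_conv_of_real[where 'a = complex])
  finally show "u *\<^sub>R x + w *\<^sub>R y \<in> {t. a + t *s v \<in> S}" using * by simp
qed

text \<open>Convexity makes the set of parameters of the complex line from a point of
  \<open>U\<close> to \<open>b\<close> connected, so the one-variable identity theorem on that line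
  reaches \<open>b\<close>.\<close>

lemma holo_fun_identity_convex:
  fixes f :: "complex ^ 'n \<Rightarrow> complex"
  assumes f: "holo_fun f S" and S: "open S" "convex S"
    and U: "open U" "U \<noteq> {}" "U \<subseteq> S" "\<And>x. x \<in> U \<Longrightarrow> f x = 0" and b: "b \<in> S"
  shows "f b = 0"
proof -
  obtain a where a: "a \<in> U" using U by auto
  define T where "T = {t. a + t *s (b - a) \<in> S}"
  have "(\<lambda>t. f (a + t *s (b - a))) 1 = 0"
  proof (rule analytic_continuation_open[of "{t. a + t *s (b - a) \<in> U}" T "\<lambda>t. f (a + t *s (b - a))" "\<lambda>_. 0"])
    show "open {t. a + t *s (b - a) \<in> U}" "open T"
      unfolding T_def by (rule open_line_set[OF U(1)], rule open_line_set[OF S(1)])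
    show "connected T" unfolding T_def by (rule convex_connected[OF convex_line_set[OF S(2)]])
    show "{t. a + t *s (b - a) \<in> U} \<noteq> {}" using a by (auto intro: exI[of _ 0])
    show "{t. a + t *s (b - a) \<in> U} \<subseteq> T" unfolding T_def using U by auto
    show "(\<lambda>t. f (a + t *s (b - a))) holomorphic_on T"
      by (rule holo_fun_line_holomorphic[OF f]) (simp add: T_def)
    show "1 \<in> T" unfolding T_def using b by simp
  qed (use U in auto)
  then show ?thesis by simp
qed

text \<open>The interior of \<open>Z \<inter> S\<close> is open and closed in \<open>S\<close>.
  \<open>Z\<close> is an arbitrary set because in the main application it is given by relations in
  varying charts, not by the zeros of globally defined functions.\<close>

lemma connected_propagation:
  fixes S :: "'a::metric_space set"
  assumes S: "open S" "connected S" and U: "open U" "U \<noteq> {}" "U \<subseteq> S" "U \<subseteq> Z"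
    and loc: "\<And>x. x \<in> S \<Longrightarrow> \<exists>r>0. ball x r \<subseteq> S \<and>
        (\<forall>V. open V \<longrightarrow> V \<noteq> {} \<longrightarrow> V \<subseteq> ball x r \<longrightarrow> V \<subseteq> Z \<longrightarrow> ball x r \<subseteq> Z)"
  shows "S \<subseteq> Z"
proof -
  define W where "W = interior (Z \<inter> S)"
  have "openin (top_of_set S) W" unfolding W_def using S
    by (metis Int_commute inf.absorb2 interior_subset le_inf_iff open_interior openin_open)
  moreover have "closedin (top_of_set S) W"
    unfolding closedin_limpt
  proof safe
    show "x \<in> S" if "x \<in> W" for x using that interior_subset unfolding W_def by blast
    fix x assume x: "x islimpt W" "x \<in> S"
    obtain r where r: "r > 0" "ball x r \<subseteq> S"
      "\<And>V. open V \<Longrightarrow> V \<noteq> {} \<Longrightarrow> V \<subseteq> ball x r \<Longrightarrow> V \<subseteq> Z \<Longrightarrow> ball x r \<subseteq> Z"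
      using loc[OF x(2)] by blast
    have "ball x r \<inter> W \<noteq> {}" using x(1) r(1) unfolding islimpt_def
      by (metis centre_in_ball disjoint_iff open_ball)
    moreover have "open (ball x r \<inter> W)" unfolding W_def by auto
    moreover have "ball x r \<inter> W \<subseteq> Z" unfolding W_def using interior_subset by blast
    ultimately have "ball x r \<subseteq> Z \<inter> S" using r(2) r(3)[of "ball x r \<inter> W"] by blast
    then show "x \<in> W" unfolding W_def using r(1) by (metis centre_in_ball interiorI open_ball)
  qed
  moreover have "W \<noteq> {}" using U unfolding W_def
    by (metis Int_greatest interior_maximal subset_empty)
  ultimately have "W = S" using S(2) unfolding connected_clopen by blast
  then show ?thesis unfolding W_def using interior_subset by blast
qed

lemma holo_fun_identity:
  fixes f g :: "complex ^ 'n \<Rightarrow> complex"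
  assumes S: "open S" "connected S" and f: "holo_fun f S" and g: "holo_fun g S"
    and U: "open U" "U \<noteq> {}" "U \<subseteq> S" "\<And>x. x \<in> U \<Longrightarrow> f x = g x" and b: "b \<in> S"
  shows "f b = g b"
proof -
  have "S \<subseteq> {x. f x - g x = 0}"
  proof (rule connected_propagation[OF S U(1-3)])
    show "U \<subseteq> {x. f x - g x = 0}" using U(4) by auto
    fix x assume "x \<in> S"
    then obtain r where r: "r > 0" "ball x r \<subseteq> S" using S openE by blast
    have h: "holo_fun (\<lambda>x. f x - g x) (ball x r)"
      using holo_fun_diff[OF f g] r holo_fun_subset by blast
    show "\<exists>r>0. ball x r \<subseteq> S \<and> (\<forall>V. open V \<longrightarrow> V \<noteq> {} \<longrightarrow> V \<subseteq> ball x r \<longrightarrow> V \<subseteq> {x. f x - g x = 0} \<longrightarrow> ball x r \<subseteq> {x. f x - g x = 0})"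
      using holo_fun_identity_convex[OF h open_ball convex_ball] r by (intro exI[of _ r]) blast
  qed
  then show ?thesis using b by auto
qed

section \<open>Doubling of variables and polarization\<close>

text \<open>Doubled variables turn a function holomorphic in \<open>z\<close> and antiholomorphic in
  \<open>w\<close> into a holomorphic function of the pair formed by \<open>z\<close> and the
  conjugate of \<open>w\<close>; the index type is a sum so that the pair is again a vector to which
  \<open>holo_fun\<close> applies.\<close>

definition vpair :: "complex ^ 'n \<Rightarrow> complex ^ 'm \<Rightarrow> complex ^ ('n::finite + 'm::finite)" where
  "vpair a b = (\<chi> s. case s of Inl i \<Rightarrow> a $ i | Inr j \<Rightarrow> b $ j)"

definition vfst :: "complex ^ ('n::finite + 'm::finite) \<Rightarrow> complex ^ 'n" where "vfst x = (\<chi> i. x $ Inl i)"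

definition vsnd :: "complex ^ ('n::finite + 'm::finite) \<Rightarrow> complex ^ 'm" where "vsnd x = (\<chi> i. x $ Inr i)"

definition vcnj :: "complex ^ 'n \<Rightarrow> complex ^ 'n" where "vcnj v = (\<chi> i. cnj (v $ i))"

definition vdiag :: "complex ^ 'n \<Rightarrow> complex ^ ('n::finite + 'n)" where "vdiag z = vpair z (vcnj z)"

text \<open>The product of \<open>U\<close> with its complex conjugate. The image of
  \<open>U\<close> under \<open>vdiag\<close> is its totally real diagonal.\<close>

definition dbl :: "(complex ^ 'n) set \<Rightarrow> (complex ^ ('n::finite + 'n)) set" where
  "dbl U = {x. vfst x \<in> U \<and> vcnj (vsnd x) \<in> U}"

lemma vpair_simps [simp]:
  "vfst (vpair a b) = a" "vsnd (vpair a b) = b" "vpair (vfst x) (vsnd x) = x"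
  "vcnj (vcnj v) = v" "vcnj 0 = 0" "vcnj (u + v) = vcnj u + vcnj v" "vcnj (u - v) = vcnj u - vcnj v"
  "vfst (x + y) = vfst x + vfst y" "vsnd (x + y) = vsnd x + vsnd y"
  "vfst (c *s x) = c *s vfst x" "vsnd (c *s x) = c *s vsnd x"
  "vcnj (c *s v) = cnj c *s vcnj v" "vpair 0 0 = 0" "vcnj v $ i = cnj (v $ i)"
  by (auto simp: vpair_def vfst_def vsnd_def vcnj_def vec_eq_iff split: sum.splits)

lemma vpair_arith:
  "vpair a b + vpair c d = vpair (a + c) (b + d)" "t *s vpair a b = vpair (t *s a) (t *s b)"
  by (auto simp: vpair_def vec_eq_iff split: sum.splits)

lemma bounded_linear_vops:
  "bounded_linear (vfst :: _ \<Rightarrow> complex ^ 'n)" "bounded_linear (vsnd :: _ \<Rightarrow> complex ^ 'm)"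
  "bounded_linear (vcnj :: complex ^ 'n \<Rightarrow> _)" "bounded_linear (vdiag :: complex ^ 'n \<Rightarrow> _)"
  by (auto simp: linear_conv_bounded_linear[symmetric] vfst_def vsnd_def vcnj_def vdiag_def vpair_def vec_eq_iff
      scaleR_conv_of_real[where 'a = complex] intro!: linearI split: sum.splits)

lemma open_dbl: assumes "open U" shows "open (dbl U)"
proof -
  have "dbl U = vfst -` U \<inter> (\<lambda>x. vcnj (vsnd x)) -` U" by (auto simp: dbl_def)
  moreover have "continuous_on UNIV vfst" "continuous_on UNIV (\<lambda>x :: complex ^ ('n::finite + 'n). vcnj (vsnd x))"
    using bounded_linear_vops(1) bounded_linear_compose[OF bounded_linear_vops(3,2)]
    by (auto intro: linear_continuous_on)
  ultimately show ?thesis using assms by (metis open_Int open_vimage)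
qed

lemma convex_dbl: assumes "convex U" shows "convex (dbl U)"
proof -
  have "dbl U = vfst -` U \<inter> (\<lambda>x. vcnj (vsnd x)) -` U" by (auto simp: dbl_def)
  then show ?thesis
    using assms bounded_linear_vops(1) bounded_linear_compose[OF bounded_linear_vops(3,2)]
    by (auto intro!: convex_Int convex_linear_vimage bounded_linear.linear)
qed

lemma vdiag_in_dbl [simp]: "vdiag z \<in> dbl U \<longleftrightarrow> z \<in> U"
  by (simp add: vdiag_def dbl_def)

lemma vpair_in_dbl [simp]: "vpair z (vcnj w) \<in> dbl U \<longleftrightarrow> z \<in> U \<and> w \<in> U"
  by (simp add: dbl_def)

lemma dbl_mono: "U \<subseteq> V \<Longrightarrow> dbl U \<subseteq> dbl V"
  by (auto simp: dbl_def)

lemma holo_map_vfst: "holo_map vfst S"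
  unfolding holo_map_def vfst_def by (simp add: holo_fun_nth)

lemma holo_map_vsnd: "holo_map vsnd S"
  unfolding holo_map_def vsnd_def by (simp add: holo_fun_nth)

lemma holo_map_vpair:
  assumes "holo_map F S" "holo_map G S"
  shows "holo_map (\<lambda>x. vpair (F x) (G x)) S"
  unfolding holo_map_def
proof
  show "holo_fun (\<lambda>z. vpair (F z) (G z) $ i) S" for i
    using assms unfolding holo_map_def vpair_def by (cases i) auto
qed

lemma holo_fun_vcnj:
  assumes "holo_fun f S"
  shows "holo_fun (\<lambda>x. cnj (f (vcnj x))) (vcnj ` S)"
proof -
  have D: "((\<lambda>x. cnj (f (vcnj x))) has_derivative (\<lambda>v. cnj (fd f z (vcnj v)))) (at (vcnj z))" if "z \<in> S" for z
  proof -
    have "(vcnj has_derivative vcnj) (at (vcnj z))"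
      by (rule bounded_linear_imp_has_derivative[OF bounded_linear_vops(3)])
    from diff_chain_at[OF this, of f "fd f z"] holo_fun_has_derivative[OF assms that]
    have "((\<lambda>x. f (vcnj x)) has_derivative (\<lambda>v. fd f z (vcnj v))) (at (vcnj z))" by (simp add: o_def)
    then show ?thesis by (rule has_derivative_cnj)
  qed
  show "holo_fun (\<lambda>x. cnj (f (vcnj x))) (vcnj ` S)"
  proof (rule holo_funI)
    fix x assume "x \<in> vcnj ` S"
    then obtain z where z: "z \<in> S" "x = vcnj z" by auto
    show "\<exists>f'. ((\<lambda>x. cnj (f (vcnj x))) has_derivative f') (at x) \<and> (\<forall>c v. f' (c *s v) = c * f' v)"
      using D[OF z(1)] holo_fun_smult[OF assms z(1)] z by (intro exI[of _ "\<lambda>v. cnj (fd f z (vcnj v))"]) simp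
  qed
qed

lemma holo_fun_fd_linear:
  assumes "holo_fun f S" "z \<in> S"
  shows "linear (fd f z)"
  using holo_fun_has_derivative[OF assms] has_derivative_linear by blast

lemma holo_fun_fd_sum:
  assumes "holo_fun f S" "z \<in> S"
  shows "fd f z (\<Sum>k\<in>K. c k *s v k) = (\<Sum>k\<in>K. c k * fd f z (v k))"
  using holo_fun_fd_linear[OF assms] by (simp add: linear_sum holo_fun_smult[OF assms])

text \<open>\<open>vdiag\<close> is only real linear: it sends \<open>axis j 1\<close> to the sum of
  the two block directions and \<open>axis j \<i>\<close> to \<i> times their difference. The
  Wirtinger combinations isolate one block each.\<close>

lemma wirtinger_vdiag:
  assumes G: "holo_fun G (dbl U)" and z: "z \<in> U"
  shows "wirtinger j (\<lambda>z. G (vdiag z)) z = fd G (vdiag z) (vpair (axis j 1) 0)"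
    and "wirtinger_bar j (\<lambda>z. G (vdiag z)) z = fd G (vdiag z) (vpair 0 (axis j 1))"
proof -
  let ?D = "fd G (vdiag z)"
  have zi: "vdiag z \<in> dbl U" using z by simp
  have "((\<lambda>z. G (vdiag z)) has_derivative (\<lambda>v. ?D (vdiag v))) (at z)"
    using diff_chain_at[OF bounded_linear_imp_has_derivative[OF bounded_linear_vops(4)]
        holo_fun_has_derivative[OF G zi]] by (simp add: o_def)
  then have fdG: "fd (\<lambda>z. G (vdiag z)) z = (\<lambda>v. ?D (vdiag v))" using frechet_derivative_at by metis
  have "vdiag (axis j 1) = vpair (axis j 1) 0 + vpair 0 (axis j 1)"
    by (auto simp: vdiag_def vpair_def vcnj_def vec_eq_iff axis_def split: sum.splits)
  then have 1: "?D (vdiag (axis j 1)) = ?D (vpair (axis j 1) 0) + ?D (vpair 0 (axis j 1))"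
    using holo_fun_fd_linear[OF G zi] by (simp add: linear_add)
  have "vdiag (axis j \<i>) = \<i> *s vpair (axis j 1) 0 + (-\<i>) *s vpair 0 (axis j 1)"
    by (auto simp: vdiag_def vpair_def vcnj_def vec_eq_iff axis_def split: sum.splits)
  then have 2: "?D (vdiag (axis j \<i>)) = \<i> * ?D (vpair (axis j 1) 0) - \<i> * ?D (vpair 0 (axis j 1))"
    using holo_fun_fd_linear[OF G zi] holo_fun_smult[OF G zi] by (simp add: linear_diff)
  show "wirtinger j (\<lambda>z. G (vdiag z)) z = fd G (vdiag z) (vpair (axis j 1) 0)"
    and "wirtinger_bar j (\<lambda>z. G (vdiag z)) z = fd G (vdiag z) (vpair 0 (axis j 1))"
    unfolding wirtinger_def wirtinger_bar_def fdG 1 2 by (auto simp: algebra_simps)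
qed

text \<open>The polarized complex Hessian: \<open>a\<close> is a direction in the holomorphic block
  and \<open>b\<close> in the conjugate block, so a tangent vector \<open>v\<close> in the second
  slot of the metric appears as \<open>b = vcnj v\<close>.\<close>

definition mixed :: "(complex ^ ('n::finite + 'n) \<Rightarrow> complex) \<Rightarrow> complex ^ ('n::finite + 'n) \<Rightarrow> complex ^ 'n \<Rightarrow> complex ^ 'n \<Rightarrow> complex" where
  "mixed G x a b = fd (\<lambda>y. fd G y (vpair 0 b)) x (vpair a 0)"

lemma tensor_eval_complex_hessian:
  assumes G: "holo_fun G (dbl U)" and U: "open U" and z: "z \<in> U"
  shows "tensor_eval (complex_hessian (\<lambda>z. G (vdiag z)) z) u v = mixed G (vdiag z) u (vcnj v)"
proof -
  let ?e = "\<lambda>k. axis k (1::complex) :: complex ^ 'a"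
  have zi: "vdiag z \<in> dbl U" using z by simp
  have h: "holo_fun (\<lambda>y. fd G y b) (dbl U)" for b
    using holo_fun_fd[OF G open_dbl[OF U]] .
  have hess: "complex_hessian (\<lambda>z. G (vdiag z)) z $ j $ k = mixed G (vdiag z) (?e j) (?e k)" for j k
  proof -
    have "fd (wirtinger_bar k (\<lambda>z. G (vdiag z))) z = fd (\<lambda>z. fd G (vdiag z) (vpair 0 (?e k))) z"
      using wirtinger_vdiag(2)[OF G] by (intro fd_cong[OF U z]) auto
    then have "wirtinger j (wirtinger_bar k (\<lambda>z. G (vdiag z))) z = wirtinger j (\<lambda>z. fd G (vdiag z) (vpair 0 (?e k))) z"
      unfolding wirtinger_def by simp
    then show ?thesis unfolding complex_hessian_def mixed_def using wirtinger_vdiag(1)[OF h z] by simp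
  qed
  have b: "vpair 0 b = (\<Sum>k\<in>UNIV. b $ k *s vpair 0 (?e k))" for b :: "complex ^ 'a"
    by (auto simp: vec_eq_iff vpair_def axis_def sum.delta' if_distrib split: sum.splits cong: if_cong)
  have a: "vpair a 0 = (\<Sum>k\<in>UNIV. a $ k *s vpair (?e k) 0)" for a :: "complex ^ 'a"
    by (auto simp: vec_eq_iff vpair_def axis_def sum.delta' if_distrib split: sum.splits cong: if_cong)
  have "mixed G (vdiag z) u (vcnj v) = fd (\<lambda>y. \<Sum>k\<in>UNIV. vcnj v $ k * fd G y (vpair 0 (?e k))) (vdiag z) (vpair u 0)"
  proof -
    have "fd G y (vpair 0 (vcnj v)) = (\<Sum>k\<in>UNIV. vcnj v $ k * fd G y (vpair 0 (?e k)))" if "y \<in> dbl U" for y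
      by (subst b, rule holo_fun_fd_sum[OF G that])
    from fd_cong[OF open_dbl[OF U] zi this] show ?thesis unfolding mixed_def by (rule fun_cong)
  qed
  also have "\<dots> = (\<Sum>k\<in>UNIV. vcnj v $ k * fd (\<lambda>y. fd G y (vpair 0 (?e k))) (vdiag z) (vpair u 0))"
  proof -
    have "((\<lambda>y. \<Sum>k\<in>UNIV. vcnj v $ k * fd G y (vpair 0 (?e k))) has_derivative
       (\<lambda>w. \<Sum>k\<in>UNIV. vcnj v $ k * fd (\<lambda>y. fd G y (vpair 0 (?e k))) (vdiag z) w)) (at (vdiag z))"
      by (intro has_derivative_sum has_derivative_mult_right holo_fun_has_derivative[OF h zi])
    from frechet_derivative_at[OF this, symmetric] show ?thesis by (rule fun_cong)
  qed
  also have "\<dots> = (\<Sum>k\<in>UNIV. vcnj v $ k * (\<Sum>j\<in>UNIV. u $ j * mixed G (vdiag z) (?e j) (?e k)))"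
    unfolding mixed_def by (subst a, subst holo_fun_fd_sum[OF h zi]) (rule refl)
  also have "\<dots> = (\<Sum>j\<in>UNIV. \<Sum>k\<in>UNIV. mixed G (vdiag z) (?e j) (?e k) * u $ j * cnj (v $ k))"
    by (subst sum.swap) (simp add: sum_distrib_left mult_ac)
  finally show ?thesis unfolding tensor_eval_def hess by simp
qed

text \<open>The diagonal is totally real of maximal dimension. Every point of \<open>dbl U\<close>
  lies, at parameter \<i>, on a complex line whose real parameters trace the diagonal, so zeros on a
  real interval already force the zero at the point.\<close>

lemma polarization:
  fixes E :: "complex ^ ('n::finite + 'n) \<Rightarrow> complex"
  assumes E: "holo_fun E (dbl U)" and U: "open U" "convex U"
    and 0: "\<And>z. z \<in> U \<Longrightarrow> E (vdiag z) = 0" and x: "x \<in> dbl U"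
  shows "E x = 0"
proof -
  define a where "a = vfst x"
  define b where "b = vcnj (vsnd x)"
  have ab: "a \<in> U" "b \<in> U" using x by (auto simp: a_def b_def dbl_def)
  have xab: "x = vpair a (vcnj b)" by (simp add: a_def b_def)
  \<comment> \<open>Chosen so that \<open>m + \<i> *s d = a\<close> and
    \<open>m - \<i> *s d = b\<close>; conjugating the second equation gives the second block of
    \<open>x\<close> at parameter \<i>.\<close>
  define m where "m = (1/2) *s (a + b)"
  define d where "d = (-\<i>/2) *s (a - b)"
  define T where "T = {t. vdiag m + t *s vdiag d \<in> dbl U}"
  have mU: "m \<in> U"
    using convexD[OF U(2) ab, of "1/2" "1/2"] by (simp add: m_def scaleR_eq_smult vector_add_ldistrib)
  have real: "vdiag m + complex_of_real s *s vdiag d = vdiag (m + s *\<^sub>R d)" for s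
    by (auto simp: vdiag_def vpair_def vcnj_def vec_eq_iff scaleR_conv_of_real[where 'a = complex] split: sum.splits)
  have i: "vdiag m + \<i> *s vdiag d = x"
    unfolding xab by (auto simp: vdiag_def vpair_def vcnj_def vec_eq_iff m_def d_def field_simps split: sum.splits)
  have T: "open T" "connected T" unfolding T_def
    using U by (auto intro!: open_line_set open_dbl convex_connected convex_line_set convex_dbl)
  have 0: "0 \<in> T" unfolding T_def using mU by simp
  obtain e where e: "e > 0" "ball 0 e \<subseteq> T" using T 0 openE by blast
  have "(\<lambda>t. E (vdiag m + t *s vdiag d)) \<i> = 0"
  proof (rule analytic_continuation[of "\<lambda>t. E (vdiag m + t *s vdiag d)" T "complex_of_real ` {0<..<e}" 0])
    show "complex_of_real ` {0<..<e} \<subseteq> T" using e(2) by (auto simp: subset_iff)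
    show "E (vdiag m + z *s vdiag d) = 0" if "z \<in> complex_of_real ` {0<..<e}" for z
    proof -
      have "z \<in> T" using that e(2) by (auto simp: subset_iff)
      then show ?thesis using that real unfolding T_def by (auto intro!: assms(4))
    qed
    show "0 islimpt complex_of_real ` {0<..<e}"
      unfolding islimpt_approachable
    proof safe
      fix \<epsilon> :: real assume "\<epsilon> > 0"
      then show "\<exists>x'\<in>complex_of_real ` {0<..<e}. x' \<noteq> 0 \<and> dist x' 0 < \<epsilon>"
        using e by (intro bexI[OF _ imageI[of "min e \<epsilon> / 2"]]) (auto simp: norm_divide)
    qed
    show "\<i> \<in> T" unfolding T_def using i x by simp
    show "(\<lambda>t. E (vdiag m + t *s vdiag d)) holomorphic_on T"
      by (rule holo_fun_line_holomorphic[OF E]) (simp add: T_def)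
  qed (use T 0 in auto)
  then show ?thesis using i by simp
qed

lemma holo_fun_constant_on_line:
  fixes f :: "complex ^ 'n \<Rightarrow> complex"
  assumes f: "holo_fun f S" and S: "convex S" "a \<in> S" "b \<in> S"
    and 0: "\<And>x. x \<in> S \<Longrightarrow> fd f x (b - a) = 0"
  shows "f a = f b"
proof -
  define T where "T = {t. a + t *s (b - a) \<in> S}"
  have "convex T" unfolding T_def by (rule convex_line_set[OF S(1)])
  moreover have "((\<lambda>t. f (a + t *s (b - a))) has_field_derivative 0) (at t within T)" if "t \<in> T" for t
    using holo_fun_line[OF f, of a t "b - a"] 0 that by (auto simp: T_def intro: has_field_derivative_at_within)
  ultimately obtain c where c: "\<And>t. t \<in> T \<Longrightarrow> f (a + t *s (b - a)) = c"
    using has_field_derivative_zero_constant by metis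
  from c[of 0] c[of 1] S show ?thesis by (simp add: T_def)
qed

text \<open>A function with vanishing mixed derivatives is a sum of a function of \<open>z\<close>
  and a function of the conjugate of \<open>w\<close>. The four-point form avoids choosing the two
  summands; after exponentiation it says that the quotient of two kernels has rank one.\<close>

lemma mixed_zero_separates:
  fixes L :: "complex ^ ('n::finite + 'n) \<Rightarrow> complex"
  assumes L: "holo_fun L (dbl U)" and U: "open U" "convex U"
    and 0: "\<And>x a b. x \<in> dbl U \<Longrightarrow> mixed L x a b = 0"
    and m: "z \<in> U" "w \<in> U" "z' \<in> U" "w' \<in> U"
  shows "L (vpair z (vcnj w)) + L (vpair z' (vcnj w')) = L (vpair z (vcnj w')) + L (vpair z' (vcnj w))"
proof -
  \<comment> \<open>Integration in the first block: the derivative in the second block does not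
    depend on the first variable. A second integration, along the conjugate block, follows
    below.\<close>
  have const: "fd L (vpair z y) (vpair 0 b) = fd L (vpair z' y) (vpair 0 b)" if y: "vcnj y \<in> U" for y b
  proof (rule holo_fun_constant_on_line[OF holo_fun_fd[OF L open_dbl[OF U(1)]] convex_dbl[OF U(2)]])
    show "vpair z y \<in> dbl U" "vpair z' y \<in> dbl U" using y m by (auto simp: dbl_def)
    fix x assume "x \<in> dbl U"
    moreover have "vpair z' y - vpair z y = vpair (z' - z) 0"
      by (auto simp: vpair_def vec_eq_iff split: sum.splits)
    ultimately show "fd (\<lambda>x. fd L x (vpair 0 b)) x (vpair z' y - vpair z y) = 0"
      using 0 unfolding mixed_def by simp
  qed
  define V where "V = {y :: complex ^ 'n. vcnj y \<in> U}"
  have V: "convex V" 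
    unfolding V_def using convex_linear_vimage[OF bounded_linear.linear[OF bounded_linear_vops(3)] U(2)]
    by (simp add: vimage_def)
  have hp: "holo_map (vpair z) V" for z :: "complex ^ 'n"
    by (rule holo_map_vpair) (auto simp: holo_map_def holo_fun_nth holo_fun_const)
  have im: "vpair z ` V \<subseteq> dbl U" if "z \<in> U" for z using that by (auto simp: V_def dbl_def)
  have fdp: "fd (vpair z) y v = vpair 0 v" for z y v :: "complex ^ 'n"
  proof -
    have "((\<lambda>y. vpair z 0 + vpair 0 y) has_derivative (\<lambda>v. vpair 0 v)) (at y)"
    proof -
      have "bounded_linear (vpair 0 :: complex ^ 'n \<Rightarrow> complex ^ ('n::finite + 'n))"
        by (auto simp: linear_conv_bounded_linear[symmetric] vpair_def vec_eq_iff intro!: linearI split: sum.splits)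
      from bounded_linear_imp_has_derivative[OF this] show ?thesis
        by (auto intro!: derivative_eq_intros)
    qed
    then have "(vpair z has_derivative (\<lambda>v. vpair 0 v)) (at y)" by (simp add: vpair_arith)
    then show ?thesis using frechet_derivative_at by metis
  qed
  have 1: "holo_fun (\<lambda>y. L (vpair z y)) V" "holo_fun (\<lambda>y. L (vpair z' y)) V"
    using holo_fun_compose(1)[OF hp L im] m by auto
  have 2: "fd (\<lambda>y. L (vpair z y)) y v = fd L (vpair z y) (vpair 0 v)" if "z \<in> U" "y \<in> V" for z y v
    using holo_fun_compose(2)[OF hp L im[OF that(1)] that(2)] fdp by simp
  have "(\<lambda>y. L (vpair z y) - L (vpair z' y)) (vcnj w) = (\<lambda>y. L (vpair z y) - L (vpair z' y)) (vcnj w')"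
  proof (rule holo_fun_constant_on_line[OF holo_fun_diff[OF 1] V])
    show "vcnj w \<in> V" "vcnj w' \<in> V" using m by (auto simp: V_def)
    fix y assume y: "y \<in> V"
    let ?v = "vcnj w' - vcnj w"
    have "fd (\<lambda>y. L (vpair z y) - L (vpair z' y)) y = (\<lambda>v. fd (\<lambda>y. L (vpair z y)) y v - fd (\<lambda>y. L (vpair z' y)) y v)"
      by (rule frechet_derivative_at[symmetric], rule has_derivative_diff) (use holo_fun_has_derivative[OF 1(1) y] holo_fun_has_derivative[OF 1(2) y] in auto)
    then show "fd (\<lambda>y. L (vpair z y) - L (vpair z' y)) y ?v = 0"
      using 2[OF m(1) y] 2[OF m(3) y] const[of y ?v] y by (simp add: V_def)
  qed
  then show ?thesis by (simp add: algebra_simps)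
qed

section \<open>Square summable families of holomorphic functions\<close>

text \<open>The bound is on finite partial sums, so that it can be stated before any summability is
  known and for index sets of any size.\<close>

definition sq_bounded :: "'j set \<Rightarrow> ('j \<Rightarrow> complex) \<Rightarrow> real \<Rightarrow> bool" where
  "sq_bounded J a C \<longleftrightarrow> (\<forall>F. finite F \<longrightarrow> F \<subseteq> J \<longrightarrow> (\<Sum>j\<in>F. (cmod (a j))\<^sup>2) \<le> C)"

text \<open>In other words, a locally bounded map into the square summable sequences over
  \<open>J\<close> with holomorphic components.\<close>

definition sq_bounded_family :: "'j set \<Rightarrow> ('j \<Rightarrow> complex ^ 'n \<Rightarrow> complex) \<Rightarrow> (complex ^ 'n) set \<Rightarrow> bool" where
  "sq_bounded_family J g S \<longleftrightarrow> (\<forall>j\<in>J. holo_fun (g j) S) \<and>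
     (\<forall>x\<in>S. \<exists>R>0. \<exists>C. ball x R \<subseteq> S \<and> (\<forall>y\<in>ball x R. sq_bounded J (\<lambda>j. g j y) C))"

lemma sq_bounded_nonneg: "sq_bounded J a C \<Longrightarrow> C \<ge> 0"
  unfolding sq_bounded_def by (metis empty_subsetI finite.emptyI sum.empty)

lemma cmod_mult_cnj_le: "cmod (a * cnj b) \<le> ((cmod a)\<^sup>2 + (cmod b)\<^sup>2) / 2"
  using sum_squares_bound[of "cmod a" "cmod b"] by (simp add: norm_mult)

lemma sq_bounded_sum_le:
  assumes "sq_bounded J a A" "sq_bounded J b B" "finite F" "F \<subseteq> J"
  shows "cmod (\<Sum>j\<in>F. a j * cnj (b j)) \<le> (A + B) / 2"
proof -
  have "cmod (\<Sum>j\<in>F. a j * cnj (b j)) \<le> (\<Sum>j\<in>F. ((cmod (a j))\<^sup>2 + (cmod (b j))\<^sup>2) / 2)"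
    by (rule sum_norm_le) (rule cmod_mult_cnj_le)
  also have "\<dots> = ((\<Sum>j\<in>F. (cmod (a j))\<^sup>2) + (\<Sum>j\<in>F. (cmod (b j))\<^sup>2)) / 2"
    by (simp add: sum.distrib flip: sum_divide_distrib)
  also have "\<dots> \<le> (A + B) / 2"
    using assms unfolding sq_bounded_def by (intro divide_right_mono add_mono) auto
  finally show ?thesis .
qed

lemma sq_bounded_summable:
  assumes "sq_bounded J a A"
  shows "(\<lambda>j. (cmod (a j))\<^sup>2) summable_on J"
  using assms unfolding sq_bounded_def
  by (intro nonneg_bdd_above_summable_on) (auto intro!: bdd_aboveI2)

lemma sq_bounded_summable_mult:
  assumes "sq_bounded J a A" "sq_bounded J b B"
  shows "(\<lambda>j. a j * cnj (b j)) summable_on J"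
proof (rule abs_summable_summable, rule Infinite_Sum.abs_summable_on_comparison_test')
  show "(\<lambda>j. ((cmod (a j))\<^sup>2 + (cmod (b j))\<^sup>2) / 2) summable_on J"
    using summable_on_cmult_left[OF summable_on_add[OF assms[THEN sq_bounded_summable]], of "1/2"] by simp
qed (rule cmod_mult_cnj_le)

lemma has_sum_norm_square:
  assumes "((\<lambda>j. a j * cnj (a j)) has_sum k) J"
  shows "sq_bounded J a (Re k)" and "((\<lambda>j. (cmod (a j))\<^sup>2) has_sum Re k) J" and "Im k = 0"
proof -
  have "((\<lambda>j. Re (a j * cnj (a j))) has_sum Re k) J" using has_sum_Re[OF assms] by (simp add: o_def)
  then show *: "((\<lambda>j. (cmod (a j))\<^sup>2) has_sum Re k) J" by (simp add: complex_mult_cnj cmod_power2)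
  have "((\<lambda>j. Im (a j * cnj (a j))) has_sum Im k) J" using has_sum_Im[OF assms] by (simp add: o_def)
  then have "((\<lambda>j. 0) has_sum Im k) J" by (simp add: complex_mult_cnj)
  then show "Im k = 0" by (metis has_sum_0 has_sum_unique)
  show "sq_bounded J a (Re k)"
    unfolding sq_bounded_def
  proof (intro allI impI)
    fix F assume "finite F" "F \<subseteq> J"
    then show "(\<Sum>j\<in>F. (cmod (a j))\<^sup>2) \<le> Re k"
      using has_sum_mono2[OF has_sum_finite[of F] *] by auto
  qed
qed

text \<open>The means of passing from kernels back to functions: the squared norm of a difference
  expands into kernel values, and if they cancel then each component vanishes.\<close>

lemma has_sum_norm_square_0:
  assumes "((\<lambda>j. a j * cnj (a j)) has_sum 0) J" "j \<in> J"
  shows "a j = 0"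
  using has_sum_norm_square(1)[OF assms(1)] assms(2) unfolding sq_bounded_def
  by (auto dest: spec[of _ "{j}"])

lemma sq_bounded_combination:
  assumes "sq_bounded J a A" "sq_bounded J b B"
  shows "sq_bounded J (\<lambda>j. a j - c * b j) (2 * A + 2 * (cmod c)\<^sup>2 * B)"
  unfolding sq_bounded_def
proof (intro allI impI)
  fix F assume F: "finite F" "F \<subseteq> J"
  have "(cmod (x - y))\<^sup>2 \<le> 2 * (cmod x)\<^sup>2 + 2 * (cmod y)\<^sup>2" for x y
  proof -
    have "(cmod (x - y))\<^sup>2 \<le> (cmod x + cmod y)\<^sup>2" by (intro power_mono norm_triangle_ineq4) auto
    then show ?thesis using sum_squares_bound[of "cmod x" "cmod y"] by (simp add: power2_sum)
  qed
  then have "(\<Sum>j\<in>F. (cmod (a j - c * b j))\<^sup>2) \<le> (\<Sum>j\<in>F. 2 * (cmod (a j))\<^sup>2 + 2 * (cmod (c * b j))\<^sup>2)"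
    by (intro sum_mono)
  also have "\<dots> = 2 * (\<Sum>j\<in>F. (cmod (a j))\<^sup>2) + 2 * (cmod c)\<^sup>2 * (\<Sum>j\<in>F. (cmod (b j))\<^sup>2)"
    by (simp add: sum.distrib sum_distrib_left norm_mult power_mult_distrib mult_ac)
  also have "\<dots> \<le> 2 * A + 2 * (cmod c)\<^sup>2 * B"
    using assms F unfolding sq_bounded_def by (intro add_mono mult_left_mono) auto
  finally show "(\<Sum>j\<in>F. (cmod (a j - c * b j))\<^sup>2) \<le> 2 * A + 2 * (cmod c)\<^sup>2 * B" .
qed

lemma sq_bounded_family_at:
  assumes "sq_bounded_family J g S" "x \<in> S"
  obtains C where "sq_bounded J (\<lambda>j. g j x) C"
  using assms unfolding sq_bounded_family_def by (metis centre_in_ball)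

lemma sq_bounded_family_summable:
  assumes "sq_bounded_family J g S" "x \<in> S" "y \<in> S"
  shows "(\<lambda>j. g j x * cnj (g j y)) summable_on J"
  using assms by (metis sq_bounded_family_at sq_bounded_summable_mult)

lemma fd_sum:
  assumes "\<And>i. i \<in> I \<Longrightarrow> holo_fun (f i) S" "x \<in> S"
  shows "fd (\<lambda>z. \<Sum>i\<in>I. f i z) x v = (\<Sum>i\<in>I. fd (f i) x v)"
proof -
  have "((\<lambda>z. \<Sum>i\<in>I. f i z) has_derivative (\<lambda>v. \<Sum>i\<in>I. fd (f i) x v)) (at x)"
    by (rule has_derivative_sum) (use assms holo_fun_has_derivative in blast)
  from frechet_derivative_at[OF this, symmetric] show ?thesis by (rule fun_cong)
qed

lemma fd_mult_const:
  assumes "holo_fun f S" "x \<in> S"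
  shows "fd (\<lambda>z. f z * c) x v = fd f x v * c"
proof -
  have "((\<lambda>z. f z * c) has_derivative (\<lambda>v. fd f x v * c)) (at x)"
    by (rule has_derivative_mult_left) (use assms holo_fun_has_derivative in blast)
  from frechet_derivative_at[OF this, symmetric] show ?thesis by (rule fun_cong)
qed

text \<open>An instance of \<open>holo_fun_limit\<close> along the filter of finite subsets of
  \<open>J\<close>; the convergence of derivatives becomes termwise differentiation of the unordered
  sum.\<close>

lemma finite_sums_limit:
  fixes h :: "'j \<Rightarrow> complex ^ 'n \<Rightarrow> complex"
  assumes h: "\<And>j. j \<in> J \<Longrightarrow> holo_fun (h j) S"
    and bdd: "\<And>x. x \<in> S \<Longrightarrow> \<exists>R>0. \<exists>C. ball x R \<subseteq> S \<and>
       (\<forall>y\<in>ball x R. \<forall>F. finite F \<longrightarrow> F \<subseteq> J \<longrightarrow> cmod (\<Sum>j\<in>F. h j y) \<le> C)"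
    and sum: "\<And>x. x \<in> S \<Longrightarrow> (\<lambda>j. h j x) summable_on J"
  shows "holo_fun (\<lambda>x. \<Sum>\<^sub>\<infinity>j\<in>J. h j x) S"
    and "x \<in> S \<Longrightarrow> ((\<lambda>j. fd (h j) x v) has_sum fd (\<lambda>x. \<Sum>\<^sub>\<infinity>j\<in>J. h j x) x v) J"
proof -
  have 1: "\<exists>R>0. \<exists>C. ball x R \<subseteq> S \<and> (\<forall>\<^sub>F F in finite_subsets_at_top J.
        holo_fun (\<lambda>y. \<Sum>j\<in>F. h j y) (ball x R) \<and> (\<forall>y\<in>ball x R. cmod (\<Sum>j\<in>F. h j y) \<le> C))" if x: "x \<in> S" for x
  proof -
    obtain R C where RC: "R > 0" "ball x R \<subseteq> S"
      "\<forall>y\<in>ball x R. \<forall>F. finite F \<longrightarrow> F \<subseteq> J \<longrightarrow> cmod (\<Sum>j\<in>F. h j y) \<le> C"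
      using bdd[OF x] by blast
    have "holo_fun (\<lambda>y. \<Sum>j\<in>F. h j y) (ball x R) \<and> (\<forall>y\<in>ball x R. cmod (\<Sum>j\<in>F. h j y) \<le> C)"
      if F: "finite F" "F \<subseteq> J" for F
    proof
      show "holo_fun (\<lambda>y. \<Sum>j\<in>F. h j y) (ball x R)"
        using h RC(2) F by (intro holo_fun_sum) (blast intro: holo_fun_subset)
    qed (use RC(3) F in blast)
    then have "\<forall>\<^sub>F F in finite_subsets_at_top J. holo_fun (\<lambda>y. \<Sum>j\<in>F. h j y) (ball x R) \<and>
        (\<forall>y\<in>ball x R. cmod (\<Sum>j\<in>F. h j y) \<le> C)"
      by (rule eventually_finite_subsets_at_top_weakI)
    then show ?thesis using RC(1,2) by blast
  qed
  have 2: "((\<lambda>F. \<Sum>j\<in>F. h j x) \<longlongrightarrow> (\<Sum>\<^sub>\<infinity>j\<in>J. h j x)) (finite_subsets_at_top J)" if "x \<in> S" for x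
    using has_sum_infsum[OF sum[OF that]] by (simp add: has_sum_def)
  note * = holo_fun_limit[where f = "\<lambda>F y. \<Sum>j\<in>F. h j y", OF _ 1 2]
  show "holo_fun (\<lambda>x. \<Sum>\<^sub>\<infinity>j\<in>J. h j x) S" by (rule *) auto
  assume x: "x \<in> S"
  have "((\<lambda>F. fd (\<lambda>y. \<Sum>j\<in>F. h j y) x v) \<longlongrightarrow> fd (\<lambda>x. \<Sum>\<^sub>\<infinity>j\<in>J. h j x) x v) (finite_subsets_at_top J)"
    by (rule *(2)) (use x in auto)
  moreover have "\<forall>\<^sub>F F in finite_subsets_at_top J. fd (\<lambda>y. \<Sum>j\<in>F. h j y) x v = (\<Sum>j\<in>F. fd (h j) x v)"
    by (intro eventually_finite_subsets_at_top_weakI fd_sum[of _ _ S]) (use h x in auto)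
  ultimately show "((\<lambda>j. fd (h j) x v) has_sum fd (\<lambda>x. \<Sum>\<^sub>\<infinity>j\<in>J. h j x) x v) J"
    unfolding has_sum_def by (rule Lim_transform_eventually)
qed

text \<open>With \<open>a j = g j w\<close> the series is the kernel as a function of its first
  argument, so that kernels may be differentiated termwise.\<close>

lemma
  assumes g: "sq_bounded_family J g S" and a: "sq_bounded J a A"
  shows holo_fun_series: "holo_fun (\<lambda>x. \<Sum>\<^sub>\<infinity>j\<in>J. g j x * cnj (a j)) S"
    and has_sum_fd_series: "x \<in> S \<Longrightarrow>
      ((\<lambda>j. fd (g j) x v * cnj (a j)) has_sum fd (\<lambda>x. \<Sum>\<^sub>\<infinity>j\<in>J. g j x * cnj (a j)) x v) J"
proof -
  have hj: "holo_fun (g j) S" if "j \<in> J" for j using g that by (simp add: sq_bounded_family_def)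
  have b: "\<exists>R>0. \<exists>C. ball x R \<subseteq> S \<and>
       (\<forall>y\<in>ball x R. \<forall>F. finite F \<longrightarrow> F \<subseteq> J \<longrightarrow> cmod (\<Sum>j\<in>F. g j y * cnj (a j)) \<le> C)" if x: "x \<in> S" for x
  proof -
    obtain R C where RC: "R > 0" "ball x R \<subseteq> S" "\<And>y. y \<in> ball x R \<Longrightarrow> sq_bounded J (\<lambda>j. g j y) C"
      using g x unfolding sq_bounded_family_def by blast
    then show ?thesis
      by (rule_tac exI[of _ R], intro exI[of _ "(C + A) / 2"] conjI ballI allI impI sq_bounded_sum_le[OF _ a]) auto
  qed
  have s: "(\<lambda>j. g j x * cnj (a j)) summable_on J" if x: "x \<in> S" for x
    by (rule sq_bounded_family_at[OF g x]) (rule sq_bounded_summable_mult[OF _ a])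
  have h: "holo_fun (\<lambda>x. g j x * cnj (a j)) S" if "j \<in> J" for j
    using hj[OF that] by (intro holo_fun_mult holo_fun_const)
  note * = finite_sums_limit[of J "\<lambda>j x. g j x * cnj (a j)" S, OF h b s]
  show "holo_fun (\<lambda>x. \<Sum>\<^sub>\<infinity>j\<in>J. g j x * cnj (a j)) S" by (rule *)
  assume x: "x \<in> S"
  have "((\<lambda>j. fd (\<lambda>x. g j x * cnj (a j)) x v) has_sum fd (\<lambda>x. \<Sum>\<^sub>\<infinity>j\<in>J. g j x * cnj (a j)) x v) J"
    by (rule *(2)) (use x in auto)
  then show "((\<lambda>j. fd (g j) x v * cnj (a j)) has_sum fd (\<lambda>x. \<Sum>\<^sub>\<infinity>j\<in>J. g j x * cnj (a j)) x v) J"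
    by (rule has_sum_cong[THEN iffD1, rotated]) (rule fd_mult_const[OF hj x])
qed

text \<open>The kernel of the family \<open>g\<close>, with \<open>z\<close> and the conjugate of
  \<open>w\<close> as independent holomorphic variables; here \<open>w\<close> is
  \<open>vcnj (vsnd x)\<close>.\<close>

definition polarized :: "'j set \<Rightarrow> ('j \<Rightarrow> complex ^ 'n \<Rightarrow> complex) \<Rightarrow> complex ^ ('n::finite + 'n) \<Rightarrow> complex" where
  "polarized J g x = (\<Sum>\<^sub>\<infinity>j\<in>J. g j (vfst x) * cnj (g j (vcnj (vsnd x))))"

lemma holo_fun_cnj_vcnj_vsnd:
  assumes "holo_fun g S"
  shows "holo_fun (\<lambda>x. cnj (g (vcnj (vsnd x)))) (dbl S)"
proof (rule holo_fun_compose(1)[OF holo_map_vsnd holo_fun_vcnj[OF assms]])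
  show "vsnd ` dbl S \<subseteq> vcnj ` S"
  proof
    fix y assume "y \<in> vsnd ` dbl S"
    then have "vcnj y \<in> S" by (auto simp: dbl_def)
    then show "y \<in> vcnj ` S" by (metis image_eqI vpair_simps(4))
  qed
qed

text \<open>Joint holomorphy comes straight from the partial sums, which are jointly holomorphic and
  locally bounded by the mean of the square bounds at the two points.\<close>

lemma holo_fun_polarized:
  fixes g :: "'j \<Rightarrow> complex ^ 'n::finite \<Rightarrow> complex"
  assumes g: "sq_bounded_family J g S"
  shows "holo_fun (polarized J g) (dbl S)"
  unfolding polarized_def
proof (rule finite_sums_limit(1))
  show "holo_fun (\<lambda>x. g j (vfst x) * cnj (g j (vcnj (vsnd x)))) (dbl S)" if "j \<in> J" for j
  proof -
    have hj: "holo_fun (g j) S" using g that by (simp add: sq_bounded_family_def)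
    have "holo_fun (\<lambda>x. g j (vfst x)) (dbl S)"
      by (rule holo_fun_compose(1)[OF holo_map_vfst hj]) (auto simp: dbl_def)
    then show ?thesis by (intro holo_fun_mult holo_fun_cnj_vcnj_vsnd[OF hj])
  qed
  show "(\<lambda>j. g j (vfst x) * cnj (g j (vcnj (vsnd x)))) summable_on J" if "x \<in> dbl S" for x
    using that by (intro sq_bounded_family_summable[OF g]) (auto simp: dbl_def)
  fix x assume x: "x \<in> dbl S"
  define a b where "a = vfst x" and "b = vcnj (vsnd x)"
  have ab: "a \<in> S" "b \<in> S" using x by (auto simp: a_def b_def dbl_def)
  obtain R C where R: "R > 0" "ball a R \<subseteq> S" "\<And>y. y \<in> ball a R \<Longrightarrow> sq_bounded J (\<lambda>j. g j y) C"
    using g ab unfolding sq_bounded_family_def by blast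
  obtain R' C' where R': "R' > 0" "ball b R' \<subseteq> S" "\<And>y. y \<in> ball b R' \<Longrightarrow> sq_bounded J (\<lambda>j. g j y) C'"
    using g ab unfolding sq_bounded_family_def by blast
  let ?U = "{y. vfst y \<in> ball a R \<and> vcnj (vsnd y) \<in> ball b R'}"
  have "?U = vfst -` ball a R \<inter> (\<lambda>x. vcnj (vsnd x)) -` ball b R'" by auto
  moreover have "continuous_on UNIV (vfst :: complex ^ ('n + 'n) \<Rightarrow> _)" "continuous_on UNIV (\<lambda>x :: complex ^ ('n + 'n). vcnj (vsnd x))"
    using bounded_linear_vops(1) bounded_linear_compose[OF bounded_linear_vops(3,2)]
    by (auto intro: linear_continuous_on)
  ultimately have "open ?U" by (metis open_Int open_vimage open_ball)
  moreover have "x \<in> ?U" using R(1) R'(1) by (simp flip: a_def b_def)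
  ultimately obtain r where r: "r > 0" "ball x r \<subseteq> ?U" by (meson openE)
  show "\<exists>R>0. \<exists>C. ball x R \<subseteq> dbl S \<and> (\<forall>y\<in>ball x R. \<forall>F. finite F \<longrightarrow> F \<subseteq> J \<longrightarrow>
        cmod (\<Sum>j\<in>F. g j (vfst y) * cnj (g j (vcnj (vsnd y)))) \<le> C)"
  proof (rule exI[of _ r], intro exI[of _ "(C + C') / 2"] conjI ballI allI impI)
    show "ball x r \<subseteq> dbl S" using r(2) R(2) R'(2) unfolding dbl_def by blast
    fix y F assume "y \<in> ball x r" "finite F" "F \<subseteq> J"
    then show "cmod (\<Sum>j\<in>F. g j (vfst y) * cnj (g j (vcnj (vsnd y)))) \<le> (C + C') / 2"
      using r(2) by (intro sq_bounded_sum_le[OF R(3) R'(3)]) auto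
  qed (rule r)
qed

text \<open>Duality: a finite part of the family is paired with its own derivatives at
  \<open>x\<close>. The resulting scalar function \<open>G\<close> has derivative \<open>s\<close>
  at \<open>x\<close>, the very square sum to be estimated, and the Cauchy estimate for
  \<open>G\<close> bounds \<open>s\<close> by a multiple of \<open>C\<close> plus a small multiple
  of \<open>s\<close>.\<close>

lemma sq_bounded_fd:
  assumes g: "sq_bounded_family J g S" and x: "x \<in> S"
  obtains C where "sq_bounded J (\<lambda>j. fd (g j) x v) C"
proof -
  obtain R C where R: "R > 0" "ball x R \<subseteq> S" "\<And>y. y \<in> ball x R \<Longrightarrow> sq_bounded J (\<lambda>j. g j y) C"
    using g x unfolding sq_bounded_family_def by blast
  define k where "k = norm v / R"
  have "(\<Sum>j\<in>F. (cmod (fd (g j) x v))\<^sup>2) \<le> 4 * C * k\<^sup>2" if F: "finite F" "F \<subseteq> J" for F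
  proof -
    define s where "s = (\<Sum>j\<in>F. (cmod (fd (g j) x v))\<^sup>2)"
    define G where "G y = (\<Sum>j\<in>F. g j y * cnj (fd (g j) x v))" for y
    have h: "holo_fun (\<lambda>y. g j y * cnj (fd (g j) x v)) S" if "j \<in> F" for j
      using g F that unfolding sq_bounded_family_def by (intro holo_fun_mult holo_fun_const) auto
    have hG: "holo_fun G S" unfolding G_def by (rule holo_fun_sum) (rule h)
    have "fd G x v = (\<Sum>j\<in>F. fd (\<lambda>y. g j y * cnj (fd (g j) x v)) x v)"
      unfolding G_def by (rule fd_sum[OF h x])
    also have "\<dots> = (\<Sum>j\<in>F. fd (g j) x v * cnj (fd (g j) x v))"
      using g F x unfolding sq_bounded_family_def by (intro sum.cong fd_mult_const[of _ S]) auto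
    finally have "fd G x v = (\<Sum>j\<in>F. fd (g j) x v * cnj (fd (g j) x v))" .
    then have fdG: "fd G x v = complex_of_real s"
      by (simp only: s_def of_real_sum complex_norm_square)
    \<comment> \<open>The free weight \<open>t\<close> in the arithmetic-geometric mean inequality
      balances the two square sums. The estimate reads \<open>s \<le> (t * C + s / t) * k\<close>;
      taking \<open>t = 2 * k\<close> leaves \<open>s / 2\<close> on the right, which is
      absorbed.\<close>
    have "2 * k * t * s \<le> 2 * k * k * (t\<^sup>2 * C + s)" if k: "k > 0" and t: "t > 0" for t
    proof -
      have "cmod (fd G x v) \<le> 2 * ((t * C + s / t) / 2) / R * norm v"
      proof (rule Cauchy_estimate_fd)
        show "holo_fun G (ball x R)" using hG R(2) holo_fun_subset by blast
        fix y assume y: "y \<in> ball x R"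
        have "cmod (G y) \<le> (\<Sum>j\<in>F. (t * (cmod (g j y))\<^sup>2 + (cmod (fd (g j) x v))\<^sup>2 / t) / 2)"
          unfolding G_def
        proof (rule sum_norm_le)
          fix j
          have "2 * (sqrt t * cmod (g j y)) * (cmod (fd (g j) x v) / sqrt t)
              \<le> (sqrt t * cmod (g j y))\<^sup>2 + (cmod (fd (g j) x v) / sqrt t)\<^sup>2"
            by (rule sum_squares_bound)
          then show "cmod (g j y * cnj (fd (g j) x v)) \<le> (t * (cmod (g j y))\<^sup>2 + (cmod (fd (g j) x v))\<^sup>2 / t) / 2"
            using t by (simp add: norm_mult power_mult_distrib power_divide)
        qed
        also have "\<dots> = (t * (\<Sum>j\<in>F. (cmod (g j y))\<^sup>2) + s / t) / 2"
          by (simp add: s_def sum.distrib sum_distrib_left flip: sum_divide_distrib)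
        also have "\<dots> \<le> (t * C + s / t) / 2"
          using R(3)[OF y] F t unfolding sq_bounded_def by (intro divide_right_mono add_mono mult_left_mono) auto
        finally show "cmod (G y) \<le> (t * C + s / t) / 2" .
      qed (use R in auto)
      then have "s \<le> (t * C + s / t) * k"
      proof -
        have "s \<ge> 0" by (simp add: s_def sum_nonneg)
        then have "cmod (fd G x v) = s" unfolding fdG by simp
        moreover have "2 * (u / 2) / R * norm v = u * k" for u by (simp add: k_def)
        ultimately show ?thesis using \<open>cmod (fd G x v) \<le> _\<close> by metis
      qed
      then have "2 * k * t * s \<le> 2 * k * t * ((t * C + s / t) * k)"
        using k t by (intro mult_left_mono) auto
      also have "\<dots> = 2 * k * k * (t\<^sup>2 * C + s)" using t by (simp add: field_simps power2_eq_square)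
      finally show ?thesis .
    qed
    note * = this
    have k0: "k \<ge> 0" using R(1) by (simp add: k_def)
    show ?thesis
    proof (cases "k = 0")
      case True
      then have "v = 0" using R(1) by (simp add: k_def)
      moreover have "fd (g j) x 0 = 0" if "j \<in> F" for j
        using holo_fun_fd_linear[of "g j" S x] g F x that unfolding sq_bounded_family_def
        by (auto simp: linear_0)
      ultimately show ?thesis using sq_bounded_nonneg[OF R(3)[of x]] R(1) by simp
    next
      case False
      with k0 have k: "k > 0" by simp
      have "4 * k\<^sup>2 * s \<le> 2 * k\<^sup>2 * (4 * k\<^sup>2 * C + s)"
        using *[OF k, of "2 * k"] k by (simp add: power2_eq_square)
      then have "2 * k\<^sup>2 * s \<le> 2 * k\<^sup>2 * (4 * k\<^sup>2 * C)" by (simp add: algebra_simps)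
      then have "s \<le> 4 * k\<^sup>2 * C" by (rule mult_left_le_imp_le) (use k in simp)
      then show ?thesis by (simp add: s_def mult_ac)
    qed
  qed
  then have "sq_bounded J (\<lambda>j. fd (g j) x v) (4 * C * k\<^sup>2)" unfolding sq_bounded_def by blast
  then show thesis by (rule that)
qed

section \<open>Minimizing sequences and orthonormal systems\<close>

text \<open>Neither definite nor complete: functions that differ only outside \<Omega>, or different
  coefficient functions with the same kernel combination, may be at distance 0. The instances are
  kernel combinations, the spaces \<open>L2\<close>, and the Bergman spaces of \<Omega> and
  \<open>M\<close>.\<close>

locale semi_inner =
  fixes V :: "('x \<Rightarrow> complex) set" and ip :: "('x \<Rightarrow> complex) \<Rightarrow> ('x \<Rightarrow> complex) \<Rightarrow> complex"
  assumes add_closed: "f \<in> V \<Longrightarrow> g \<in> V \<Longrightarrow> (\<lambda>x. f x + g x) \<in> V"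
    and scale_closed: "f \<in> V \<Longrightarrow> (\<lambda>x. c * f x) \<in> V"
    and ip_add: "f \<in> V \<Longrightarrow> g \<in> V \<Longrightarrow> h \<in> V \<Longrightarrow> ip (\<lambda>x. f x + g x) h = ip f h + ip g h"
    and ip_scale: "f \<in> V \<Longrightarrow> h \<in> V \<Longrightarrow> ip (\<lambda>x. c * f x) h = c * ip f h"
    and ip_cnj: "f \<in> V \<Longrightarrow> h \<in> V \<Longrightarrow> ip h f = cnj (ip f h)"
    and ip_nonneg: "f \<in> V \<Longrightarrow> Re (ip f f) \<ge> 0"
begin

definition q where "q f = Re (ip f f)"

lemma ip_self: "f \<in> V \<Longrightarrow> ip f f = complex_of_real (q f)"
  using ip_cnj[of f f] by (simp add: complex_eq_iff q_def)

lemma comb_closed: "f \<in> V \<Longrightarrow> g \<in> V \<Longrightarrow> (\<lambda>x. f x + c * g x) \<in> V"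
  using add_closed[OF _ scale_closed] by blast

lemma ip_comb_left:
  "f \<in> V \<Longrightarrow> g \<in> V \<Longrightarrow> h \<in> V \<Longrightarrow> ip (\<lambda>x. f x + c * g x) h = ip f h + c * ip g h"
  using ip_add[OF _ scale_closed] ip_scale by simp

lemma ip_comb_right:
  assumes "f \<in> V" "g \<in> V" "h \<in> V"
  shows "ip h (\<lambda>x. f x + c * g x) = ip h f + cnj c * ip h g"
  using ip_cnj[OF comb_closed[OF assms(1,2)] assms(3)] ip_comb_left[OF assms] ip_cnj[OF assms(1,3)] ip_cnj[OF assms(2,3)]
  by simp

lemma q_comb:
  assumes "f \<in> V" "g \<in> V"
  shows "q (\<lambda>x. f x + c * g x) = q f + 2 * Re (c * ip g f) + (cmod c)\<^sup>2 * q g"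
proof -
  have "ip (\<lambda>x. f x + c * g x) (\<lambda>x. f x + c * g x) = ip f f + cnj c * ip f g + c * (ip g f + cnj c * ip g g)"
    using assms by (simp add: ip_comb_left ip_comb_right comb_closed)
  also have "ip f g = cnj (ip g f)" using ip_cnj assms by blast
  also have "ip g g = complex_of_real (q g)" using ip_self assms by blast
  finally show ?thesis unfolding q_def cmod_power2 by (simp add: algebra_simps power2_eq_square)
qed

lemma Cauchy_Schwarz:
  assumes "f \<in> V" "g \<in> V"
  shows "(cmod (ip f g))\<^sup>2 \<le> q f * q g"
proof -
  define d where "d = ip f g"
  have qn: "q f \<ge> 0" "q g \<ge> 0" using assms ip_nonneg by (auto simp: q_def)
  have *: "2 * t * (cmod d)\<^sup>2 \<le> q g + t\<^sup>2 * (cmod d)\<^sup>2 * q f" for t :: real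
  proof -
    have "0 \<le> q (\<lambda>x. g x + (- (complex_of_real t * cnj d)) * f x)"
      using ip_nonneg[OF comb_closed[OF assms(2,1)]] unfolding q_def .
    also have "\<dots> = q g + 2 * Re (- (complex_of_real t * cnj d) * d) + (cmod (- (complex_of_real t * cnj d)))\<^sup>2 * q f"
      unfolding q_comb[OF assms(2,1)] d_def ..
    also have "Re (- (complex_of_real t * cnj d) * d) = - t * (cmod d)\<^sup>2"
      unfolding cmod_power2 by (simp add: algebra_simps power2_eq_square)
    also have "(cmod (- (complex_of_real t * cnj d)))\<^sup>2 = t\<^sup>2 * (cmod d)\<^sup>2"
      by (simp add: norm_mult power_mult_distrib)
    finally show ?thesis by simp
  qed
  have "(cmod d)\<^sup>2 \<le> q f * q g"
  proof (cases "q f = 0")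
    case True
    have "(cmod d)\<^sup>2 = 0"
    \<comment> \<open>If \<open>q f = 0\<close>, the inequality bounds
      \<open>2 * t * (cmod d)\<^sup>2\<close> by \<open>q g\<close> for every \<open>t\<close>; a
      large \<open>t\<close> contradicts it.\<close>
    proof (rule ccontr)
      assume n: "(cmod d)\<^sup>2 \<noteq> 0"
      have "2 * ((q g + 1) / (cmod d)\<^sup>2) * (cmod d)\<^sup>2 \<le> q g" using *[of "(q g + 1) / (cmod d)\<^sup>2"] True by simp
      also have "2 * ((q g + 1) / (cmod d)\<^sup>2) * (cmod d)\<^sup>2 = 2 * (q g + 1)" using n by simp
      finally show False using qn by simp
    qed
    then show ?thesis using True by simp
  next
    case False
    then have p: "q f > 0" using qn by simp
    have "2 * (1 / q f) * (cmod d)\<^sup>2 \<le> q g + (1 / q f) * (cmod d)\<^sup>2"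
      using *[of "1 / q f"] p by (simp add: power2_eq_square)
    then have "(cmod d)\<^sup>2 / q f \<le> q g" by simp
    then show ?thesis using p by (simp add: field_simps)
  qed
  then show ?thesis by (simp add: d_def)
qed

text \<open>In a complete space the minimizer of \<open>Q f = q f - 2 * Re (L f)\<close> represents
  \<open>L\<close>. Without completeness a minimizing sequence still is Cauchy, with an explicit
  rate from the parallelogram law, and represents \<open>L\<close> in the limit; where the sequence
  converges is left to each application.\<close>

lemma Riesz_minimizing_sequence:
  assumes ne: "V \<noteq> {}"
    and L_add: "\<And>f g. f \<in> V \<Longrightarrow> g \<in> V \<Longrightarrow> L (\<lambda>x. f x + g x) = L f + L g"
    and L_scale: "\<And>f c. f \<in> V \<Longrightarrow> L (\<lambda>x. c * f x) = c * L f"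
    and L_bound: "\<And>f. f \<in> V \<Longrightarrow> (cmod (L f))\<^sup>2 \<le> C * q f" and C: "C \<ge> 0"
  obtains v where "\<And>n::nat. v n \<in> V"
    and "\<And>m n. q (\<lambda>x. v m x - v n x) \<le> 2 * (1 / Suc m + 1 / Suc n)"
    and "\<And>n. q (v n) \<le> 2 + 4 * C"
    and "\<And>f. f \<in> V \<Longrightarrow> (\<lambda>n. ip f (v n)) \<longlonglongrightarrow> L f"
proof -
  define Q where "Q f = q f - 2 * Re (L f)" for f
  have qn: "q f \<ge> 0" if "f \<in> V" for f using ip_nonneg[OF that] by (simp add: q_def)
  \<comment> \<open>The arithmetic-geometric mean inequality, weighted so that only half of
    \<open>q f\<close> is spent: it yields both the lower bound \<open>- 2 * C\<close> for
    \<open>Q\<close> and, from \<open>Q (v n) \<le> 1\<close>, the bound \<open>2 + 4 * C\<close>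
    for \<open>q (v n)\<close>.\<close>
  have LR: "2 * cmod (L f) \<le> 2 * C + q f / 2" if "f \<in> V" for f
  proof -
    have "(cmod (L f))\<^sup>2 \<le> C * q f" by (rule L_bound[OF that])
    also have "\<dots> \<le> (C + q f / 4)\<^sup>2" using zero_le_power2[of "C - q f / 4"]
      by (simp add: power2_sum power2_diff algebra_simps)
    finally have "cmod (L f) \<le> C + q f / 4"
      by (rule power2_le_imp_le) (use C qn[OF that] in simp)
    then show ?thesis by simp
  qed
  have bdd: "bdd_below (Q ` V)"
  proof (rule bdd_belowI2)
    show "- 2 * C \<le> Q f" if "f \<in> V" for f
      using LR[OF that] complex_Re_le_cmod[of "L f"] qn[OF that] unfolding Q_def by linarith
  qed
  define m where "m = Inf (Q ` V)"
  have m_le: "m \<le> Q f" if "f \<in> V" for f unfolding m_def using bdd that by (intro cInf_lower) auto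
  have "\<exists>f\<in>V. Q f < m + 1 / real (Suc n)" for n
  proof -
    have "Inf (Q ` V) < m + 1 / real (Suc n)" by (simp add: m_def)
    then show ?thesis using cInf_lessD[of "Q ` V"] ne by blast
  qed
  then obtain v where v: "\<And>n. v n \<in> V" "\<And>n. Q (v n) < m + 1 / real (Suc n)" by metis
  \<comment> \<open>The parallelogram law holds for \<open>Q\<close> in place of \<open>q\<close>
    because the linear part of \<open>Q\<close> cancels.\<close>
  have mean: "q (\<lambda>x. f x - g x) = 2 * Q f + 2 * Q g - 4 * Q (\<lambda>x. (1/2) * (f x + g x))"
    if "f \<in> V" "g \<in> V" for f g
  proof -
    have 1: "q (\<lambda>x. f x - g x) = q f - 2 * Re (ip g f) + q g"
      using q_comb[OF that, of "-1"] by simp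
    have "q (\<lambda>x. (1/2) * (f x + g x)) = (1/4) * q (\<lambda>x. f x + g x)"
      using q_comb[of "\<lambda>x. 0 * f x" "\<lambda>x. f x + g x" "1/2"] add_closed[OF that] scale_closed[OF that(1), of 0]
        ip_scale[OF that(1) scale_closed[OF that(1), of 0], of 0] ip_cnj[OF add_closed[OF that] scale_closed[OF that(1), of 0]]
        ip_scale[OF that(1) add_closed[OF that], of 0]
      by (simp add: q_def power2_eq_square)
    also have "q (\<lambda>x. f x + g x) = q f + 2 * Re (ip g f) + q g"
      using q_comb[OF that, of 1] by simp
    finally have 2: "4 * q (\<lambda>x. (1/2) * (f x + g x)) = q f + 2 * Re (ip g f) + q g" by simp
    have "L (\<lambda>x. (1/2) * (f x + g x)) = (1/2) * (L f + L g)"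
      using L_scale[OF add_closed[OF that], of "1/2"] L_add[OF that] by simp
    then have 3: "2 * Re (L (\<lambda>x. (1/2) * (f x + g x))) = Re (L f) + Re (L g)" by (simp only:) simp
    have "a = 2 * (b - 2 * c) + 2 * (d - 2 * e) - 4 * (k - 2 * l)"
      if "a = b - 2 * r + d" "4 * k = b + 2 * r + d" "2 * l = c + e" for a b c d e k l r :: real
      using that by simp
    from this[OF 1 2 3] show ?thesis unfolding Q_def .
  qed
  show thesis
  proof
    show "v n \<in> V" for n by (rule v)
    show "q (\<lambda>x. v k x - v n x) \<le> 2 * (1 / Suc k + 1 / Suc n)" for k n
    proof -
      have "m \<le> Q (\<lambda>x. (1/2) * (v k x + v n x))"
        by (rule m_le[OF scale_closed[OF add_closed[OF v(1) v(1)]]])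
      then show ?thesis using mean[OF v(1)[of k] v(1)[of n]] v(2)[of k] v(2)[of n] by simp
    qed
    show "q (v n) \<le> 2 + 4 * C" for n
    proof -
      have z: "(\<lambda>x. 0 * v n x) \<in> V" by (rule scale_closed[OF v(1)])
      have "m \<le> 0" using m_le[OF z] ip_scale[OF v(1)[of n] z, of 0] L_scale[OF v(1)[of n], of 0]
        by (simp add: Q_def q_def)
      moreover have "1 / real (Suc n) \<le> 1" by simp
      ultimately have "Q (v n) \<le> 1" using v(2)[of n] by linarith
      then show ?thesis using LR[OF v(1)[of n]] complex_Re_le_cmod[of "L (v n)"] unfolding Q_def by linarith
    qed
    fix f assume f: "f \<in> V"
    have d: "(cmod (ip f (v n) - L f))\<^sup>2 \<le> (1 + q f) * (1 / real (Suc n))" for n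
    proof -
      define d where "d = ip f (v n) - L f"
      \<comment> \<open>Moving \<open>v n\<close> by \<open>c * f\<close> lowers \<open>Q\<close> by
        \<open>2 * s * (cmod d)\<^sup>2\<close> to first order and raises it by at most
        \<open>s * (cmod d)\<^sup>2\<close> to second order, as \<open>s * q f \<le> 1\<close>.
        Near-minimality of \<open>v n\<close> then bounds \<open>d\<close>.\<close>
      define s where "s = 1 / (1 + q f)"
      have s: "s > 0" "s * q f \<le> 1" using qn[OF f] by (auto simp: s_def)
      define c where "c = - (complex_of_real s * cnj d)"
      have "m \<le> Q (\<lambda>x. v n x + c * f x)" by (rule m_le[OF comb_closed[OF v(1) f]])
      also have "\<dots> = Q (v n) + 2 * Re (c * d) + (cmod c)\<^sup>2 * q f"
        unfolding Q_def q_comb[OF v(1) f] L_add[OF v(1) scale_closed[OF f]] L_scale[OF f] d_def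
        by (simp add: algebra_simps)
      also have "2 * Re (c * d) = - 2 * s * (cmod d)\<^sup>2"
        unfolding c_def cmod_power2 by (simp add: algebra_simps power2_eq_square)
      also have "(cmod c)\<^sup>2 = s\<^sup>2 * (cmod d)\<^sup>2" using s by (simp add: c_def norm_mult power_mult_distrib)
      finally have "2 * s * (cmod d)\<^sup>2 - s * (s * q f) * (cmod d)\<^sup>2 \<le> 1 / real (Suc n)"
        using v(2)[of n] by (simp add: power2_eq_square algebra_simps)
      moreover have "s * (s * q f) * (cmod d)\<^sup>2 \<le> s * 1 * (cmod d)\<^sup>2"
        using s by (intro mult_right_mono mult_left_mono) auto
      ultimately have "s * (cmod d)\<^sup>2 \<le> 1 / real (Suc n)" by simp
      then have "(1 + q f) * (s * (cmod d)\<^sup>2) \<le> (1 + q f) * (1 / real (Suc n))"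
        using qn[OF f] by (intro mult_left_mono) auto
      moreover have "(1 + q f) * s = 1" using qn[OF f] by (simp add: s_def)
      ultimately show ?thesis unfolding d_def by (metis mult.assoc mult_1)
    qed
    have "(\<lambda>n. 1 / real (Suc n)) \<longlonglongrightarrow> 0" using LIMSEQ_inverse_real_of_nat by (simp add: inverse_eq_divide)
    then have "(\<lambda>n. (1 + q f) * (1 / real (Suc n))) \<longlonglongrightarrow> (1 + q f) * 0" by (intro tendsto_intros)
    then have lim0: "(\<lambda>n. (1 + q f) * (1 / real (Suc n))) \<longlonglongrightarrow> 0" by (simp only: mult_zero_right)
    have "(\<lambda>n. (cmod (ip f (v n) - L f))\<^sup>2) \<longlonglongrightarrow> 0"
      by (rule tendsto_sandwich[OF _ _ tendsto_const lim0]) (intro always_eventually allI d zero_le_power2)+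
    then have "(\<lambda>n. sqrt ((cmod (ip f (v n) - L f))\<^sup>2)) \<longlonglongrightarrow> sqrt 0" by (intro tendsto_intros)
    then have "(\<lambda>n. ip f (v n) - L f) \<longlonglongrightarrow> 0" by (simp add: tendsto_norm_zero_iff)
    then show "(\<lambda>n. ip f (v n)) \<longlonglongrightarrow> L f" by (simp add: LIM_zero_iff)
  qed
qed

end

text \<open>Zorn's lemma: a vector of nonzero norm orthogonal to a maximal system could be
  normalized and adjoined. The scaling \<open>sc\<close> is a parameter so that the same statement
  serves functions and forms.\<close>

lemma maximal_orthonormal_system:
  assumes scale: "\<And>c f. f \<in> H \<Longrightarrow> sc c f \<in> H"
    and ip_scale: "\<And>c f g. f \<in> H \<Longrightarrow> g \<in> H \<Longrightarrow> ip (sc c f) g = c * ip f g"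
    and ip_cnj: "\<And>f g. f \<in> H \<Longrightarrow> g \<in> H \<Longrightarrow> ip g f = cnj (ip f g)"
    and ip_nonneg: "\<And>f. f \<in> H \<Longrightarrow> Re (ip f f) \<ge> 0"
  shows "\<exists>B. complete_orthonormal_system ip H B"
proof -
  define OS where "OS = {B. B \<subseteq> H \<and> (\<forall>\<phi>\<in>B. \<forall>\<psi>\<in>B. ip \<phi> \<psi> = (if \<phi> = \<psi> then 1 else 0))}"
  have "\<exists>M\<in>OS. \<forall>X\<in>OS. M \<subseteq> X \<longrightarrow> X = M"
  proof (rule subset_Zorn)
    fix C assume C: "subset.chain OS C"
    have "\<Union>C \<subseteq> H" using C unfolding subset.chain_def OS_def by blast
    moreover have "ip \<phi> \<psi> = (if \<phi> = \<psi> then 1 else 0)" if "\<phi> \<in> \<Union>C" "\<psi> \<in> \<Union>C" for \<phi> \<psi>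
    proof -
      obtain X Y where m: "X \<in> C" "\<phi> \<in> X" "Y \<in> C" "\<psi> \<in> Y" using \<open>\<phi> \<in> \<Union>C\<close> \<open>\<psi> \<in> \<Union>C\<close> by blast
      then have "X \<subseteq> Y \<or> Y \<subseteq> X" using C unfolding subset.chain_def by blast
      then obtain Z where Z: "Z \<in> C" "\<phi> \<in> Z" "\<psi> \<in> Z" using m by blast
      then have "Z \<in> OS" using C unfolding subset.chain_def by blast
      then show ?thesis using Z(2,3) unfolding OS_def by blast
    qed
    ultimately have "\<Union>C \<in> OS" unfolding OS_def by blast
    then show "\<exists>U\<in>OS. \<forall>X\<in>C. X \<subseteq> U" by blast
  qed
  then obtain B where B: "B \<in> OS" "\<And>X. X \<in> OS \<Longrightarrow> B \<subseteq> X \<Longrightarrow> X = B" by blast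
  have "ip f f = 0" if f: "f \<in> H" "\<forall>\<phi>\<in>B. ip f \<phi> = 0" for f
  proof (rule ccontr)
    assume nz: "ip f f \<noteq> 0"
    have re: "ip f f = complex_of_real (Re (ip f f))" using ip_cnj[OF f(1) f(1)] by (simp add: complex_eq_iff)
    with nz have pos: "Re (ip f f) > 0" using ip_nonneg[OF f(1)] by (metis of_real_0 order_le_less)
    define c where "c = complex_of_real (1 / sqrt (Re (ip f f)))"
    define g where "g = sc c f"
    have g: "g \<in> H" using scale f by (simp add: g_def)
    have gs: "ip g h = c * ip f h" if "h \<in> H" for h using ip_scale f that by (simp add: g_def)
    have "ip g g = c * ip f g" by (rule gs[OF g])
    also have "ip f g = cnj (ip g f)" by (rule ip_cnj[OF g f(1)])
    also have "\<dots> = c * ip f f"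
    proof -
      have "cnj (ip f f) = ip f f" by (subst (1 2) re) simp
      then show ?thesis using gs[OF f(1)] by (simp add: c_def)
    qed
    also have "c * (c * ip f f) = complex_of_real (1 / sqrt (Re (ip f f)) * (1 / sqrt (Re (ip f f)) * Re (ip f f)))"
      by (subst re) (simp only: c_def of_real_mult)
    also have "1 / sqrt (Re (ip f f)) * (1 / sqrt (Re (ip f f)) * Re (ip f f)) = 1"
      using pos by (simp add: real_div_sqrt)
    finally have gg: "ip g g = 1" by simp
    have gB: "ip g \<phi> = 0" "ip \<phi> g = 0" if "\<phi> \<in> B" for \<phi>
    proof -
      have H: "\<phi> \<in> H" using B(1) that by (auto simp: OS_def)
      show "ip g \<phi> = 0" using gs[OF H] f that by simp
      then show "ip \<phi> g = 0" using ip_cnj[OF g H] by simp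
    qed
    have "g \<notin> B" using gB(1) gg by force
    moreover have "insert g B \<in> OS" using B(1) g gg gB \<open>g \<notin> B\<close> unfolding OS_def by auto
    ultimately show False using B(2)[of "insert g B"] by blast
  qed
  then show ?thesis using B(1) unfolding OS_def complete_orthonormal_system_def by blast
qed

section \<open>Extension of a family with the same kernel\<close>

definition fin_coeffs :: "'x set \<Rightarrow> ('x \<Rightarrow> complex) set" where
  "fin_coeffs N = {c. finite {w. c w \<noteq> 0} \<and> {w. c w \<noteq> 0} \<subseteq> N}"

text \<open>The inner product of the combinations of the functions \<open>K(\<cdot>, w)\<close> with
  coefficients \<open>c\<close> and \<open>d\<close>, as prescribed by the reproducing property: the
  product of \<open>K(\<cdot>, w)\<close> with \<open>K(\<cdot>, w')\<close> is
  \<open>K w' w\<close>.\<close>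

definition kernel_form :: "('x \<Rightarrow> 'x \<Rightarrow> complex) \<Rightarrow> ('x \<Rightarrow> complex) \<Rightarrow> ('x \<Rightarrow> complex) \<Rightarrow> complex" where
  "kernel_form K c d = (\<Sum>w | c w \<noteq> 0. \<Sum>w' | d w' \<noteq> 0. c w * cnj (d w') * K w' w)"

lemma kernel_form_superset:
  assumes "finite W" "{w. c w \<noteq> 0} \<subseteq> W" "{w. d w \<noteq> 0} \<subseteq> W"
  shows "kernel_form K c d = (\<Sum>w\<in>W. \<Sum>w'\<in>W. c w * cnj (d w') * K w' w)"
proof -
  have "kernel_form K c d = (\<Sum>w | c w \<noteq> 0. \<Sum>w'\<in>W. c w * cnj (d w') * K w' w)"
    unfolding kernel_form_def using assms by (intro sum.cong refl sum.mono_neutral_left) auto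
  also have "\<dots> = (\<Sum>w\<in>W. \<Sum>w'\<in>W. c w * cnj (d w') * K w' w)"
    using assms by (intro sum.mono_neutral_left) auto
  finally show ?thesis .
qed

lemma has_sum_sum_finite:
  fixes f :: "'i \<Rightarrow> 'j \<Rightarrow> complex"
  assumes "\<And>i. i \<in> I \<Longrightarrow> (f i has_sum s i) J"
  shows "((\<lambda>j. \<Sum>i\<in>I. f i j) has_sum (\<Sum>i\<in>I. s i)) J"
  using assms by (induction I rule: infinite_finite_induct) (auto intro: has_sum_add)

text \<open>The kernel form is the inner product of the square summable vectors with entries
  \<open>\<Sum>w\<in>W. c w * cnj (a j w)\<close>. Hence it is positive, and any family with kernel
  \<open>K\<close> may serve as the witness.\<close>

lemma has_sum_gram:
  assumes "\<And>w w'. w \<in> W \<Longrightarrow> w' \<in> W \<Longrightarrow> ((\<lambda>j. a j w' * cnj (a j w)) has_sum K w' w) J"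
  shows "((\<lambda>j. (\<Sum>w\<in>W. c w * cnj (a j w)) * cnj (\<Sum>w\<in>W. d w * cnj (a j w)))
    has_sum (\<Sum>w\<in>W. \<Sum>w'\<in>W. c w * cnj (d w') * K w' w)) J"
proof -
  have "((\<lambda>j. \<Sum>w\<in>W. \<Sum>w'\<in>W. c w * cnj (d w') * (a j w' * cnj (a j w)))
    has_sum (\<Sum>w\<in>W. \<Sum>w'\<in>W. c w * cnj (d w') * K w' w)) J"
    using assms by (intro has_sum_sum_finite has_sum_cmult_right)
  then show ?thesis by (simp add: sum_product mult_ac)
qed

lemma kernel_cnj:
  assumes "((\<lambda>j. a j z * cnj (a j w)) has_sum k) J" "((\<lambda>j. a j w * cnj (a j z)) has_sum l) J"
  shows "l = cnj (k :: complex)"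
proof -
  have "((\<lambda>j. cnj (a j z * cnj (a j w))) has_sum cnj k) J" using assms(1) by (simp only: has_sum_cnj_iff)
  then show ?thesis using assms(2) by (simp add: mult.commute has_sum_unique)
qed

lemma semi_inner_kernel_form:
  fixes a :: "'j \<Rightarrow> 'x \<Rightarrow> complex"
  assumes K: "\<And>z w. z \<in> N \<Longrightarrow> w \<in> N \<Longrightarrow> ((\<lambda>j. a j z * cnj (a j w)) has_sum K z w) J"
  shows "semi_inner (fin_coeffs N) (kernel_form K)"
proof
  fix f g h :: "'x \<Rightarrow> complex" and c :: complex
  show "(\<lambda>x. f x + g x) \<in> fin_coeffs N" if "f \<in> fin_coeffs N" "g \<in> fin_coeffs N"
  proof -
    have "{x. f x + g x \<noteq> 0} \<subseteq> {x. f x \<noteq> 0} \<union> {x. g x \<noteq> 0}" by auto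
    then show ?thesis using that unfolding fin_coeffs_def by (auto intro: finite_subset)
  qed
  show "(\<lambda>x. c * f x) \<in> fin_coeffs N" if "f \<in> fin_coeffs N"
  proof -
    have "{x. c * f x \<noteq> 0} \<subseteq> {x. f x \<noteq> 0}" by auto
    then show ?thesis using that unfolding fin_coeffs_def by (auto intro: finite_subset)
  qed
  let ?W = "{w. f w \<noteq> 0} \<union> {w. g w \<noteq> 0} \<union> {w. h w \<noteq> 0}"
  show "kernel_form K (\<lambda>x. f x + g x) h = kernel_form K f h + kernel_form K g h"
    if "f \<in> fin_coeffs N" "g \<in> fin_coeffs N" "h \<in> fin_coeffs N"
    by (subst (1 2 3) kernel_form_superset[of ?W])
       (use that in \<open>auto simp: fin_coeffs_def sum.distrib distrib_right\<close>)
  let ?W2 = "{w. f w \<noteq> 0} \<union> {w. h w \<noteq> 0}"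
  show "kernel_form K (\<lambda>x. c * f x) h = c * kernel_form K f h"
    if "f \<in> fin_coeffs N" "h \<in> fin_coeffs N"
    by (subst (1 2) kernel_form_superset[of ?W2])
       (use that in \<open>auto simp: fin_coeffs_def sum_distrib_left algebra_simps\<close>)
  show "kernel_form K h f = cnj (kernel_form K f h)" if fh: "f \<in> fin_coeffs N" "h \<in> fin_coeffs N"
  proof -
    have W: "finite ?W2" "?W2 \<subseteq> N" using fh by (auto simp: fin_coeffs_def)
    have "kernel_form K h f = (\<Sum>w\<in>?W2. \<Sum>w'\<in>?W2. h w * cnj (f w') * K w' w)"
      by (rule kernel_form_superset[OF W(1)]) auto
    also have "\<dots> = (\<Sum>w'\<in>?W2. \<Sum>w\<in>?W2. h w * cnj (f w') * K w' w)" by (rule sum.swap)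
    also have "\<dots> = (\<Sum>w'\<in>?W2. \<Sum>w\<in>?W2. cnj (f w' * cnj (h w) * K w w'))"
    proof (intro sum.cong refl)
      fix w w' assume "w \<in> ?W2" "w' \<in> ?W2"
      then have "w \<in> N" "w' \<in> N" using W by blast+
      then have "K w' w = cnj (K w w')" by (intro kernel_cnj[OF K[of w w'] K[of w' w]])
      then show "h w * cnj (f w') * K w' w = cnj (f w' * cnj (h w) * K w w')" by simp
    qed
    also have "\<dots> = cnj (kernel_form K f h)"
      by (subst kernel_form_superset[OF W(1)]) auto
    finally show ?thesis .
  qed
  show "0 \<le> Re (kernel_form K f f)" if f: "f \<in> fin_coeffs N"
  proof -
    let ?F = "{w. f w \<noteq> 0}"
    have "((\<lambda>j. (\<Sum>w\<in>?F. f w * cnj (a j w)) * cnj (\<Sum>w\<in>?F. f w * cnj (a j w)))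
       has_sum kernel_form K f f) J"
      unfolding kernel_form_def by (rule has_sum_gram) (use f K in \<open>auto simp: fin_coeffs_def\<close>)
    from has_sum_norm_square(2)[OF this] show ?thesis by (rule has_sum_nonneg) simp
  qed
qed

lemma Cauchy_Schwarz_sum_complex:
  "(cmod (\<Sum>j\<in>F. a j * b j))\<^sup>2 \<le> (\<Sum>j\<in>F. (cmod (a j))\<^sup>2) * (\<Sum>j\<in>F. (cmod (b j))\<^sup>2)"
proof -
  have "(cmod (\<Sum>j\<in>F. a j * b j))\<^sup>2 \<le> (\<Sum>j\<in>F. cmod (a j) * cmod (b j))\<^sup>2"
    by (intro power_mono sum_norm_le) (auto simp: norm_mult)
  also have "\<dots> \<le> (\<Sum>j\<in>F. (cmod (a j))\<^sup>2) * (\<Sum>j\<in>F. (cmod (b j))\<^sup>2)"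
    by (rule Cauchy_Schwarz_ineq_sum)
  finally show ?thesis .
qed

text \<open>Two families with one kernel: \<phi> on all of \<Omega>, and \<open>b\<close> only on
  the open part \<open>N\<close>. About \<open>b\<close> nothing but its kernel is known; that its
  members are restrictions of holomorphic functions on \<Omega> is the outcome.\<close>

context
  fixes \<Omega> N :: "(complex ^ 'n) set" and \<phi> :: "'i \<Rightarrow> complex ^ 'n \<Rightarrow> complex" and I :: "'i set"
    and b :: "'j \<Rightarrow> complex ^ 'n \<Rightarrow> complex" and J :: "'j set" and K
  assumes \<Omega>: "open \<Omega>" "connected \<Omega>" and N: "open N" "N \<noteq> {}" "N \<subseteq> \<Omega>"
    and \<phi>: "sq_bounded_family I \<phi> \<Omega>"
    and K_def: "K = (\<lambda>z w. \<Sum>\<^sub>\<infinity>i\<in>I. \<phi> i z * cnj (\<phi> i w))"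
    and b: "\<And>z w. z \<in> N \<Longrightarrow> w \<in> N \<Longrightarrow> ((\<lambda>j. b j z * cnj (b j w)) has_sum K z w) J"
begin

lemma K_has_sum: "z \<in> \<Omega> \<Longrightarrow> w \<in> \<Omega> \<Longrightarrow> ((\<lambda>i. \<phi> i z * cnj (\<phi> i w)) has_sum K z w) I"
  unfolding K_def by (rule has_sum_infsum[OF sq_bounded_family_summable[OF \<phi>]])

lemma holo_fun_K: "w \<in> \<Omega> \<Longrightarrow> holo_fun (\<lambda>z. K z w) \<Omega>"
  unfolding K_def by (rule sq_bounded_family_at[OF \<phi>], assumption, rule holo_fun_series[OF \<phi>])

lemma K_locally_bounded:
  assumes "x \<in> \<Omega>"
  obtains R C where "R > 0" "ball x R \<subseteq> \<Omega>" "\<And>y. y \<in> ball x R \<Longrightarrow> Re (K y y) \<le> C"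
proof -
  obtain R C where R: "R > 0" "ball x R \<subseteq> \<Omega>" "\<And>y. y \<in> ball x R \<Longrightarrow> sq_bounded I (\<lambda>i. \<phi> i y) C"
    using \<phi> assms unfolding sq_bounded_family_def by blast
  have "Re (K y y) \<le> C" if y: "y \<in> ball x R" for y
  proof -
    have "((\<lambda>i. (cmod (\<phi> i y))\<^sup>2) has_sum Re (K y y)) I"
      using has_sum_norm_square(2)[OF K_has_sum] y R(2) by blast
    then show ?thesis
      by (rule has_sum_le_finite_sums) (use R(3)[OF y] in \<open>auto simp: sq_bounded_def\<close>)
  qed
  then show thesis using that R by blast
qed

text \<open>Both interpretations carry the same form. On \<Omega> its positivity comes from \<phi>,
  on \<open>N\<close> from \<open>b\<close>, and this coincidence is what transports estimates for
  \<open>b\<close> to all of \<Omega>.\<close>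

interpretation V: semi_inner "fin_coeffs \<Omega>" "kernel_form K"
  by (rule semi_inner_kernel_form[OF K_has_sum])

interpretation VN: semi_inner "fin_coeffs N" "kernel_form K"
  by (rule semi_inner_kernel_form[OF b])

definition delta :: "complex ^ 'n \<Rightarrow> complex ^ 'n \<Rightarrow> complex" where
  "delta z = (\<lambda>w. if w = z then 1 else 0)"

text \<open>The function on \<Omega> that the coefficients \<open>c\<close> stand for. Its value at
  \<open>z\<close> is the product with \<open>delta z\<close>, so Cauchy-Schwarz makes evaluation
  continuous.\<close>

definition comb :: "(complex ^ 'n \<Rightarrow> complex) \<Rightarrow> complex ^ 'n \<Rightarrow> complex" where
  "comb c z = (\<Sum>w | c w \<noteq> 0. c w * K z w)"

lemma supp_delta: "{w. delta z w \<noteq> 0} = {z}" by (auto simp: delta_def)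

lemma delta_in: "z \<in> S \<Longrightarrow> delta z \<in> fin_coeffs S"
  by (simp add: fin_coeffs_def supp_delta)

lemma kernel_form_delta: "kernel_form K c (delta z) = comb c z"
  unfolding kernel_form_def comb_def supp_delta by (simp add: delta_def)

lemma kernel_form_delta_delta: "V.q (delta z) = Re (K z z)"
  unfolding V.q_def kernel_form_delta by (simp add: comb_def supp_delta) (simp add: delta_def)

lemma comb_bound:
  assumes "c \<in> fin_coeffs \<Omega>" "z \<in> \<Omega>"
  shows "(cmod (comb c z))\<^sup>2 \<le> V.q c * Re (K z z)"
  using V.Cauchy_Schwarz[OF assms(1) delta_in[OF assms(2)]]
  by (simp add: kernel_form_delta kernel_form_delta_delta)

lemma fin_coeffs_mono: "fin_coeffs N \<subseteq> fin_coeffs \<Omega>"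
  using N(3) by (auto simp: fin_coeffs_def)

text \<open>The function to be extended defines a functional on coefficients supported in
  \<open>N\<close>. It is bounded because the square sums over \<open>F\<close> of the vectors
  representing \<open>c\<close> do not exceed \<open>VN.q c\<close>. The minimizing sequence for it
  uses base points in \<open>N\<close> only, but its combinations are functions on \<Omega> and
  converge there by \<open>comb_bound\<close>. Combinations are extended, not just single members,
  since the dependence of the bound on \<open>a\<close> later controls the whole family.\<close>

lemma extend_combination:
  assumes F: "finite F" "F \<subseteq> J"
  obtains \<xi> where "holo_fun \<xi> \<Omega>" "\<And>w. w \<in> N \<Longrightarrow> \<xi> w = (\<Sum>j\<in>F. a j * b j w)"
    and "\<And>z. z \<in> \<Omega> \<Longrightarrow> (cmod (\<xi> z))\<^sup>2 \<le> (2 + 4 * (\<Sum>j\<in>F. (cmod (a j))\<^sup>2)) * Re (K z z)"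
proof -
  define A where "A = (\<Sum>j\<in>F. (cmod (a j))\<^sup>2)"
  \<comment> \<open>The conjugates are placed so that \<open>L\<close> is linear in \<open>c\<close>
    and \<open>cnj (L (delta w))\<close> is the value at \<open>w\<close> of the function to be
    extended.\<close>
  define L where "L c = (\<Sum>j\<in>F. cnj (a j) * (\<Sum>w | c w \<noteq> 0. c w * cnj (b j w)))" for c
  have L_sup: "L c = (\<Sum>j\<in>F. cnj (a j) * (\<Sum>w\<in>W. c w * cnj (b j w)))"
    if "finite W" "{w. c w \<noteq> 0} \<subseteq> W" for c W
    unfolding L_def using that by (intro sum.cong refl arg_cong2[where f = "(*)"] sum.mono_neutral_left) auto
  have L_add: "L (\<lambda>x. f x + g x) = L f + L g" if "f \<in> fin_coeffs N" "g \<in> fin_coeffs N" for f g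
  proof -
    let ?W = "{w. f w \<noteq> 0} \<union> {w. g w \<noteq> 0}"
    have W: "finite ?W" using that by (auto simp: fin_coeffs_def)
    show ?thesis
      by (subst (1 2 3) L_sup[OF W]) (auto simp: sum.distrib distrib_left distrib_right)
  qed
  have L_scale: "L (\<lambda>x. c * f x) = c * L f" if "f \<in> fin_coeffs N" for f c
  proof -
    let ?W = "{w. f w \<noteq> 0}"
    have W: "finite ?W" using that by (auto simp: fin_coeffs_def)
    show ?thesis
      by (subst (1 2) L_sup[OF W]) (auto simp: sum_distrib_left mult_ac)
  qed
  have L_bound: "(cmod (L f))\<^sup>2 \<le> A * VN.q f" if f: "f \<in> fin_coeffs N" for f
  proof -
    let ?e = "\<lambda>j. \<Sum>w | f w \<noteq> 0. f w * cnj (b j w)"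
    have "(cmod (L f))\<^sup>2 \<le> (\<Sum>j\<in>F. (cmod (cnj (a j)))\<^sup>2) * (\<Sum>j\<in>F. (cmod (?e j))\<^sup>2)"
      unfolding L_def by (rule Cauchy_Schwarz_sum_complex)
    also have "(\<Sum>j\<in>F. (cmod (?e j))\<^sup>2) \<le> VN.q f"
    proof -
      have "((\<lambda>j. ?e j * cnj (?e j)) has_sum kernel_form K f f) J"
        unfolding kernel_form_def by (rule has_sum_gram) (use f b in \<open>auto simp: fin_coeffs_def\<close>)
      from has_sum_norm_square(1)[OF this] show ?thesis using F unfolding sq_bounded_def VN.q_def by blast
    qed
    finally show ?thesis by (simp add: A_def mult_left_mono sum_nonneg)
  qed
  have A0: "A \<ge> 0" by (simp add: A_def sum_nonneg)
  have "fin_coeffs N \<noteq> {}" using delta_in N(2) by blast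
  from VN.Riesz_minimizing_sequence[OF this L_add L_scale L_bound A0]
  obtain v where v: "\<And>n::nat. v n \<in> fin_coeffs N"
    and vC: "\<And>m n. VN.q (\<lambda>x. v m x - v n x) \<le> 2 * (1 / Suc m + 1 / Suc n)"
    and vB: "\<And>n. VN.q (v n) \<le> 2 + 4 * A"
    and vL: "\<And>f. f \<in> fin_coeffs N \<Longrightarrow> (\<lambda>n. kernel_form K f (v n)) \<longlonglongrightarrow> L f" by blast
  have v\<Omega>: "v n \<in> fin_coeffs \<Omega>" for n using v fin_coeffs_mono by blast
  have Kpos: "Re (K z z) \<ge> 0" if "z \<in> \<Omega>" for z
    using V.ip_nonneg[OF delta_in[OF that]] kernel_form_delta_delta by (simp add: V.q_def)
  have "convergent (\<lambda>n. comb (v n) z)" if z: "z \<in> \<Omega>" for z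
  proof (rule Cauchy_convergent, rule metric_CauchyI)
    fix e :: real assume e: "e > 0"
    define k where "k = Re (K z z) + 1"
    have k: "k > 0" using Kpos[OF z] by (simp add: k_def)
    obtain M :: nat where M: "4 * k / e\<^sup>2 < M" using reals_Archimedean2 by blast
    have "dist (comb (v m) z) (comb (v n) z) < e" if mn: "m \<ge> M" "n \<ge> M" for m n
    proof -
      have dv: "(\<lambda>x. v m x - v n x) \<in> fin_coeffs \<Omega>"
        using V.comb_closed[OF v\<Omega>[of m] v\<Omega>[of n], of "-1"] by simp
      have "comb (v m) z - comb (v n) z = comb (\<lambda>x. v m x - v n x) z"
        using V.ip_comb_left[OF v\<Omega>[of m] v\<Omega>[of n] delta_in[OF z], of "-1"] by (simp add: kernel_form_delta)
      then have "(dist (comb (v m) z) (comb (v n) z))\<^sup>2 \<le> V.q (\<lambda>x. v m x - v n x) * Re (K z z)"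
        using comb_bound[OF dv z] by (simp add: dist_norm)
      also have "\<dots> \<le> 2 * (1 / Suc m + 1 / Suc n) * k"
        using vC[of m n] Kpos[OF z] by (intro mult_mono) (auto simp: k_def)
      also have "\<dots> \<le> 2 * (1 / Suc M + 1 / Suc M) * k"
        using mn k by (intro mult_right_mono mult_left_mono add_mono divide_left_mono) auto
      also have "\<dots> = 4 * k / Suc M" by simp
      also have "\<dots> < e\<^sup>2" using M e k by (simp add: field_simps) (smt (verit) zero_less_power mult_pos_pos)
      finally show ?thesis using e by (simp add: power2_less_imp_less)
    qed
    then show "\<exists>M. \<forall>m\<ge>M. \<forall>n\<ge>M. dist (comb (v m) z) (comb (v n) z) < e" by blast
  qed
  then obtain \<xi> where \<xi>: "\<And>z. z \<in> \<Omega> \<Longrightarrow> (\<lambda>n. comb (v n) z) \<longlonglongrightarrow> \<xi> z"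
    unfolding convergent_def by metis
  \<comment> \<open>The bound \<open>2 + 4 * A\<close> on the minimizing sequence passes to the
    limit and becomes the constant in the last claim.\<close>
  have bd: "(cmod (comb (v n) z))\<^sup>2 \<le> (2 + 4 * A) * Re (K z z)" if z: "z \<in> \<Omega>" for n z
    using comb_bound[OF v\<Omega> z, of n] mult_right_mono[OF vB[of n] Kpos[OF z]] by simp
  have hc: "holo_fun (comb (v n)) \<Omega>" for n
    unfolding comb_def[abs_def] using v\<Omega>[of n]
    by (intro holo_fun_sum holo_fun_mult holo_fun_const holo_fun_K) (auto simp: fin_coeffs_def)
  show thesis
  proof
    show "holo_fun \<xi> \<Omega>"
    proof (rule holo_fun_limit(1)[of sequentially, where f = "\<lambda>n. comb (v n)"])
      fix x assume "x \<in> \<Omega>"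
      then obtain R C where R: "R > 0" "ball x R \<subseteq> \<Omega>" "\<And>y. y \<in> ball x R \<Longrightarrow> Re (K y y) \<le> C"
        using K_locally_bounded by blast
      have "cmod (comb (v n) y) \<le> sqrt ((2 + 4 * A) * C)" if y: "y \<in> ball x R" for n y
      proof (rule real_le_rsqrt)
        have "(cmod (comb (v n) y))\<^sup>2 \<le> (2 + 4 * A) * Re (K y y)" using bd y R(2) by blast
        also have "\<dots> \<le> (2 + 4 * A) * C" using R(3)[OF y] A0 by (intro mult_left_mono) auto
        finally show "(cmod (comb (v n) y))\<^sup>2 \<le> (2 + 4 * A) * C" .
      qed
      then show "\<exists>R>0. \<exists>C. ball x R \<subseteq> \<Omega> \<and> (\<forall>\<^sub>F n in sequentially.
          holo_fun (comb (v n)) (ball x R) \<and> (\<forall>y\<in>ball x R. cmod (comb (v n) y) \<le> C))"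
        using R(1,2) holo_fun_subset[OF hc R(2)] by (intro exI[of _ R] conjI exI always_eventually) auto
    qed (use \<xi> in auto)
    show "\<xi> w = (\<Sum>j\<in>F. a j * b j w)" if w: "w \<in> N" for w
    proof -
      have "(\<lambda>n. cnj (kernel_form K (delta w) (v n))) \<longlonglongrightarrow> cnj (L (delta w))"
        by (intro tendsto_intros vL delta_in w)
      also have "(\<lambda>n. cnj (kernel_form K (delta w) (v n))) = (\<lambda>n. comb (v n) w)"
        using V.ip_cnj[OF delta_in v\<Omega>, of w] w N(3) by (auto simp: kernel_form_delta)
      finally have "(\<lambda>n. comb (v n) w) \<longlonglongrightarrow> cnj (L (delta w))" .
      moreover have "cnj (L (delta w)) = (\<Sum>j\<in>F. a j * b j w)"
        by (simp add: L_def supp_delta) (simp add: delta_def)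
      ultimately show ?thesis using LIMSEQ_unique \<xi>[of w] w N(3) by auto
    qed
    show "(cmod (\<xi> z))\<^sup>2 \<le> (2 + 4 * (\<Sum>j\<in>F. (cmod (a j))\<^sup>2)) * Re (K z z)" if z: "z \<in> \<Omega>" for z
    proof (rule tendsto_upperbound)
      show "(\<lambda>n. (cmod (comb (v n) z))\<^sup>2) \<longlonglongrightarrow> (cmod (\<xi> z))\<^sup>2" by (intro tendsto_intros \<xi> z)
    qed (use bd[OF z] A_def in auto)
  qed
qed

text \<open>Members are extended one at a time; the square bound on \<Omega> follows by extending a
  combination with well chosen coefficients; then both kernels agree on \<open>N\<close> and hence
  everywhere, one variable at a time.\<close>

proposition kernel_family_extension:
  obtains \<xi> where "sq_bounded_family J \<xi> \<Omega>"
    and "\<And>j z. j \<in> J \<Longrightarrow> z \<in> N \<Longrightarrow> \<xi> j z = b j z"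
    and "\<And>z w. z \<in> \<Omega> \<Longrightarrow> w \<in> \<Omega> \<Longrightarrow> ((\<lambda>j. \<xi> j z * cnj (\<xi> j w)) has_sum K z w) J"
proof -
  have "\<exists>\<xi>. holo_fun \<xi> \<Omega> \<and> (\<forall>w\<in>N. \<xi> w = b j w)" if "j \<in> J" for j
    using extend_combination[of "{j}" "\<lambda>_. 1"] that by (simp, metis)
  then obtain \<xi> where \<xi>: "\<And>j. j \<in> J \<Longrightarrow> holo_fun (\<xi> j) \<Omega>" "\<And>j w. j \<in> J \<Longrightarrow> w \<in> N \<Longrightarrow> \<xi> j w = b j w"
    by metis
  have sq: "sq_bounded J (\<lambda>j. \<xi> j z) (6 * Re (K z z))" if z: "z \<in> \<Omega>" for z
    unfolding sq_bounded_def
  proof (intro allI impI)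
    fix F assume F: "finite F" "F \<subseteq> J"
    define s where "s = (\<Sum>j\<in>F. (cmod (\<xi> j z))\<^sup>2)"
    have "s \<ge> 0" by (simp add: s_def sum_nonneg)
    \<comment> \<open>The coefficients \<open>t *\<^sub>R cnj (\<xi> j z)\<close> make the extended
      combination equal to \<open>t * s\<close> at \<open>z\<close>. The bound is not homogeneous in
      the coefficients, hence the free scale; \<open>t = 1 / sqrt s\<close> gives the factor
      6.\<close>
    have *: "t\<^sup>2 * s\<^sup>2 \<le> (2 + 4 * (t\<^sup>2 * s)) * Re (K z z)" for t :: real
    proof -
      define a where "a j = t *\<^sub>R cnj (\<xi> j z)" for j
      obtain g where g: "holo_fun g \<Omega>" "\<And>w. w \<in> N \<Longrightarrow> g w = (\<Sum>j\<in>F. a j * b j w)"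
        "\<And>z. z \<in> \<Omega> \<Longrightarrow> (cmod (g z))\<^sup>2 \<le> (2 + 4 * (\<Sum>j\<in>F. (cmod (a j))\<^sup>2)) * Re (K z z)"
        by (rule extend_combination[OF F, of a]) (rule that)
      have "g z = (\<Sum>j\<in>F. a j * \<xi> j z)"
      proof (rule holo_fun_identity[OF \<Omega> g(1) _ N])
        show "holo_fun (\<lambda>z. \<Sum>j\<in>F. a j * \<xi> j z) \<Omega>"
          using F by (intro holo_fun_sum holo_fun_mult holo_fun_const \<xi>) auto
        show "g x = (\<Sum>j\<in>F. a j * \<xi> j x)" if x: "x \<in> N" for x
          unfolding g(2)[OF x] using F by (intro sum.cong refl) (auto simp: \<xi>(2) x)
      qed (rule z)
      also have "\<dots> = complex_of_real (t * s)"
        unfolding s_def sum_distrib_left of_real_sum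
        by (intro sum.cong refl) (simp only: a_def scaleR_conv_of_real of_real_mult complex_norm_square mult_ac)
      finally have 1: "(cmod (g z))\<^sup>2 = t\<^sup>2 * s\<^sup>2" by (simp add: norm_mult power_mult_distrib)
      have 2: "(\<Sum>j\<in>F. (cmod (a j))\<^sup>2) = t\<^sup>2 * s"
        by (simp add: a_def s_def power_mult_distrib sum_distrib_left)
      show ?thesis using g(3)[OF z] unfolding 1 2 .
    qed
    show "s \<le> 6 * Re (K z z)"
    proof (cases "s = 0")
      case True
      then show ?thesis using V.ip_nonneg[OF delta_in[OF z]] kernel_form_delta_delta by (simp add: V.q_def)
    next
      case False
      with \<open>s \<ge> 0\<close> have "s > 0" by simp
      then show ?thesis using *[of "1 / sqrt s"] by (simp add: power_divide power2_eq_square)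
    qed
  qed
  have fam: "sq_bounded_family J \<xi> \<Omega>"
    unfolding sq_bounded_family_def
  proof (intro conjI ballI)
    show "\<And>j. j \<in> J \<Longrightarrow> holo_fun (\<xi> j) \<Omega>" by (rule \<xi>)
    fix x assume "x \<in> \<Omega>"
    then obtain R C where R: "R > 0" "ball x R \<subseteq> \<Omega>" "\<And>y. y \<in> ball x R \<Longrightarrow> Re (K y y) \<le> C"
      using K_locally_bounded by blast
    have "sq_bounded J (\<lambda>j. \<xi> j y) (6 * C)" if "y \<in> ball x R" for y
      using sq[of y] R(2) R(3)[OF that] that unfolding sq_bounded_def by fastforce
    then show "\<exists>R>0. \<exists>C. ball x R \<subseteq> \<Omega> \<and> (\<forall>y\<in>ball x R. sq_bounded J (\<lambda>j. \<xi> j y) C)" using R by blast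
  qed
  define K' where "K' z w = (\<Sum>\<^sub>\<infinity>j\<in>J. \<xi> j z * cnj (\<xi> j w))" for z w
  have K': "((\<lambda>j. \<xi> j z * cnj (\<xi> j w)) has_sum K' z w) J" if "z \<in> \<Omega>" "w \<in> \<Omega>" for z w
    unfolding K'_def by (rule has_sum_infsum[OF sq_bounded_family_summable[OF fam that]])
  have hK': "holo_fun (\<lambda>z. K' z w) \<Omega>" if w: "w \<in> \<Omega>" for w
    unfolding K'_def by (rule holo_fun_series[OF fam sq[OF w]])
  have NN: "K' z w = K z w" if "z \<in> N" "w \<in> N" for z w
  proof -
    have "((\<lambda>j. b j z * cnj (b j w)) has_sum K' z w) J"
      using K'[of z w] that N(3) \<xi>(2) by (subst has_sum_cong[where g = "\<lambda>j. \<xi> j z * cnj (\<xi> j w)"]) auto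
    then show ?thesis using b[OF that] has_sum_unique by blast
  qed
  have \<Omega>N: "K' z w = K z w" if "z \<in> \<Omega>" "w \<in> N" for z w
  proof (rule holo_fun_identity[OF \<Omega> hK' holo_fun_K N NN[OF _ that(2)] that(1)])
    show "w \<in> \<Omega>" "w \<in> \<Omega>" using that N(3) by auto
  qed
  \<comment> \<open>The kernels are holomorphic in the first argument only; Hermitian symmetry
    exchanges the arguments for the second use of the identity theorem.\<close>
  have sym: "K' w z = cnj (K' z w)" "K w z = cnj (K z w)" if "z \<in> \<Omega>" "w \<in> \<Omega>" for z w
    by (intro kernel_cnj[OF K'[of z w] K'[of w z]] kernel_cnj[OF K_has_sum[of z w] K_has_sum[of w z]] that)+
  have "K' w z = K w z" if "z \<in> \<Omega>" "w \<in> \<Omega>" for z w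
  proof (rule holo_fun_identity[OF \<Omega> hK'[OF that(1)] holo_fun_K[OF that(1)] N _ that(2)])
    show "K' x z = K x z" if "x \<in> N" for x
      using sym[of z x] \<Omega>N[of z x] that \<open>z \<in> \<Omega>\<close> N(3) by auto
  qed
  then show thesis using that[OF fam \<xi>(2)] K' by metis
qed

end

section \<open>Point evaluation\<close>

lemma nn_integral_lborel_translate:
  fixes c :: "'a::euclidean_space"
  assumes [measurable]: "f \<in> borel_measurable borel"
  shows "(\<integral>\<^sup>+x. f (c + x) \<partial>lborel) = (\<integral>\<^sup>+x. f x \<partial>lborel)"
  by (subst (2) lborel_distr_plus[of c, symmetric]) (simp add: nn_integral_distr)

text \<open>Both sides of the equality are compared by integrating the indicator of \<open>A\<close> over
  \<open>L x + y\<close> with \<open>y\<close> in the unit ball.\<close>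

lemma lborel_distr_isometry:
  fixes L :: "'a::euclidean_space \<Rightarrow> 'a"
  assumes L: "linear L" and iso: "\<And>x. norm (L x) = norm x"
  shows "distr lborel borel L = lborel"
proof (rule measure_eqI)
  have cL: "continuous_on UNIV L" using L by (simp add: linear_continuous_on linear_conv_bounded_linear)
  then have [measurable]: "L \<in> borel_measurable borel" by (rule borel_measurable_continuous_onI)
  have inj: "inj L" using L iso by (metis linear_injective_0 norm_eq_zero)
  then have "surj L" using L linear_injective_imp_surjective by blast
  then obtain L' where L': "\<And>y. L (L' y) = y" by (metis surj_def)
  fix A assume "A \<in> sets (distr lborel borel L)"
  then have A [measurable]: "A \<in> sets borel" by simp
  define B where "B = ball (0::'a) 1"
  have [measurable]: "B \<in> sets borel" by (simp add: B_def)
  have shift: "(\<integral>\<^sup>+x. indicator A (L x + y) \<partial>lborel) = (\<integral>\<^sup>+x. indicator A (L x) \<partial>lborel)" for y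
  proof -
    have "(\<lambda>x. indicator A (L x + y) :: ennreal) = (\<lambda>x. indicator A (L (L' y + x)))"
      using L L' by (simp add: linear_add add.commute)
    then show ?thesis using nn_integral_lborel_translate[of "\<lambda>x. indicator A (L x)" "L' y"] by simp
  qed
  have ballB: "(\<integral>\<^sup>+x. indicator B (y - L x) \<partial>lborel) = emeasure lborel B" for y
  proof -
    have eq: "(\<lambda>x. indicator B (y - L x) :: ennreal) = (\<lambda>x. indicator (ball 0 1) (- L' y + x))"
    proof
      fix x
      have "norm (y - L x) = norm (L (L' y - x))" using L L' by (simp add: linear_diff)
      then have "norm (y - L x) = norm (- L' y + x)" by (simp add: iso norm_minus_commute)
      then show "(indicator B (y - L x) :: ennreal) = indicator (ball 0 1) (- L' y + x)"
        by (simp add: B_def indicator_def)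
    qed
    have "(\<integral>\<^sup>+x. indicator (ball 0 1) (- L' y + x) \<partial>lborel) = (\<integral>\<^sup>+x. indicator (ball (0::'a) 1) x \<partial>lborel)"
      by (rule nn_integral_lborel_translate) (intro borel_measurable_indicator borel_open open_ball)
    also have "\<dots> = emeasure lborel B" by (simp add: B_def)
    finally show ?thesis unfolding eq .
  qed
  have "emeasure (distr lborel borel L) A * emeasure lborel B = (\<integral>\<^sup>+x. indicator A (L x) \<partial>lborel) * emeasure lborel B"
  proof -
    have "(\<integral>\<^sup>+x. indicator A x \<partial>distr lborel borel L) = (\<integral>\<^sup>+x. indicator A (L x) \<partial>lborel)"
      by (rule nn_integral_distr) measurable
    then show ?thesis by simp
  qed
  also have "\<dots> = (\<integral>\<^sup>+y. (\<integral>\<^sup>+x. indicator A (L x + y) \<partial>lborel) * indicator B y \<partial>lborel)"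
    by (simp add: shift nn_integral_cmult)
  also have "\<dots> = (\<integral>\<^sup>+y. (\<integral>\<^sup>+x. indicator A (L x + y) * indicator B y \<partial>lborel) \<partial>lborel)"
    by (simp add: nn_integral_multc)
  also have "\<dots> = (\<integral>\<^sup>+x. (\<integral>\<^sup>+y. indicator A (L x + y) * indicator B y \<partial>lborel) \<partial>lborel)"
    by (rule lborel_pair.Fubini') measurable
  also have "\<dots> = (\<integral>\<^sup>+x. (\<integral>\<^sup>+y. indicator A y * indicator B (y - L x) \<partial>lborel) \<partial>lborel)"
  proof (rule nn_integral_cong)
    fix x
    show "(\<integral>\<^sup>+y. indicator A (L x + y) * indicator B y \<partial>lborel) = (\<integral>\<^sup>+y. indicator A y * indicator B (y - L x) \<partial>lborel)"
      using nn_integral_lborel_translate[of "\<lambda>y. indicator A y * indicator B (y - L x)" "L x"] by simp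
  qed
  also have "\<dots> = (\<integral>\<^sup>+y. (\<integral>\<^sup>+x. indicator A y * indicator B (y - L x) \<partial>lborel) \<partial>lborel)"
    by (rule lborel_pair.Fubini'[symmetric]) measurable
  also have "\<dots> = (\<integral>\<^sup>+y. indicator A y * (\<integral>\<^sup>+x. indicator B (y - L x) \<partial>lborel) \<partial>lborel)"
    by (simp add: nn_integral_cmult)
  also have "\<dots> = emeasure lborel A * emeasure lborel B"
    by (simp add: ballB nn_integral_multc)
  finally have "emeasure (distr lborel borel L) A * emeasure lborel B = emeasure lborel A * emeasure lborel B" .
  moreover have "emeasure lborel B \<noteq> 0"
  proof
    assume "emeasure lborel B = 0"
    then have "negligible B" by (simp add: negligible_iff_null_sets null_sets_def emeasure_completion B_def)
    then show False using open_not_negligible[of B] by (simp add: B_def)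
  qed
  moreover have "emeasure lborel B < \<infinity>" unfolding B_def by (rule emeasure_lborel_ball_finite)
  ultimately show "emeasure (distr lborel borel L) A = emeasure lborel A"
    by (metis ennreal_mult_divide_eq infinity_ennreal_def less_irrefl)
qed simp

lemma cis_circle_mean:
  assumes g: "g holomorphic_on ball 0 R" "R > 1"
  shows "((\<lambda>x. g (exp (2 * pi * \<i> * of_real x))) has_integral g 0) {0..1}"
proof -
  have "g holomorphic_on cball 0 1" using g by (auto intro: holomorphic_on_subset)
  then have "((\<lambda>u. g u / (u - 0)) has_contour_integral (2 * of_real pi * \<i> * g 0)) (circlepath 0 1)"
    by (rule Cauchy_integral_circlepath_simple) auto
  then have "((\<lambda>x. g (circlepath 0 1 x) / circlepath 0 1 x * vector_derivative (circlepath 0 1) (at x within {0..1}))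
      has_integral (2 * of_real pi * \<i> * g 0)) {0..1}"
    by (simp add: has_contour_integral_def)
  \<comment> \<open>On the unit circle the derivative of the path is \<open>2 * pi * \<i>\<close>
    times its position, so the Cauchy kernel cancels.\<close>
  then have "((\<lambda>x. (2 * of_real pi * \<i>) * g (exp (2 * pi * \<i> * of_real x))) has_integral (2 * of_real pi * \<i>) * g 0) {0..1}"
    by (rule has_integral_eq[rotated])
       (subst vector_derivative_circlepath01, simp, simp, simp add: circlepath)
  from has_integral_mult_right[OF this, of "1 / (2 * of_real pi * \<i>)"]
  show ?thesis by (simp add: field_simps)
qed

text \<open>Rotations \<open>v \<mapsto> e x *s v\<close> preserve the ball and Lebesgue measure, so
  the integral may be averaged over them. By Fubini the average over \<open>x\<close> can be taken
  first, and on each complex line through \<open>z\<close> it equals \<open>f z\<close> by the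
  one-variable mean value property.\<close>

lemma mean_value_cball:
  fixes f :: "complex ^ 'n \<Rightarrow> complex"
  assumes f: "holo_fun f S" and S: "open S" "cball z r \<subseteq> S" and r: "r \<ge> 0"
  shows "(LINT v:cball 0 r|lborel. f (z + v)) = measure lborel (cball (0 :: complex ^ 'n) r) *\<^sub>R f z"
proof -
  define e where "e x = exp (2 * pi * \<i> * of_real x)" for x :: real
  have e1: "cmod (e x) = 1" for x by (simp add: e_def norm_exp_eq_Re)
  let ?T = "{0..1::real} \<times> cball (0 :: complex ^ 'n) r"
  define h where "h = (\<lambda>p. indicator ?T p *\<^sub>R f (z + e (fst p) *s snd p))"
  have mem: "z + c *s v \<in> S" if "cmod c = 1" "v \<in> cball 0 r" for c v
    using S(2) that by (auto simp: dist_norm norm_vector_smult subset_iff)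
  have ch: "continuous_on ?T (\<lambda>p. f (z + e (fst p) *s snd p))"
  proof (rule continuous_on_compose2[OF holo_fun_continuous_on[OF f]])
    show "continuous_on ?T (\<lambda>p. z + e (fst p) *s snd p)"
    proof -
      have "(\<lambda>p. z + e (fst p) *s snd p) = (\<lambda>p. \<chi> i. z $ i + e (fst p) * (snd p :: complex ^ 'n) $ i)"
        by (auto simp: vec_eq_iff)
      then show ?thesis by (simp only: e_def) (intro continuous_intros)
    qed
    show "(\<lambda>p. z + e (fst p) *s snd p) ` ?T \<subseteq> S" using mem e1 by auto
  qed
  have int: "integrable (lborel \<Otimes>\<^sub>M lborel) h"
    unfolding h_def lborel_prod by (rule borel_integrable_compact[OF _ ch]) (intro compact_Times compact_Icc compact_cball)
  have c0: "integrable lborel (\<lambda>v. indicator (cball 0 r) v *\<^sub>R f (z + v))"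
  proof (rule borel_integrable_compact)
    show "continuous_on (cball 0 r) (\<lambda>v. f (z + v))"
      by (rule continuous_on_compose2[OF holo_fun_continuous_on[OF f]])
         (use S(2) in \<open>auto intro!: continuous_intros\<close>)
  qed simp
  define J where "J = (LINT v:cball 0 r|lborel. f (z + v))"
  have rot: "(LINT v|lborel. indicator (cball 0 r) v *\<^sub>R f (z + e x *s v)) = J" for x
  proof -
    have L: "linear (\<lambda>v :: complex ^ 'n. e x *s v)" using bounded_linear_smult_right bounded_linear.linear by blast
    have "J = (LINT v|distr lborel borel (\<lambda>v. e x *s v). indicator (cball 0 r) v *\<^sub>R f (z + v))"
      unfolding J_def set_lebesgue_integral_def
      by (subst lborel_distr_isometry[OF L]) (simp_all add: norm_vector_smult e1)
    also have "\<dots> = (LINT v|lborel. indicator (cball 0 r) (e x *s v) *\<^sub>R f (z + e x *s v))"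
    proof (rule integral_distr)
      show "(\<lambda>v. e x *s v) \<in> measurable lborel borel"
        using borel_measurable_continuous_onI[OF linear_continuous_on[OF bounded_linear_smult_right]] by simp
      show "(\<lambda>v. indicator (cball 0 r) v *\<^sub>R f (z + v)) \<in> borel_measurable borel"
        using borel_measurable_integrable[OF c0] by simp
    qed
    also have "\<dots> = (LINT v|lborel. indicator (cball 0 r) v *\<^sub>R f (z + e x *s v))"
      by (intro Bochner_Integration.integral_cong refl) (simp add: indicator_def norm_vector_smult e1)
    finally show ?thesis by simp
  qed
  have "(LINT x|lborel. (LINT v|lborel. h (x, v))) = (LINT v|lborel. (LINT x|lborel. h (x, v)))"
    using lborel_pair.Fubini_integral[of "\<lambda>x v. h (x, v)"] int by simp
  moreover have "(LINT v|lborel. h (x, v)) = indicator {0..1} x *\<^sub>R J" for x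
  proof -
    have "(LINT v|lborel. h (x, v)) = (LINT v|lborel. indicator {0..1} x *\<^sub>R (indicator (cball 0 r) v *\<^sub>R f (z + e x *s v)))"
      by (intro Bochner_Integration.integral_cong refl) (simp add: h_def indicator_def)
    also have "\<dots> = indicator {0..1} x *\<^sub>R J" using rot[of x] by (cases "x \<in> {0..1}") simp_all
    finally show ?thesis .
  qed
  moreover have "(LINT x|lborel. h (x, v)) = indicator (cball 0 r) v *\<^sub>R f z" for v
  proof (cases "v \<in> cball 0 r")
    case False
    then show ?thesis by (simp add: h_def)
  next
    case True
    \<comment> \<open>The circle mean needs holomorphy beyond the closed unit disc. By compactness
      some \<open>d\<close>-neighbourhood of that disc still maps into \<open>S\<close>, and it
      contains the disc of radius \<open>1 + d\<close>, with \<open>sgn t\<close> as the near point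
      for \<open>cmod t > 1\<close>.\<close>
    have "\<exists>R>1. (\<lambda>t. f (z + t *s v)) holomorphic_on ball 0 R"
    proof -
      have "open {t. z + t *s v \<in> S}" by (rule open_line_set[OF S(1)])
      moreover have "cball 0 1 \<subseteq> {t. z + t *s v \<in> S}"
      proof
        fix t :: complex assume "t \<in> cball 0 1"
        then have "norm (t *s v) \<le> r" using True mult_mono[of "cmod t" 1 "norm v" r] r
          by (simp add: norm_vector_smult)
        then show "t \<in> {t. z + t *s v \<in> S}" using S(2) by (auto simp: dist_norm subset_iff)
      qed
      ultimately obtain R where R: "R > 1" "ball 0 R \<subseteq> {t. z + t *s v \<in> S}"
      proof -
        assume a: "\<And>R. 1 < R \<Longrightarrow> ball 0 R \<subseteq> {t. z + t *s v \<in> S} \<Longrightarrow> thesis"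
        assume o: "open {t. z + t *s v \<in> S}" and c: "cball 0 1 \<subseteq> {t. z + t *s v \<in> S}"
        obtain d where d: "d > 0" "(\<Union>x\<in>cball 0 1. ball x d) \<subseteq> {t. z + t *s v \<in> S}"
          using compact_subset_open_imp_ball_epsilon_subset[OF compact_cball o c] by blast
        have "ball (0::complex) (1 + d) \<subseteq> (\<Union>x\<in>cball 0 1. ball x d)"
        proof
          fix t :: complex assume t: "t \<in> ball 0 (1 + d)"
          show "t \<in> (\<Union>x\<in>cball 0 1. ball x d)"
          proof (cases "cmod t \<le> 1")
            case True then show ?thesis using d(1) by (intro UN_I[of t]) auto
          next
            case False
            then have "t \<noteq> 0" by auto
            have "dist (sgn t) t = \<bar>1 - cmod t\<bar>"
            proof -
              have "sgn t - t = complex_of_real (1 - cmod t) * sgn t"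
                using \<open>t \<noteq> 0\<close> by (simp add: sgn_eq field_simps)
              then show ?thesis using \<open>t \<noteq> 0\<close> by (simp only: dist_norm norm_mult norm_of_real norm_sgn) simp
            qed
            then show ?thesis using False t \<open>t \<noteq> 0\<close> by (intro UN_I[of "sgn t"]) (auto simp: norm_sgn)
          qed
        qed
        then show thesis using a[of "1 + d"] d by auto
      qed
      show ?thesis
        by (rule exI[of _ R], rule conjI[OF R(1)], rule holo_fun_line_holomorphic[OF f]) (use R(2) in blast)
    qed
    then obtain R where R: "R > 1" "(\<lambda>t. f (z + t *s v)) holomorphic_on ball 0 R" by blast
    have hi: "((\<lambda>x. f (z + e x *s v)) has_integral f z) {0..1}"
      using cis_circle_mean[OF R(2,1)] by (simp add: e_def)
    have "set_integrable lborel {0..1} (\<lambda>x. f (z + e x *s v))"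
      unfolding set_integrable_def
    proof (rule borel_integrable_compact)
      show "continuous_on {0..1} (\<lambda>x. f (z + e x *s v))"
      proof -
        have "continuous_on {0..1} (\<lambda>x. (\<lambda>p. f (z + e (fst p) *s snd p)) (x, v))"
          by (rule continuous_on_compose2[OF ch], intro continuous_intros) (use True in auto)
        then show ?thesis by simp
      qed
    qed simp
    then have "(LINT x:{0..1}|lborel. f (z + e x *s v)) = f z"
      using set_borel_integral_eq_integral(2) integral_unique[OF hi] by metis
    then show ?thesis using True
      by (simp add: h_def set_lebesgue_integral_def indicator_times)
  qed
  ultimately have "(LINT x|lborel. indicator {0..1::real} x *\<^sub>R J) = (LINT v|lborel. indicator (cball (0 :: complex ^ 'n) r) v *\<^sub>R f z)"
    by simp
  then show ?thesis unfolding J_def[symmetric]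
    using set_integral_const[of "cball (0 :: complex ^ 'n) r" lborel "f z"]
      emeasure_lborel_cball_finite[of "0 :: complex ^ 'n" r] by (simp add: set_lebesgue_integral_def)
qed

lemma point_evaluation_cball:
  fixes f :: "complex ^ 'n \<Rightarrow> complex"
  assumes f: "holo_fun f S" and S: "open S" "cball z r \<subseteq> S" and r: "r \<ge> 0"
    and int: "set_integrable lborel S (\<lambda>w. (cmod (f w))\<^sup>2)"
  shows "measure lborel (cball (0 :: complex ^ 'n) r) * (cmod (f z))\<^sup>2 \<le> (LINT w:S|lborel. (cmod (f w))\<^sup>2)"
proof -
  let ?B = "cball (0 :: complex ^ 'n) r"
  define m where "m = measure lborel ?B"
  have cf: "continuous_on ?B (\<lambda>v. f (z + v))"
    by (rule continuous_on_compose2[OF holo_fun_continuous_on[OF f]])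
       (use S(2) in \<open>auto intro!: continuous_intros simp: dist_norm subset_iff\<close>)
  have i1: "set_integrable lborel ?B (\<lambda>v. f (z + v))"
    unfolding set_integrable_def by (rule borel_integrable_compact[OF _ cf]) simp
  have i2: "set_integrable lborel ?B (\<lambda>v. (cmod (f (z + v)))\<^sup>2)"
    unfolding set_integrable_def by (rule borel_integrable_compact) (auto intro!: continuous_intros cf)
  have i3: "set_integrable lborel ?B (\<lambda>v. Re (cnj (f z) * f (z + v)))"
    unfolding set_integrable_def by (rule borel_integrable_compact) (auto intro!: continuous_intros cf)
  have i4: "set_integrable lborel ?B (\<lambda>v. (cmod (f z))\<^sup>2)"
    unfolding set_integrable_def by (rule borel_integrable_compact) auto
  have "(LINT v:?B|lborel. Re (cnj (f z) * f (z + v))) = Re (LINT v:?B|lborel. cnj (f z) * f (z + v))"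
  proof -
    have "integrable lborel (\<lambda>v. indicator ?B v *\<^sub>R (cnj (f z) * f (z + v)))"
      using set_integrable_mult_right[OF i1] by (simp add: set_integrable_def)
    from integral_Re[OF this] show ?thesis unfolding set_lebesgue_integral_def by simp
  qed
  also have "(LINT v:?B|lborel. cnj (f z) * f (z + v)) = cnj (f z) * (m *\<^sub>R f z)"
    using mean_value_cball[OF f S r] by (simp add: m_def)
  also have "Re (cnj (f z) * (m *\<^sub>R f z)) = m * (cmod (f z))\<^sup>2"
    unfolding cmod_power2 by (simp add: power2_eq_square algebra_simps)
  finally have R: "(LINT v:?B|lborel. Re (cnj (f z) * f (z + v))) = m * (cmod (f z))\<^sup>2" .
  \<comment> \<open>Expanding the square and inserting the mean value of \<open>f\<close> gives the
    mean value inequality for the squared modulus without an appeal to convexity.\<close>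
  have "0 \<le> (LINT v:?B|lborel. (cmod (f (z + v) - f z))\<^sup>2)"
    unfolding set_lebesgue_integral_def by (rule Bochner_Integration.integral_nonneg) simp
  also have "(\<lambda>v. (cmod (f (z + v) - f z))\<^sup>2) =
     (\<lambda>v. (cmod (f (z + v)))\<^sup>2 - 2 * Re (cnj (f z) * f (z + v)) + (cmod (f z))\<^sup>2)"
    by (simp add: fun_eq_iff cmod_power2 power2_diff algebra_simps)
  also have "(LINT v:?B|lborel. (cmod (f (z + v)))\<^sup>2 - 2 * Re (cnj (f z) * f (z + v)) + (cmod (f z))\<^sup>2)
     = (LINT v:?B|lborel. (cmod (f (z + v)))\<^sup>2) - 2 * (m * (cmod (f z))\<^sup>2) + m * (cmod (f z))\<^sup>2"
  proof -
    have I: "integrable lborel (\<lambda>v. indicator ?B v *\<^sub>R (cmod (f (z + v)))\<^sup>2)"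
      "integrable lborel (\<lambda>v. indicator ?B v *\<^sub>R Re (cnj (f z) * f (z + v)))"
      "integrable lborel (\<lambda>v. indicator ?B v *\<^sub>R (cmod (f z))\<^sup>2)"
      using i2 i3 i4 by (auto simp only: set_integrable_def)
    have "(LINT v|lborel. indicator ?B v *\<^sub>R (cmod (f z))\<^sup>2) = m * (cmod (f z))\<^sup>2"
      by (simp add: m_def)
    moreover have "(LINT v|lborel. indicator ?B v *\<^sub>R ((cmod (f (z + v)))\<^sup>2 - 2 * Re (cnj (f z) * f (z + v)) + (cmod (f z))\<^sup>2))
      = (LINT v|lborel. indicator ?B v *\<^sub>R (cmod (f (z + v)))\<^sup>2 - 2 * (indicator ?B v *\<^sub>R Re (cnj (f z) * f (z + v)))
         + indicator ?B v *\<^sub>R (cmod (f z))\<^sup>2)"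
      by (intro Bochner_Integration.integral_cong refl) (simp add: indicator_def)
    ultimately show ?thesis using R I unfolding set_lebesgue_integral_def
      by (simp only: Bochner_Integration.integral_add Bochner_Integration.integral_diff
          Bochner_Integration.integrable_diff integrable_mult_right integral_mult_right_zero)
  qed
  finally have "m * (cmod (f z))\<^sup>2 \<le> (LINT v:?B|lborel. (cmod (f (z + v)))\<^sup>2)" by simp
  also have "\<dots> = (LINT w:cball z r|lborel. (cmod (f w))\<^sup>2)"
  proof -
    have cg: "continuous_on (cball z r) (\<lambda>w. (cmod (f w))\<^sup>2)"
    proof -
      have "continuous_on (cball z r) f" using holo_fun_continuous_on[OF f] S(2) continuous_on_subset by blast
      then show ?thesis by (intro continuous_intros)
    qed
    have "integrable lborel (\<lambda>w. indicator (cball z r) w *\<^sub>R (cmod (f w))\<^sup>2)"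
      by (rule borel_integrable_compact[OF _ cg]) simp
    then have "(\<lambda>w. indicator (cball z r) w *\<^sub>R (cmod (f w))\<^sup>2) \<in> borel_measurable borel"
      using borel_measurable_integrable by fastforce
    then have "(LINT w|distr lborel borel ((+) z). indicator (cball z r) w *\<^sub>R (cmod (f w))\<^sup>2)
       = (LINT v|lborel. indicator (cball z r) (z + v) *\<^sub>R (cmod (f (z + v)))\<^sup>2)"
      by (intro integral_distr) auto
    moreover have "indicator (cball z r) (z + v) = (indicator ?B v :: real)" for v
      by (auto simp: indicator_def dist_norm)
    ultimately show ?thesis unfolding set_lebesgue_integral_def by (simp add: lborel_distr_plus)
  qed
  also have "\<dots> \<le> (LINT w:S|lborel. (cmod (f w))\<^sup>2)"
  proof -
    have "set_integrable lborel (cball z r) (\<lambda>w. (cmod (f w))\<^sup>2)"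
      by (rule set_integrable_subset[OF int]) (use S(2) in auto)
    then show ?thesis using int S(2) unfolding set_lebesgue_integral_def set_integrable_def
      by (intro Bochner_Integration.integral_mono) (auto simp: indicator_def)
  qed
  finally show ?thesis by (simp add: m_def)
qed

text \<open>The radius \<open>d / 3\<close> leaves room for a ball of fixed size around every
  \<open>y\<close> near \<open>x\<close>, so one constant, the inverse of its volume, serves all
  these \<open>y\<close>.\<close>

lemma point_evaluation_bound:
  fixes S :: "(complex ^ 'n) set"
  assumes S: "open S" "x \<in> S"
  obtains R C where "R > 0" "C > 0" "ball x R \<subseteq> S"
    and "\<And>f y. holo_fun f S \<Longrightarrow> set_integrable lborel S (\<lambda>w. (cmod (f w))\<^sup>2) \<Longrightarrow> y \<in> ball x R \<Longrightarrow>
       (cmod (f y))\<^sup>2 \<le> C * (LINT w:S|lborel. (cmod (f w))\<^sup>2)"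
proof -
  obtain d where d: "d > 0" "ball x d \<subseteq> S" using S openE by blast
  define R where "R = d / 3"
  define m where "m = measure lborel (cball (0 :: complex ^ 'n) R)"
  have R: "R > 0" using d by (simp add: R_def)
  have m: "m > 0" unfolding m_def by (rule content_cball_pos[OF R])
  show thesis
  proof (rule that[OF R, of "1 / m"])
    show "ball x R \<subseteq> S" using d R by (auto simp: R_def subset_iff)
    fix f y assume f: "holo_fun f S" "set_integrable lborel S (\<lambda>w. (cmod (f w))\<^sup>2)" and y: "y \<in> ball x R"
    have "cball y R \<subseteq> ball x d"
    proof
      fix w assume "w \<in> cball y R"
      then show "w \<in> ball x d" using y dist_triangle[of x w y] d(1) by (auto simp: R_def)
    qed
    then have "m * (cmod (f y))\<^sup>2 \<le> (LINT w:S|lborel. (cmod (f w))\<^sup>2)"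
      unfolding m_def using d R by (intro point_evaluation_cball f S) auto
    then show "(cmod (f y))\<^sup>2 \<le> 1 / m * (LINT w:S|lborel. (cmod (f w))\<^sup>2)"
      using m by (simp add: field_simps)
  qed (use m in simp)
qed

section \<open>The Hilbert space of square integrable holomorphic functions\<close>

context semi_inner
begin

lemma zero_closed: "V \<noteq> {} \<Longrightarrow> (\<lambda>x. 0) \<in> V"
  using scale_closed[of _ 0] by auto

text \<open>Three claims in one because the induction needs them together: the last one supplies
  orthogonality of the next vector to the combination built so far.\<close>

lemma orthonormal_combination:
  assumes ne: "V \<noteq> {}" and F: "finite F" "F \<subseteq> V"
    and on: "\<And>\<phi> \<psi>. \<phi> \<in> F \<Longrightarrow> \<psi> \<in> F \<Longrightarrow> ip \<phi> \<psi> = (if \<phi> = \<psi> then 1 else 0)"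
  shows "(\<lambda>x. \<Sum>\<phi>\<in>F. a \<phi> * \<phi> x) \<in> V \<and> q (\<lambda>x. \<Sum>\<phi>\<in>F. a \<phi> * \<phi> x) = (\<Sum>\<phi>\<in>F. (cmod (a \<phi>))\<^sup>2)
    \<and> (\<forall>\<psi>\<in>V. (\<forall>\<phi>\<in>F. ip \<phi> \<psi> = 0) \<longrightarrow> ip (\<lambda>x. \<Sum>\<phi>\<in>F. a \<phi> * \<phi> x) \<psi> = 0)"
  using F on
proof (induction F)
  case empty
  obtain f where f: "f \<in> V" using ne by auto
  have z: "ip (\<lambda>x. 0) g = 0" if "g \<in> V" for g using ip_scale[OF f that, of 0] by simp
  then show ?case using zero_closed[OF ne] by (simp add: q_def)
next
  case (insert \<psi> F)
  define f where "f = (\<lambda>x. \<Sum>\<phi>\<in>F. a \<phi> * \<phi> x)"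
  have IH: "f \<in> V" "q f = (\<Sum>\<phi>\<in>F. (cmod (a \<phi>))\<^sup>2)"
    "\<And>\<psi>. \<psi> \<in> V \<Longrightarrow> (\<forall>\<phi>\<in>F. ip \<phi> \<psi> = 0) \<Longrightarrow> ip f \<psi> = 0"
    using insert unfolding f_def by auto
  have \<psi>: "\<psi> \<in> V" using insert by auto
  have eq: "(\<lambda>x. \<Sum>\<phi>\<in>insert \<psi> F. a \<phi> * \<phi> x) = (\<lambda>x. f x + a \<psi> * \<psi> x)"
    using insert by (simp add: f_def add.commute)
  have "ip f \<psi> = 0" using insert.prems insert.hyps by (intro IH(3)[OF \<psi>]) auto
  then have o: "ip \<psi> f = 0" using ip_cnj[OF IH(1) \<psi>] by simp
  have q1: "q \<psi> = 1" using insert.prems by (simp add: q_def)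
  show ?case
    unfolding eq
    using comb_closed[OF IH(1) \<psi>] q_comb[OF IH(1) \<psi>] o q1 IH(2) insert.hyps ip_comb_left[OF IH(1) \<psi>] IH(3)
    by (auto simp: add.commute)
qed

text \<open>Tested on the combination with coefficients \<open>cnj (E \<phi>)\<close>, the
  functional takes the value \<open>s\<close>, while the squared norm is also \<open>s\<close>; thus
  \<open>s\<^sup>2 \<le> C * s\<close>. With evaluations for \<open>E\<close>, this turns point
  evaluation bounds into square bounds for an orthonormal system.\<close>

lemma orthonormal_functional_bound:
  assumes ne: "V \<noteq> {}" and B: "B \<subseteq> V"
    and on: "\<And>\<phi> \<psi>. \<phi> \<in> B \<Longrightarrow> \<psi> \<in> B \<Longrightarrow> ip \<phi> \<psi> = (if \<phi> = \<psi> then 1 else 0)"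
    and E0: "E (\<lambda>x. 0) = 0" and E: "\<And>f g c. f \<in> V \<Longrightarrow> g \<in> V \<Longrightarrow> E (\<lambda>x. f x + c * g x) = E f + c * E g"
    and bound: "\<And>f. f \<in> V \<Longrightarrow> (cmod (E f))\<^sup>2 \<le> C * q f" and C: "C \<ge> 0"
  shows "sq_bounded B E C"
  unfolding sq_bounded_def
proof (intro allI impI)
  fix F assume F: "finite F" "F \<subseteq> B"
  have FV: "F \<subseteq> V" using F B by blast
  have onF: "ip \<phi> \<psi> = (if \<phi> = \<psi> then 1 else 0)" if "\<phi> \<in> F" "\<psi> \<in> F" for \<phi> \<psi> using on that F by blast
  define s where "s = (\<Sum>\<phi>\<in>F. (cmod (E \<phi>))\<^sup>2)"
  have Esum: "E (\<lambda>x. \<Sum>\<phi>\<in>G. a \<phi> * \<phi> x) = (\<Sum>\<phi>\<in>G. a \<phi> * E \<phi>)" if "finite G" "G \<subseteq> F" for G a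
    using that
  proof (induction G)
    case (insert \<psi> G)
    have "(\<lambda>x. \<Sum>\<phi>\<in>G. a \<phi> * \<phi> x) \<in> V"
      using orthonormal_combination[OF ne, of G a] insert FV onF by (auto simp: subset_iff)
    then have "E (\<lambda>x. (\<Sum>\<phi>\<in>G. a \<phi> * \<phi> x) + a \<psi> * \<psi> x) = (\<Sum>\<phi>\<in>G. a \<phi> * E \<phi>) + a \<psi> * E \<psi>"
      using insert FV by (subst E) auto
    then show ?case using insert by (simp add: add.commute)
  qed (simp add: E0)
  have oc: "(\<lambda>x. \<Sum>\<phi>\<in>F. cnj (E \<phi>) * \<phi> x) \<in> V" "q (\<lambda>x. \<Sum>\<phi>\<in>F. cnj (E \<phi>) * \<phi> x) = s"
    using orthonormal_combination[OF ne F(1) FV onF, of "\<lambda>\<phi>. cnj (E \<phi>)"] by (auto simp: s_def)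
  have "E (\<lambda>x. \<Sum>\<phi>\<in>F. cnj (E \<phi>) * \<phi> x) = complex_of_real s"
    unfolding Esum[OF F(1) order_refl] s_def of_real_sum
    by (intro sum.cong refl) (simp only: complex_norm_square mult.commute)
  then have "s\<^sup>2 \<le> C * s" using bound[OF oc(1)] oc(2) by simp
  moreover have "s \<ge> 0" by (simp add: s_def sum_nonneg)
  ultimately have "s \<le> C" using C by (cases "s = 0") (auto simp: power2_eq_square)
  then show "(\<Sum>\<phi>\<in>F. (cmod (E \<phi>))\<^sup>2) \<le> C" by (simp add: s_def)
qed

end

definition L2 :: "'x measure \<Rightarrow> ('x \<Rightarrow> complex) set" where
  "L2 \<mu> = {u. u \<in> borel_measurable \<mu> \<and> integrable \<mu> (\<lambda>x. (cmod (u x))\<^sup>2)}"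

lemma L2_integrable_mult:
  assumes "u \<in> L2 \<mu>" "v \<in> L2 \<mu>"
  shows "integrable \<mu> (\<lambda>x. u x * cnj (v x))"
proof (rule Bochner_Integration.integrable_bound)
  show "integrable \<mu> (\<lambda>x. ((cmod (u x))\<^sup>2 + (cmod (v x))\<^sup>2) / 2)" using assms by (simp add: L2_def)
  have [measurable]: "u \<in> borel_measurable \<mu>" "v \<in> borel_measurable \<mu>" using assms by (auto simp: L2_def)
  have "(\<lambda>x. cnj (v x)) \<in> borel_measurable \<mu>"
    by (rule measurable_compose[of v _ borel]) (auto intro!: borel_measurable_continuous_onI continuous_intros)
  then show "(\<lambda>x. u x * cnj (v x)) \<in> borel_measurable \<mu>" by measurable
  show "AE x in \<mu>. norm (u x * cnj (v x)) \<le> norm (((cmod (u x))\<^sup>2 + (cmod (v x))\<^sup>2) / 2)"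
  proof (rule AE_I2)
    fix x
    have "norm (u x * cnj (v x)) \<le> ((cmod (u x))\<^sup>2 + (cmod (v x))\<^sup>2) / 2" by (rule cmod_mult_cnj_le)
    also have "\<dots> \<le> norm (((cmod (u x))\<^sup>2 + (cmod (v x))\<^sup>2) / 2)" by simp
    finally show "norm (u x * cnj (v x)) \<le> norm (((cmod (u x))\<^sup>2 + (cmod (v x))\<^sup>2) / 2)" .
  qed
qed

lemma L2_scale: "u \<in> L2 \<mu> \<Longrightarrow> (\<lambda>x. c * u x) \<in> L2 \<mu>"
  by (auto simp: L2_def norm_mult power_mult_distrib)

lemma L2_add:
  assumes "u \<in> L2 \<mu>" "v \<in> L2 \<mu>"
  shows "(\<lambda>x. u x + v x) \<in> L2 \<mu>"
proof -
  have "integrable \<mu> (\<lambda>x. (cmod (u x + v x))\<^sup>2)"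
  proof (rule Bochner_Integration.integrable_bound)
    show "integrable \<mu> (\<lambda>x. 2 * (cmod (u x))\<^sup>2 + 2 * (cmod (v x))\<^sup>2)" using assms by (simp add: L2_def)
    have [measurable]: "u \<in> borel_measurable \<mu>" "v \<in> borel_measurable \<mu>" using assms by (auto simp: L2_def)
    show "(\<lambda>x. (cmod (u x + v x))\<^sup>2) \<in> borel_measurable \<mu>" by measurable
    show "AE x in \<mu>. norm ((cmod (u x + v x))\<^sup>2) \<le> norm (2 * (cmod (u x))\<^sup>2 + 2 * (cmod (v x))\<^sup>2)"
    proof (rule AE_I2)
      fix x
      have "(cmod (u x + v x))\<^sup>2 \<le> (cmod (u x) + cmod (v x))\<^sup>2" by (intro power_mono norm_triangle_ineq) auto
      also have "\<dots> \<le> 2 * (cmod (u x))\<^sup>2 + 2 * (cmod (v x))\<^sup>2"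
        using sum_squares_bound[of "cmod (u x)" "cmod (v x)"] by (simp add: power2_sum)
      finally show "norm ((cmod (u x + v x))\<^sup>2) \<le> norm (2 * (cmod (u x))\<^sup>2 + 2 * (cmod (v x))\<^sup>2)" by simp
    qed
  qed
  then show ?thesis using assms by (auto simp: L2_def)
qed

lemma semi_inner_L2: "semi_inner (L2 \<mu>) (\<lambda>u v. LINT x|\<mu>. u x * cnj (v x))"
proof
  fix f g h :: "'a \<Rightarrow> complex" and c :: complex
  assume f: "f \<in> L2 \<mu>"
  show "(\<lambda>x. c * f x) \<in> L2 \<mu>" using f by (rule L2_scale)
  show "0 \<le> Re (LINT x|\<mu>. f x * cnj (f x))"
    using integral_Re[OF L2_integrable_mult[OF f f], symmetric]
    by (simp add: complex_mult_cnj)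
  assume g: "g \<in> L2 \<mu>"
  show "(\<lambda>x. f x + g x) \<in> L2 \<mu>" using f g by (rule L2_add)
  show "(LINT x|\<mu>. c * f x * cnj (g x)) = c * (LINT x|\<mu>. f x * cnj (g x))"
    by (simp add: mult.assoc)
  have "(LINT x|\<mu>. cnj (f x * cnj (g x))) = cnj (LINT x|\<mu>. f x * cnj (g x))"
    by (rule integral_bounded_linear'[OF bounded_linear_cnj bounded_linear_cnj]) (simp_all add: L2_integrable_mult f g)
  then show "(LINT x|\<mu>. g x * cnj (f x)) = cnj (LINT x|\<mu>. f x * cnj (g x))"
    by (simp add: mult.commute)
  assume h: "h \<in> L2 \<mu>"
  show "(LINT x|\<mu>. (f x + g x) * cnj (h x)) = (LINT x|\<mu>. f x * cnj (h x)) + (LINT x|\<mu>. g x * cnj (h x))"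
    by (simp add: distrib_right L2_integrable_mult f g h)
qed

text \<open>Serves both Bergman spaces: \<open>e\<close> sends a function or a form to an element of
  an \<open>L2\<close> space, and \<open>k\<close> absorbs the normalization of the inner product of
  forms.\<close>

lemma semi_inner_pullback:
  assumes "semi_inner V ip"
    and H: "\<And>f g. f \<in> H \<Longrightarrow> g \<in> H \<Longrightarrow> (\<lambda>x. f x + g x) \<in> H" "\<And>f c. f \<in> H \<Longrightarrow> (\<lambda>x. c * f x) \<in> H"
    and e: "\<And>f. f \<in> H \<Longrightarrow> e f \<in> V"
    and lin: "\<And>f g. f \<in> H \<Longrightarrow> g \<in> H \<Longrightarrow> e (\<lambda>x. f x + g x) = (\<lambda>y. e f y + e g y)"
      "\<And>f c. f \<in> H \<Longrightarrow> e (\<lambda>x. c * f x) = (\<lambda>y. c * e f y)"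
    and ip': "\<And>f g. f \<in> H \<Longrightarrow> g \<in> H \<Longrightarrow> ip' f g = complex_of_real k * ip (e f) (e g)" and k: "k \<ge> 0"
  shows "semi_inner H ip'"
proof -
  interpret semi_inner V ip by fact
  show ?thesis
  proof
    fix f g h :: "'b \<Rightarrow> complex" and c :: complex
    assume f: "f \<in> H"
    show "(\<lambda>x. c * f x) \<in> H" using f by (rule H)
    show "0 \<le> Re (ip' f f)" using ip_nonneg[OF e[OF f]] k by (simp add: ip'[OF f f])
    assume g: "g \<in> H"
    show "(\<lambda>x. f x + g x) \<in> H" using f g by (rule H)
    show "ip' (\<lambda>x. c * f x) g = c * ip' f g"
      by (simp add: ip'[OF H(2)[OF f] g] ip'[OF f g] lin(2)[OF f] ip_scale[OF e[OF f] e[OF g]])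
    show "ip' g f = cnj (ip' f g)"
      by (simp add: ip'[OF f g] ip'[OF g f] ip_cnj[OF e[OF f] e[OF g]])
    assume h: "h \<in> H"
    show "ip' (\<lambda>x. f x + g x) h = ip' f h + ip' g h"
      by (simp add: ip'[OF H(1)[OF f g] h] ip'[OF f h] ip'[OF g h] lin(1)[OF f g]
          ip_add[OF e[OF f] e[OF g] e[OF h]] distrib_left)
  qed
qed


lemma holo_fun_indicator_measurable:
  assumes "holo_fun f S" "open S"
  shows "(\<lambda>z. indicator S z *\<^sub>R f z) \<in> borel_measurable lborel"
  using borel_measurable_continuous_on_indicator[OF _ holo_fun_continuous_on[OF assms(1)]] assms(2) by simp

lemma domain_A2_iff:
  assumes "open \<Omega>"
  shows "f \<in> domain_A2 \<Omega> \<longleftrightarrow> holo_fun f \<Omega> \<and> (\<lambda>z. indicator \<Omega> z *\<^sub>R f z) \<in> L2 lborel"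
proof -
  have "(\<lambda>z. (cmod (indicator \<Omega> z *\<^sub>R f z))\<^sup>2) = (\<lambda>z. indicator \<Omega> z *\<^sub>R (cmod (f z))\<^sup>2)"
    by (auto simp: fun_eq_iff indicator_def)
  then show ?thesis
    using holo_fun_indicator_measurable[OF _ assms, of f]
    unfolding domain_A2_def L2_def set_integrable_def by auto
qed

lemma domain_inner_eq:
  "domain_inner \<Omega> f g = (LINT z|lborel. (indicator \<Omega> z *\<^sub>R f z) * cnj (indicator \<Omega> z *\<^sub>R g z))"
  unfolding domain_inner_def set_lebesgue_integral_def
  by (intro Bochner_Integration.integral_cong refl) (auto simp: indicator_def)

lemma semi_inner_domain:
  assumes \<Omega>: "open \<Omega>"
  shows "semi_inner (domain_A2 \<Omega>) (domain_inner \<Omega>)"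
proof (rule semi_inner_pullback[OF semi_inner_L2, where e = "\<lambda>f z. indicator \<Omega> z *\<^sub>R f z" and k = 1 and \<mu>1 = lborel])
  fix f g :: "complex ^ 'a \<Rightarrow> complex" and c :: complex
  assume f: "f \<in> domain_A2 \<Omega>"
  have s: "(\<lambda>z. indicator \<Omega> z *\<^sub>R (c * f z)) = (\<lambda>z. c * (indicator \<Omega> z *\<^sub>R f z))" by (auto simp: fun_eq_iff)
  then show "(\<lambda>z. indicator \<Omega> z *\<^sub>R (c * f z)) = (\<lambda>z. c * (indicator \<Omega> z *\<^sub>R f z))" .
  show "(\<lambda>x. c * f x) \<in> domain_A2 \<Omega>"
    using f holo_fun_mult[OF holo_fun_const, of f \<Omega> c] L2_scale[of "\<lambda>z. indicator \<Omega> z *\<^sub>R f z" lborel c]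
    unfolding domain_A2_iff[OF \<Omega>] s by blast
  show "(\<lambda>z. indicator \<Omega> z *\<^sub>R f z) \<in> L2 lborel" using f domain_A2_iff[OF \<Omega>] by blast
  assume g: "g \<in> domain_A2 \<Omega>"
  have a: "(\<lambda>z. indicator \<Omega> z *\<^sub>R (f z + g z)) = (\<lambda>z. indicator \<Omega> z *\<^sub>R f z + indicator \<Omega> z *\<^sub>R g z)"
    by (auto simp: fun_eq_iff algebra_simps)
  then show "(\<lambda>z. indicator \<Omega> z *\<^sub>R (f z + g z)) = (\<lambda>z. indicator \<Omega> z *\<^sub>R f z + indicator \<Omega> z *\<^sub>R g z)" .
  show "(\<lambda>x. f x + g x) \<in> domain_A2 \<Omega>"
    using f g holo_fun_add[of f \<Omega> g] L2_add[of "\<lambda>z. indicator \<Omega> z *\<^sub>R f z" lborel "\<lambda>z. indicator \<Omega> z *\<^sub>R g z"]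
    unfolding domain_A2_iff[OF \<Omega>] a by blast
  show "domain_inner \<Omega> f g = complex_of_real 1 * (LINT z|lborel. (indicator \<Omega> z *\<^sub>R f z) * cnj (indicator \<Omega> z *\<^sub>R g z))"
    by (simp only: domain_inner_eq of_real_1 mult_1)
qed simp

lemma domain_inner_self: "Re (domain_inner \<Omega> f f) = (LINT z:\<Omega>|lborel. (cmod (f z))\<^sup>2)"
proof -
  have "domain_inner \<Omega> f f = (LINT z|lborel. complex_of_real (indicator \<Omega> z *\<^sub>R (cmod (f z))\<^sup>2))"
    unfolding domain_inner_def set_lebesgue_integral_def
    by (intro Bochner_Integration.integral_cong refl)
       (simp only: scaleR_conv_of_real[where 'a = complex] of_real_mult complex_norm_square real_scaleR_def)
  then show ?thesis unfolding set_lebesgue_integral_def integral_complex_of_real by simp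
qed

lemma domain_A2_point_evaluation:
  fixes \<Omega> :: "(complex ^ 'n) set"
  assumes \<Omega>: "open \<Omega>" and x: "x \<in> \<Omega>"
  obtains R C where "R > 0" "C > 0" "ball x R \<subseteq> \<Omega>"
    and "\<And>f y. f \<in> domain_A2 \<Omega> \<Longrightarrow> y \<in> ball x R \<Longrightarrow> (cmod (f y))\<^sup>2 \<le> C * Re (domain_inner \<Omega> f f)"
proof -
  obtain R C where RC: "R > 0" "C > 0" "ball x R \<subseteq> \<Omega>"
    and b: "\<And>f y. holo_fun f \<Omega> \<Longrightarrow> set_integrable lborel \<Omega> (\<lambda>w. (cmod (f w))\<^sup>2) \<Longrightarrow> y \<in> ball x R \<Longrightarrow>
       (cmod (f y))\<^sup>2 \<le> C * (LINT w:\<Omega>|lborel. (cmod (f w))\<^sup>2)"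
    using point_evaluation_bound[OF \<Omega> x] by metis
  show thesis
    by (rule that[OF RC]) (auto simp: domain_A2_def domain_inner_self intro: b)
qed

text \<open>Stated only for sequences with the rate that \<open>Riesz_minimizing_sequence\<close>
  delivers. Point evaluation bounds give a holomorphic pointwise limit, and Fatou's lemma gives the
  estimate in norm.\<close>

lemma domain_A2_complete:
  fixes v :: "nat \<Rightarrow> complex ^ 'n \<Rightarrow> complex"
  assumes \<Omega>: "open \<Omega>" and v: "\<And>n. v n \<in> domain_A2 \<Omega>"
    and bd: "\<And>n. Re (domain_inner \<Omega> (v n) (v n)) \<le> D"
    and cau: "\<And>m n. Re (domain_inner \<Omega> (\<lambda>x. v m x - v n x) (\<lambda>x. v m x - v n x)) \<le> 2 * (1 / Suc m + 1 / Suc n)"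
  obtains r where "r \<in> domain_A2 \<Omega>"
    and "\<And>n. Re (domain_inner \<Omega> (\<lambda>x. v n x - r x) (\<lambda>x. v n x - r x)) \<le> 4 / Suc n"
proof -
  interpret semi_inner "domain_A2 \<Omega>" "domain_inner \<Omega>" by (rule semi_inner_domain[OF \<Omega>])
  have dv: "(\<lambda>x. v m x - v n x) \<in> domain_A2 \<Omega>" for m n
    using comb_closed[OF v[of m] v[of n], of "-1"] by simp
  have "convergent (\<lambda>n. v n z)" if z: "z \<in> \<Omega>" for z
  proof (rule Cauchy_convergent, rule metric_CauchyI)
    obtain R C where RC: "R > 0" "C > 0"
      "\<And>f y. f \<in> domain_A2 \<Omega> \<Longrightarrow> y \<in> ball z R \<Longrightarrow> (cmod (f y))\<^sup>2 \<le> C * Re (domain_inner \<Omega> f f)"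
      using domain_A2_point_evaluation[OF \<Omega> z] by metis
    fix e :: real assume e: "e > 0"
    obtain M :: nat where M: "4 * C / e\<^sup>2 < M" using reals_Archimedean2 by blast
    have "dist (v m z) (v n z) < e" if mn: "m \<ge> M" "n \<ge> M" for m n
    proof -
      have "(dist (v m z) (v n z))\<^sup>2 \<le> C * Re (domain_inner \<Omega> (\<lambda>x. v m x - v n x) (\<lambda>x. v m x - v n x))"
        using RC(3)[OF dv, of z m n] RC(1) by (simp add: dist_norm)
      also have "\<dots> \<le> C * (2 * (1 / Suc m + 1 / Suc n))"
        using RC(2) by (intro mult_left_mono cau) auto
      also have "\<dots> \<le> C * (2 * (1 / Suc M + 1 / Suc M))"
        using mn RC(2) by (intro mult_left_mono add_mono divide_left_mono) auto
      also have "\<dots> = 4 * C / Suc M" by simp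
      also have "\<dots> < e\<^sup>2"
      proof -
        have "4 * C < e\<^sup>2 * real (Suc M)"
        proof -
          have "4 * C < e\<^sup>2 * real M" using M e by (simp add: field_simps)
          also have "\<dots> \<le> e\<^sup>2 * real (Suc M)" by (intro mult_left_mono) auto
          finally show ?thesis .
        qed
        then show ?thesis by (simp add: field_simps)
      qed
      finally show ?thesis using e by (simp add: power2_less_imp_less)
    qed
    then show "\<exists>M. \<forall>m\<ge>M. \<forall>n\<ge>M. dist (v m z) (v n z) < e" by blast
  qed
  then obtain r where r: "\<And>z. z \<in> \<Omega> \<Longrightarrow> (\<lambda>n. v n z) \<longlonglongrightarrow> r z"
    unfolding convergent_def by metis
  have hv: "holo_fun (v n) \<Omega>" for n using v by (simp add: domain_A2_def)
  have hr: "holo_fun r \<Omega>"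
  proof (rule holo_fun_limit(1)[of sequentially, where f = v])
    fix x assume "x \<in> \<Omega>"
    then obtain R C where RC: "R > 0" "C > 0" "ball x R \<subseteq> \<Omega>"
      "\<And>f y. f \<in> domain_A2 \<Omega> \<Longrightarrow> y \<in> ball x R \<Longrightarrow> (cmod (f y))\<^sup>2 \<le> C * Re (domain_inner \<Omega> f f)"
      using domain_A2_point_evaluation[OF \<Omega>] by metis
    have "cmod (v n y) \<le> sqrt (C * D)" if y: "y \<in> ball x R" for n y
      by (rule real_le_rsqrt, rule order_trans[OF RC(4)[OF v y] mult_left_mono[OF bd]]) (use RC(2) in simp)
    then show "\<exists>R>0. \<exists>C. ball x R \<subseteq> \<Omega> \<and> (\<forall>\<^sub>F n in sequentially.
        holo_fun (v n) (ball x R) \<and> (\<forall>y\<in>ball x R. cmod (v n y) \<le> C))"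
      using RC(1,3) holo_fun_subset[OF hv RC(3)] by (intro exI[of _ R] conjI exI always_eventually) auto
  qed (use r in auto)
  have est: "(\<lambda>x. v n x - r x) \<in> domain_A2 \<Omega> \<and>
      Re (domain_inner \<Omega> (\<lambda>x. v n x - r x) (\<lambda>x. v n x - r x)) \<le> 4 / Suc n" for n
  proof -
    define u where "u m z = indicator \<Omega> z *\<^sub>R (cmod (v n z - v m z))\<^sup>2" for m z
    define w where "w z = indicator \<Omega> z *\<^sub>R (cmod (v n z - r z))\<^sup>2" for z
    have uint: "integrable lborel (u m)" for m
      using dv[of n m] unfolding u_def domain_A2_def set_integrable_def by simp
    have [measurable]: "w \<in> borel_measurable lborel"
    proof -
      have "(\<lambda>z. indicator \<Omega> z *\<^sub>R (v n z - r z)) \<in> borel_measurable lborel"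
        by (rule holo_fun_indicator_measurable[OF holo_fun_diff[OF hv hr] \<Omega>])
      then have "(\<lambda>z. (cmod (indicator \<Omega> z *\<^sub>R (v n z - r z)))\<^sup>2) \<in> borel_measurable lborel" by measurable
      moreover have "(\<lambda>z. (cmod (indicator \<Omega> z *\<^sub>R (v n z - r z)))\<^sup>2) = w"
        by (auto simp: w_def fun_eq_iff indicator_def)
      ultimately show ?thesis by simp
    qed
    have lim: "(\<lambda>m. u m z) \<longlonglongrightarrow> w z" for z
    proof (cases "z \<in> \<Omega>")
      case True
      then show ?thesis unfolding u_def w_def by (intro tendsto_intros r)
    qed (simp add: u_def w_def)
    \<comment> \<open>Fatou's lemma for \<open>m\<close> tending to infinity with \<open>n\<close>
      fixed; only \<open>m \<ge> n\<close> matter, where the Cauchy rate is at most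
      \<open>4 / Suc n\<close>.\<close>
    have "(\<integral>\<^sup>+z. ennreal (w z) \<partial>lborel) = (\<integral>\<^sup>+z. liminf (\<lambda>m. ennreal (u m z)) \<partial>lborel)"
      using lim by (intro nn_integral_cong lim_imp_Liminf[symmetric] tendsto_ennrealI) auto
    also have "\<dots> \<le> liminf (\<lambda>m. \<integral>\<^sup>+z. ennreal (u m z) \<partial>lborel)"
      using uint by (intro nn_integral_liminf) auto
    also have "\<dots> \<le> liminf (\<lambda>m::nat. ennreal (4 / Suc n))"
    proof (rule Liminf_mono)
      have "(\<integral>\<^sup>+z. ennreal (u m z) \<partial>lborel) \<le> ennreal (4 / Suc n)" if "m \<ge> n" for m
      proof -
        have "(\<integral>\<^sup>+z. ennreal (u m z) \<partial>lborel) = ennreal (LINT z|lborel. u m z)"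
          by (rule nn_integral_eq_integral[OF uint]) (simp add: u_def)
        also have "(LINT z|lborel. u m z) = Re (domain_inner \<Omega> (\<lambda>x. v n x - v m x) (\<lambda>x. v n x - v m x))"
          by (simp add: domain_inner_self u_def set_lebesgue_integral_def)
        also have "ennreal \<dots> \<le> ennreal (2 * (1 / Suc n + 1 / Suc m))" by (intro ennreal_leI cau)
        also have "\<dots> \<le> ennreal (2 * (1 / Suc n + 1 / Suc n))"
          using that by (intro ennreal_leI mult_left_mono add_mono divide_left_mono) auto
        finally show ?thesis by simp
      qed
      then show "\<forall>\<^sub>F m in sequentially. (\<integral>\<^sup>+z. ennreal (u m z) \<partial>lborel) \<le> ennreal (4 / Suc n)"
        by (auto simp: eventually_sequentially)
    qed
    also have "\<dots> = ennreal (4 / Suc n)" by (simp add: Liminf_const)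
    finally have fin: "(\<integral>\<^sup>+z. ennreal (w z) \<partial>lborel) \<le> ennreal (4 / Suc n)" .
    have wpos: "w z \<ge> 0" for z by (simp add: w_def)
    have wint: "integrable lborel w"
    proof (rule integrableI_nonneg)
      show "(\<integral>\<^sup>+z. ennreal (w z) \<partial>lborel) < \<infinity>" using fin by (simp add: le_less_trans)
    qed (use wpos in auto)
    have "ennreal (LINT z|lborel. w z) \<le> ennreal (4 / Suc n)"
      using fin nn_integral_eq_integral[OF wint] wpos by simp
    then have "(LINT z|lborel. w z) \<le> 4 / Suc n" by (subst (asm) ennreal_le_iff) auto
    moreover have "(\<lambda>x. v n x - r x) \<in> domain_A2 \<Omega>"
      using wint holo_fun_diff[OF hv hr] unfolding domain_A2_def set_integrable_def w_def by simp
    ultimately show ?thesis by (simp add: domain_inner_self w_def set_lebesgue_integral_def)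
  qed
  show thesis
  proof (rule that)
    \<comment> \<open>\<open>r\<close> is the difference of \<open>v 0\<close> and
      \<open>v 0 - r\<close>, both known to be square integrable.\<close>
    show "r \<in> domain_A2 \<Omega>" using comb_closed[OF v[of 0] conjunct1[OF est[of 0]], of "-1"] by simp
  qed (use est in blast)
qed

text \<open>Completeness of \<open>B\<close> speaks only of vectors orthogonal to \<open>B\<close>.
  Riesz representation converts it into the density needed later: \<open>L\<close> is the product
  with some \<open>r\<close>, which is orthogonal to \<open>B\<close> and therefore has norm
  0.\<close>

proposition bounded_functional_zero:
  fixes \<Omega> :: "(complex ^ 'n) set"
  assumes \<Omega>: "open \<Omega>" and B: "complete_orthonormal_system (domain_inner \<Omega>) (domain_A2 \<Omega>) B"
    and L_add: "\<And>f g. f \<in> domain_A2 \<Omega> \<Longrightarrow> g \<in> domain_A2 \<Omega> \<Longrightarrow> L (\<lambda>x. f x + g x) = L f + L g"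
    and L_scale: "\<And>f c. f \<in> domain_A2 \<Omega> \<Longrightarrow> L (\<lambda>x. c * f x) = c * L f"
    and L_bound: "\<And>f. f \<in> domain_A2 \<Omega> \<Longrightarrow> (cmod (L f))\<^sup>2 \<le> C * Re (domain_inner \<Omega> f f)" and C: "C \<ge> 0"
    and L0: "\<And>\<phi>. \<phi> \<in> B \<Longrightarrow> L \<phi> = 0" and g: "g \<in> domain_A2 \<Omega>"
  shows "L g = 0"
proof -
  interpret semi_inner "domain_A2 \<Omega>" "domain_inner \<Omega>" by (rule semi_inner_domain[OF \<Omega>])
  have ne: "domain_A2 \<Omega> \<noteq> {}" using g by blast
  obtain v where v: "\<And>n::nat. v n \<in> domain_A2 \<Omega>"
    "\<And>m n. q (\<lambda>x. v m x - v n x) \<le> 2 * (1 / Suc m + 1 / Suc n)" "\<And>n. q (v n) \<le> 2 + 4 * C"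
    "\<And>f. f \<in> domain_A2 \<Omega> \<Longrightarrow> (\<lambda>n. domain_inner \<Omega> f (v n)) \<longlonglongrightarrow> L f"
    using Riesz_minimizing_sequence[OF ne L_add L_scale L_bound[folded q_def] C] by blast
  obtain r where r: "r \<in> domain_A2 \<Omega>" "\<And>n. q (\<lambda>x. v n x - r x) \<le> 4 / Suc n"
    using domain_A2_complete[OF \<Omega> v(1) v(3)[unfolded q_def] v(2)[unfolded q_def]] unfolding q_def by blast
  have L_eq: "L f = domain_inner \<Omega> f r" if f: "f \<in> domain_A2 \<Omega>" for f
  proof -
    have "(cmod (domain_inner \<Omega> f (v n) - domain_inner \<Omega> f r))\<^sup>2 \<le> q f * (4 / Suc n)" for n
    proof -
      have d: "(\<lambda>x. v n x - r x) \<in> domain_A2 \<Omega>" using comb_closed[OF v(1)[of n] r(1), of "-1"] by simp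
      have "domain_inner \<Omega> f (v n) - domain_inner \<Omega> f r = domain_inner \<Omega> f (\<lambda>x. v n x - r x)"
        using ip_comb_right[OF v(1)[of n] r(1) f, of "-1"] by simp
      then have "(cmod (domain_inner \<Omega> f (v n) - domain_inner \<Omega> f r))\<^sup>2 \<le> q f * q (\<lambda>x. v n x - r x)"
        using Cauchy_Schwarz[OF f d] by simp
      also have "\<dots> \<le> q f * (4 / Suc n)"
        using r(2)[of n] ip_nonneg[OF f] by (intro mult_left_mono) (auto simp: q_def)
      finally show ?thesis .
    qed
    note est = this
    have "(\<lambda>n. q f * (4 * inverse (real (Suc n)))) \<longlonglongrightarrow> q f * (4 * 0)"
      by (intro tendsto_intros LIMSEQ_inverse_real_of_nat)
    then have lim0: "(\<lambda>n. q f * (4 / Suc n)) \<longlonglongrightarrow> 0" by (simp add: divide_inverse)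
    have "(\<lambda>n. (cmod (domain_inner \<Omega> f (v n) - domain_inner \<Omega> f r))\<^sup>2) \<longlonglongrightarrow> 0"
      by (rule tendsto_sandwich[OF _ _ tendsto_const lim0]) (intro always_eventually allI est zero_le_power2)+
    then have "(\<lambda>n. sqrt ((cmod (domain_inner \<Omega> f (v n) - domain_inner \<Omega> f r))\<^sup>2)) \<longlonglongrightarrow> sqrt 0" by (intro tendsto_intros)
    then have "(\<lambda>n. domain_inner \<Omega> f (v n) - domain_inner \<Omega> f r) \<longlonglongrightarrow> 0" by (simp add: tendsto_norm_zero_iff)
    then have "(\<lambda>n. domain_inner \<Omega> f (v n)) \<longlonglongrightarrow> domain_inner \<Omega> f r" by (simp add: LIM_zero_iff)
    then show ?thesis using v(4)[OF f] LIMSEQ_unique by blast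
  qed
  have "domain_inner \<Omega> r \<phi> = 0" if \<phi>: "\<phi> \<in> B" for \<phi>
  proof -
    have "\<phi> \<in> domain_A2 \<Omega>" using B \<phi> unfolding complete_orthonormal_system_def by blast
    then show ?thesis using L0[OF \<phi>] L_eq[of \<phi>] ip_cnj[of \<phi> r] r(1) by simp
  qed
  then have "domain_inner \<Omega> r r = 0" using B r(1) unfolding complete_orthonormal_system_def by blast
  then show ?thesis using L_eq[OF g] Cauchy_Schwarz[OF g r(1)] by (simp add: q_def)
qed

section \<open>Bergman bases of bounded domains\<close>

text \<open>The very choice made inside \<open>domain_kernel\<close>, so that the kernel is the sum
  over this set.\<close>

definition bergman_basis :: "(complex ^ 'n) set \<Rightarrow> (complex ^ 'n \<Rightarrow> complex) set" where
  "bergman_basis \<Omega> = (SOME B. complete_orthonormal_system (domain_inner \<Omega>) (domain_A2 \<Omega>) B)"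

lemma bergman_basis:
  assumes "open \<Omega>"
  shows "complete_orthonormal_system (domain_inner \<Omega>) (domain_A2 \<Omega>) (bergman_basis \<Omega>)"
proof -
  interpret semi_inner "domain_A2 \<Omega>" "domain_inner \<Omega>" by (rule semi_inner_domain[OF assms])
  have "\<exists>B. complete_orthonormal_system (domain_inner \<Omega>) (domain_A2 \<Omega>) B"
    by (rule maximal_orthonormal_system[where sc = "\<lambda>c f x. c * f x"])
       (rule scale_closed ip_scale ip_cnj ip_nonneg; assumption)+
  then show ?thesis unfolding bergman_basis_def by (rule someI_ex)
qed

lemma sq_bounded_family_bergman_basis:
  fixes \<Omega> :: "(complex ^ 'n) set"
  assumes \<Omega>: "open \<Omega>"
  shows "sq_bounded_family (bergman_basis \<Omega>) (\<lambda>\<phi>. \<phi>) \<Omega>"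
  unfolding sq_bounded_family_def
proof (intro conjI ballI)
  interpret semi_inner "domain_A2 \<Omega>" "domain_inner \<Omega>" by (rule semi_inner_domain[OF \<Omega>])
  have B: "bergman_basis \<Omega> \<subseteq> domain_A2 \<Omega>"
    "\<And>\<phi> \<psi>. \<phi> \<in> bergman_basis \<Omega> \<Longrightarrow> \<psi> \<in> bergman_basis \<Omega> \<Longrightarrow> domain_inner \<Omega> \<phi> \<psi> = (if \<phi> = \<psi> then 1 else 0)"
    using bergman_basis[OF \<Omega>] unfolding complete_orthonormal_system_def by auto
  show "holo_fun \<phi> \<Omega>" if "\<phi> \<in> bergman_basis \<Omega>" for \<phi>
    using B(1) that unfolding domain_A2_def by blast
  fix x assume "x \<in> \<Omega>"
  then obtain R C where RC: "R > 0" "C > 0" "ball x R \<subseteq> \<Omega>"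
    "\<And>f y. f \<in> domain_A2 \<Omega> \<Longrightarrow> y \<in> ball x R \<Longrightarrow> (cmod (f y))\<^sup>2 \<le> C * Re (domain_inner \<Omega> f f)"
    using domain_A2_point_evaluation[OF \<Omega>] by metis
  have "(\<lambda>x. 0) \<in> domain_A2 \<Omega>"
    by (simp add: domain_A2_def holo_fun_const set_integrable_def)
  then have ne: "domain_A2 \<Omega> \<noteq> {}" by blast
  have "sq_bounded (bergman_basis \<Omega>) (\<lambda>\<phi>. \<phi> y) C" if "y \<in> ball x R" for y
    by (rule orthonormal_functional_bound[OF ne B]) (use RC(2) RC(4)[OF _ that] in \<open>auto simp: q_def\<close>)
  then show "\<exists>R>0. \<exists>C. ball x R \<subseteq> \<Omega> \<and> (\<forall>y\<in>ball x R. sq_bounded (bergman_basis \<Omega>) (\<lambda>\<phi>. \<phi> y) C)"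
    using RC by blast
qed

lemma domain_kernel_eq: "domain_kernel \<Omega> z w = (\<Sum>\<^sub>\<infinity>\<phi>\<in>bergman_basis \<Omega>. \<phi> z * cnj (\<phi> w))"
  unfolding domain_kernel_def bergman_basis_def ..

lemma bounded_holo_in_domain_A2:
  assumes \<Omega>: "open \<Omega>" "bounded \<Omega>" and f: "holo_fun f \<Omega>" and C: "\<And>z. z \<in> \<Omega> \<Longrightarrow> cmod (f z) \<le> C"
  shows "f \<in> domain_A2 \<Omega>"
proof -
  obtain r where "\<Omega> \<subseteq> ball 0 r" using bounded_subset_ballD[OF \<Omega>(2)] by metis
  then have "emeasure lborel \<Omega> \<le> emeasure lborel (ball (0 :: complex ^ 'a) r)"
    using \<Omega>(1) by (intro emeasure_mono) auto
  then have fin: "emeasure lborel \<Omega> < \<infinity>" using emeasure_lborel_ball_finite order_le_less_trans by blast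
  have m: "(\<lambda>z. (cmod (indicator \<Omega> z *\<^sub>R f z))\<^sup>2) \<in> borel_measurable lborel"
    using holo_fun_indicator_measurable[OF f \<Omega>(1)] by measurable
  have "integrable lborel (\<lambda>z. indicator \<Omega> z *\<^sub>R (cmod (indicator \<Omega> z *\<^sub>R f z))\<^sup>2)"
  proof (rule integrableI_bounded_set_indicator[OF _ m fin])
    show "AE z in lborel. z \<in> \<Omega> \<longrightarrow> norm ((cmod (indicator \<Omega> z *\<^sub>R f z))\<^sup>2) \<le> C\<^sup>2"
      using C by (intro AE_I2) (auto intro!: power_mono)
  qed (use \<Omega> in auto)
  also have "(\<lambda>z. indicator \<Omega> z *\<^sub>R (cmod (indicator \<Omega> z *\<^sub>R f z))\<^sup>2) = (\<lambda>z. indicator \<Omega> z *\<^sub>R (cmod (f z))\<^sup>2)"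
    by (auto simp: fun_eq_iff indicator_def)
  finally show ?thesis using f by (simp add: domain_A2_def set_integrable_def)
qed

lemma fd_const: "fd (\<lambda>z. c) x v = 0"
  by (simp add: frechet_derivative_const)

lemma fd_nth: "fd (\<lambda>z. z $ i) x v = v $ (i :: 'n::finite)" for x :: "complex ^ 'n"
proof -
  have "((\<lambda>z :: complex ^ 'n. z $ i) has_derivative (\<lambda>v. v $ i)) (at x)"
    by (rule bounded_linear_imp_has_derivative) (rule bounded_linear_vec_nth)
  from frechet_derivative_at[OF this, symmetric] show ?thesis by (rule fun_cong)
qed

context
  fixes \<Omega> :: "(complex ^ 'n) set"
  assumes \<Omega>: "open \<Omega>" "bounded \<Omega>"
begin

lemma one_in_A2: "(\<lambda>z. 1) \<in> domain_A2 \<Omega>"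
  by (rule bounded_holo_in_domain_A2[OF \<Omega> holo_fun_const, where C = 1]) simp

lemma coordinate_in_A2: "(\<lambda>z. z $ i) \<in> domain_A2 \<Omega>"
proof -
  obtain C where C: "\<And>z. z \<in> \<Omega> \<Longrightarrow> norm z \<le> C" using \<Omega>(2) unfolding bounded_iff by blast
  show ?thesis
    by (rule bounded_holo_in_domain_A2[OF \<Omega> holo_fun_nth, where C = C])
       (rule order_trans[OF Finite_Cartesian_Product.norm_nth_le C])
qed

lemma evaluation_bound:
  assumes "z \<in> \<Omega>"
  obtains C where "C \<ge> 0" "\<And>f. f \<in> domain_A2 \<Omega> \<Longrightarrow> (cmod (f z))\<^sup>2 \<le> C * Re (domain_inner \<Omega> f f)"
  using domain_A2_point_evaluation[OF \<Omega>(1) assms] assms by (metis centre_in_ball less_imp_le)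

text \<open>The local bound on values, uniform on a ball around \<open>z\<close>, is passed through
  the Cauchy estimate for the first derivative.\<close>

lemma derivative_evaluation_bound:
  assumes z: "z \<in> \<Omega>"
  obtains C where "C \<ge> 0" "\<And>f. f \<in> domain_A2 \<Omega> \<Longrightarrow> (cmod (fd f z v))\<^sup>2 \<le> C * Re (domain_inner \<Omega> f f)"
proof -
  interpret semi_inner "domain_A2 \<Omega>" "domain_inner \<Omega>" by (rule semi_inner_domain[OF \<Omega>(1)])
  obtain R C where RC: "R > 0" "C > 0" "ball z R \<subseteq> \<Omega>"
    "\<And>f y. f \<in> domain_A2 \<Omega> \<Longrightarrow> y \<in> ball z R \<Longrightarrow> (cmod (f y))\<^sup>2 \<le> C * Re (domain_inner \<Omega> f f)"
    using domain_A2_point_evaluation[OF \<Omega>(1) z] by metis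
  have "(cmod (fd f z v))\<^sup>2 \<le> ((2 * norm v / R)\<^sup>2 * C) * Re (domain_inner \<Omega> f f)" if f: "f \<in> domain_A2 \<Omega>" for f
  proof -
    define s where "s = sqrt (C * Re (domain_inner \<Omega> f f))"
    have "holo_fun f (ball z R)" using f RC(3) holo_fun_subset unfolding domain_A2_def by blast
    then have "cmod (fd f z v) \<le> 2 * s / R * norm v"
      by (rule Cauchy_estimate_fd[OF _ RC(1)]) (use RC(4)[OF f] in \<open>auto simp: s_def intro: real_le_rsqrt\<close>)
    then have "(cmod (fd f z v))\<^sup>2 \<le> (2 * s / R * norm v)\<^sup>2" by (intro power_mono) auto
    also have "\<dots> = (2 * norm v / R)\<^sup>2 * s\<^sup>2" by (simp add: power_mult_distrib power_divide)
    also have "s\<^sup>2 = C * Re (domain_inner \<Omega> f f)"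
      unfolding s_def using RC(2) ip_nonneg[OF f] by (intro real_sqrt_pow2) simp
    finally show ?thesis by (simp add: mult.assoc)
  qed
  then show thesis using that[of "(2 * norm v / R)\<^sup>2 * C"] RC(2) by simp
qed

lemma square_sum_bound:
  assumes "(cmod a)\<^sup>2 \<le> A * r" "(cmod b)\<^sup>2 \<le> B * r"
  shows "(cmod (a - c * b))\<^sup>2 \<le> (2 * A + 2 * (cmod c)\<^sup>2 * B) * r"
proof -
  have "(cmod (a - c * b))\<^sup>2 \<le> (cmod a + cmod c * cmod b)\<^sup>2"
    using norm_triangle_ineq4[of a "c * b"] by (intro power_mono) (auto simp: norm_mult)
  also have "\<dots> \<le> 2 * (cmod a)\<^sup>2 + 2 * (cmod c * cmod b)\<^sup>2"
  proof -
    have "(x + y)\<^sup>2 \<le> 2 * x\<^sup>2 + 2 * y\<^sup>2" for x y :: real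
    using sum_squares_bound[of x y] by (simp add: power2_sum)
    then show ?thesis .
  qed
  also have "2 * (cmod c * cmod b)\<^sup>2 = 2 * (cmod c)\<^sup>2 * (cmod b)\<^sup>2" by (simp add: power_mult_distrib)
  also have "2 * (cmod a)\<^sup>2 + 2 * (cmod c)\<^sup>2 * (cmod b)\<^sup>2 \<le> 2 * (A * r) + 2 * (cmod c)\<^sup>2 * (B * r)"
    using assms by (intro add_mono mult_left_mono) auto
  finally show ?thesis by (simp add: algebra_simps)
qed

text \<open>\<open>f z - c * f w\<close> is a bounded functional of \<open>f\<close> that kills the
  basis, hence the whole Bergman space. The constant function gives \<open>c = 1\<close>, then the
  coordinates give the claim.\<close>

lemma bergman_basis_separates_points:
  assumes z: "z \<in> \<Omega>" "w \<in> \<Omega>" and eq: "\<And>\<phi>. \<phi> \<in> bergman_basis \<Omega> \<Longrightarrow> \<phi> z = c * \<phi> w"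
  shows "z = w"
proof -
  obtain A where A: "A \<ge> 0" "\<And>f. f \<in> domain_A2 \<Omega> \<Longrightarrow> (cmod (f z))\<^sup>2 \<le> A * Re (domain_inner \<Omega> f f)"
    using evaluation_bound[OF z(1)] by metis
  obtain B where B: "B \<ge> 0" "\<And>f. f \<in> domain_A2 \<Omega> \<Longrightarrow> (cmod (f w))\<^sup>2 \<le> B * Re (domain_inner \<Omega> f f)"
    using evaluation_bound[OF z(2)] by metis
  have L: "f z - c * f w = 0" if "f \<in> domain_A2 \<Omega>" for f
  proof (rule bounded_functional_zero[OF \<Omega>(1) bergman_basis[OF \<Omega>(1)], where L = "\<lambda>f. f z - c * f w"
          and C = "2 * A + 2 * (cmod c)\<^sup>2 * B"])
    show "(cmod (f z - c * f w))\<^sup>2 \<le> (2 * A + 2 * (cmod c)\<^sup>2 * B) * Re (domain_inner \<Omega> f f)"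
      if "f \<in> domain_A2 \<Omega>" for f by (rule square_sum_bound[OF A(2)[OF that] B(2)[OF that]])
  qed (use that A(1) B(1) eq in \<open>simp_all add: algebra_simps\<close>)
  have "c = 1" using L[OF one_in_A2] by simp
  then show ?thesis using L[OF coordinate_in_A2] by (simp add: vec_eq_iff)
qed

text \<open>As for points, with the functional \<open>fd f z v - c * f z\<close>: the constant
  function gives \<open>c = 0\<close>, and a coordinate function returns the corresponding entry of
  \<open>v\<close>.\<close>

lemma bergman_basis_separates_tangents:
  assumes z: "z \<in> \<Omega>" and eq: "\<And>\<phi>. \<phi> \<in> bergman_basis \<Omega> \<Longrightarrow> fd \<phi> z v = c * \<phi> z"
  shows "v = 0"
proof -
  obtain A where A: "A \<ge> 0" "\<And>f. f \<in> domain_A2 \<Omega> \<Longrightarrow> (cmod (fd f z v))\<^sup>2 \<le> A * Re (domain_inner \<Omega> f f)"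
    using derivative_evaluation_bound[OF z] by metis
  obtain B where B: "B \<ge> 0" "\<And>f. f \<in> domain_A2 \<Omega> \<Longrightarrow> (cmod (f z))\<^sup>2 \<le> B * Re (domain_inner \<Omega> f f)"
    using evaluation_bound[OF z] by metis
  have hf: "holo_fun f \<Omega>" if "f \<in> domain_A2 \<Omega>" for f using that by (simp add: domain_A2_def)
  have add: "fd (\<lambda>x. f x + g x) z v = fd f z v + fd g z v" if "f \<in> domain_A2 \<Omega>" "g \<in> domain_A2 \<Omega>" for f g
    using fun_cong[OF frechet_derivative_at[OF has_derivative_add[OF holo_fun_has_derivative[OF hf z]
      holo_fun_has_derivative[OF hf z]], symmetric]] that by simp
  have scale: "fd (\<lambda>x. k * f x) z v = k * fd f z v" if "f \<in> domain_A2 \<Omega>" for f k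
    using fd_mult_const[OF hf[OF that] z, of k v] by (simp add: mult.commute)
  have L: "fd f z v - c * f z = 0" if "f \<in> domain_A2 \<Omega>" for f
  proof (rule bounded_functional_zero[OF \<Omega>(1) bergman_basis[OF \<Omega>(1)], where L = "\<lambda>f. fd f z v - c * f z"
          and C = "2 * A + 2 * (cmod c)\<^sup>2 * B"])
    show "(cmod (fd f z v - c * f z))\<^sup>2 \<le> (2 * A + 2 * (cmod c)\<^sup>2 * B) * Re (domain_inner \<Omega> f f)"
      if "f \<in> domain_A2 \<Omega>" for f by (rule square_sum_bound[OF A(2)[OF that] B(2)[OF that]])
  qed (use that A(1) B(1) eq add scale in \<open>simp_all add: algebra_simps\<close>)
  have "c = 0" using L[OF one_in_A2] by (simp add: fd_const)
  then show ?thesis using L[OF coordinate_in_A2] by (simp add: vec_eq_iff fd_nth)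
qed

lemma bergman_basis_nonvanishing:
  assumes z: "z \<in> \<Omega>"
  obtains \<phi> where "\<phi> \<in> bergman_basis \<Omega>" "\<phi> z \<noteq> 0"
proof -
  obtain A where A: "A \<ge> 0" "\<And>f. f \<in> domain_A2 \<Omega> \<Longrightarrow> (cmod (f z))\<^sup>2 \<le> A * Re (domain_inner \<Omega> f f)"
    using evaluation_bound[OF z] by metis
  have "\<exists>\<phi>\<in>bergman_basis \<Omega>. \<phi> z \<noteq> 0"
  proof (rule ccontr)
    assume n: "\<not> (\<exists>\<phi>\<in>bergman_basis \<Omega>. \<phi> z \<noteq> 0)"
    have "(\<lambda>f. f z) (\<lambda>z. 1 :: complex) = 0"
      by (rule bounded_functional_zero[OF \<Omega>(1) bergman_basis[OF \<Omega>(1)], where C = A and L = "\<lambda>f. f z"])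
         (use A n one_in_A2 in auto)
    then show False by simp
  qed
  then show thesis using that by blast
qed

end

section \<open>Square integrable forms on manifolds\<close>

text \<open>The signs and powers of \<i> in \<open>manifold_inner\<close> and
  \<open>form_integral\<close> cancel. What remains is a positive multiple of an \<open>L2\<close>
  inner product of coefficients, from which positivity of the product of forms is drawn.\<close>

lemma form_constant:
  "\<i> ^ (m\<^sup>2) * ((-1) ^ (m * (m - 1) div 2) * (- 2 * \<i>) ^ m) = (2 :: complex) ^ m"
proof (induction m)
  case (Suc m)
  have e: "Suc m * (Suc m - 1) div 2 = m * (m - 1) div 2 + m"
  proof -
    have "Suc m * (Suc m - 1) = m * (m - 1) + 2 * m" by (cases m) (auto simp: algebra_simps)
    then show ?thesis by simp
  qed
  have s: "(Suc m)\<^sup>2 = m\<^sup>2 + 2 * m + 1" by (simp add: power2_eq_square)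
  have 1: "\<i> ^ ((Suc m)\<^sup>2) * ((-1) ^ (Suc m * (Suc m - 1) div 2) * (- 2 * \<i>) ^ Suc m)
     = (\<i> ^ (m\<^sup>2) * ((-1) ^ (m * (m - 1) div 2) * (- 2 * \<i>) ^ m)) * (\<i> ^ (2 * m) * (-1) ^ m) * 2"
    unfolding e s power_add power_Suc by (simp add: algebra_simps)
  have 2: "\<i> ^ (2 * m) * (-1) ^ m = (1 :: complex)"
    by (simp add: power_mult flip: power_mult_distrib)
  show ?case unfolding 1 2 Suc.IH by simp
qed simp

lemma holomorphic_top_form_holo_fun:
  "holomorphic_top_form A \<omega> \<Longrightarrow> c \<in> A \<Longrightarrow> holo_fun (\<lambda>\<zeta>. \<omega> c (chart_inv c \<zeta>)) (snd c ` fst c)"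
  unfolding holomorphic_top_form_def by (simp add: o_def)

lemma holomorphic_top_form_transition:
  assumes "holomorphic_top_form A \<omega>" "c \<in> A" "d \<in> A" "x \<in> fst c \<inter> fst d"
  shows "\<omega> c x = \<omega> d x * det (matrix (frechet_derivative (snd d \<circ> chart_inv c) (at (snd c x))))"
  using assms unfolding holomorphic_top_form_def by blast

lemma holomorphic_top_form_scale:
  assumes "holomorphic_top_form A \<omega>"
  shows "holomorphic_top_form A (\<lambda>d x. k * \<omega> d x)"
  unfolding holomorphic_top_form_def o_def
proof (intro conjI ballI)
  show "holo_fun (\<lambda>\<zeta>. k * \<omega> c (chart_inv c \<zeta>)) (snd c ` fst c)" if "c \<in> A" for c
    by (rule holo_fun_mult[OF holo_fun_const holomorphic_top_form_holo_fun[OF assms that]])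
  fix c d x assume "c \<in> A" "d \<in> A" "x \<in> fst c \<inter> fst d"
  from holomorphic_top_form_transition[OF assms this]
  show "k * \<omega> c x = k * \<omega> d x * det (matrix (frechet_derivative (\<lambda>x. snd d (chart_inv c x)) (at (snd c x))))"
    by (simp only: o_def mult.assoc)
qed

lemma holomorphic_top_form_add:
  assumes "holomorphic_top_form A \<omega>" "holomorphic_top_form A \<eta>"
  shows "holomorphic_top_form A (\<lambda>d x. \<omega> d x + \<eta> d x)"
  unfolding holomorphic_top_form_def o_def
proof (intro conjI ballI)
  show "holo_fun (\<lambda>\<zeta>. \<omega> c (chart_inv c \<zeta>) + \<eta> c (chart_inv c \<zeta>)) (snd c ` fst c)" if "c \<in> A" for c
    by (rule holo_fun_add[OF holomorphic_top_form_holo_fun[OF assms(1) that] holomorphic_top_form_holo_fun[OF assms(2) that]])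
  fix c d x assume cd: "c \<in> A" "d \<in> A" "x \<in> fst c \<inter> fst d"
  show "\<omega> c x + \<eta> c x = (\<omega> d x + \<eta> d x) * det (matrix (frechet_derivative (\<lambda>x. snd d (chart_inv c x)) (at (snd c x))))"
    using holomorphic_top_form_transition[OF assms(1) cd] holomorphic_top_form_transition[OF assms(2) cd]
    by (simp only: o_def distrib_right)
qed

section \<open>Charts, the space of square integrable forms, and its basis\<close>

context
  fixes M :: "'a topology" and A :: "('a, 'm::finite) chart set"
  assumes M: "complex_manifold M A" and ne: "topspace M \<noteq> {}"
begin

lemma chart_facts:
  assumes "c \<in> A"
  shows "openin M (fst c)" "open (snd c ` fst c)"
    "homeomorphic_map (subtopology M (fst c)) (top_of_set (snd c ` fst c)) (snd c)"
    "inj_on (snd c) (fst c)"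
proof -
  show *: "openin M (fst c)" "open (snd c ` fst c)"
    "homeomorphic_map (subtopology M (fst c)) (top_of_set (snd c ` fst c)) (snd c)"
    using M assms unfolding complex_manifold_def by auto
  have "topspace (subtopology M (fst c)) = fst c" using openin_subset[OF *(1)] by auto
  then show "inj_on (snd c) (fst c)" using homeomorphic_imp_injective_map[OF *(3)] by simp
qed

lemma chart_image_open:
  assumes "c \<in> A" "openin M V"
  shows "open (snd c ` (fst c \<inter> V))"
proof -
  have "open_map (subtopology M (fst c)) (top_of_set (snd c ` fst c)) (snd c)"
    using chart_facts(3)[OF assms(1)] homeomorphic_imp_open_map by blast
  moreover have "openin (subtopology M (fst c)) (fst c \<inter> V)"
    using assms(2) by (simp add: openin_subtopology_Int2)
  ultimately have "openin (top_of_set (snd c ` fst c)) (snd c ` (fst c \<inter> V))"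
    unfolding open_map_def by blast
  then show ?thesis using chart_facts(2)[OF assms(1)] openin_open_trans by blast
qed

lemma chart_inv_simps:
  assumes "c \<in> A"
  shows "x \<in> fst c \<Longrightarrow> chart_inv c (snd c x) = x"
    "\<zeta> \<in> snd c ` fst c \<Longrightarrow> snd c (chart_inv c \<zeta>) = \<zeta>" "\<zeta> \<in> snd c ` fst c \<Longrightarrow> chart_inv c \<zeta> \<in> fst c"
  using chart_facts(4)[OF assms] unfolding chart_inv_def
  by (auto simp: f_inv_into_f inv_into_into)

text \<open>Justifies the choice in the definition: second countability gives the Lindelof property.
  Since the cover is indexed by all natural numbers, the countable subfamily must be nonempty, which
  follows from \<open>topspace M \<noteq> {}\<close>.\<close>

lemma chart_cover:
  "range (chart_cover M A) \<subseteq> A \<and> (\<Union>k. fst (chart_cover M A k)) = topspace M"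
proof -
  have "second_countable M" and U: "(\<Union>(U, \<phi>)\<in>A. U) = topspace M" using M by (simp_all add: complex_manifold_def)
  then have "Lindelof_space M" using second_countable_imp_Lindelof_space by blast
  moreover have "\<Union>(fst ` A) = topspace M" unfolding U[symmetric] by (simp add: case_prod_unfold)
  moreover have "\<forall>U\<in>fst ` A. openin M U" using chart_facts(1) by blast
  ultimately obtain W where W: "countable W" "W \<subseteq> fst ` A" "\<Union>W = topspace M"
    unfolding Lindelof_space_def by meson
  then obtain A' where A': "countable A'" "A' \<subseteq> A" "W = fst ` A'"
    by (meson countable_subset_image)
  have "A' \<noteq> {}" using W(3) A'(3) ne by (metis Sup_empty image_empty)
  then have r: "range (from_nat_into A') = A'" using A'(1) by (rule range_from_nat_into)
  then have "(\<Union>k. fst (from_nat_into A' k)) = \<Union>(fst ` A')" by (metis image_image)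
  then have "range (from_nat_into A') \<subseteq> A \<and> (\<Union>k. fst (from_nat_into A' k)) = topspace M"
    using W(3) A'(3) r A'(2) by simp
  then have "\<exists>c::nat \<Rightarrow> _. range c \<subseteq> A \<and> (\<Union>k. fst (c k)) = topspace M"
    by (rule exI[of "\<lambda>c. range c \<subseteq> A \<and> (\<Union>k. fst (c k)) = topspace M" "from_nat_into A'"])
  then show ?thesis unfolding chart_cover_def by (rule someI_ex)
qed

lemma chart_cover_in: "chart_cover M A k \<in> A"
  using chart_cover by blast

text \<open>One measure space for the disjoint union of all pieces: a countable sum of integrals
  over pieces becomes a single integral, and the general facts about \<open>L2\<close>
  apply.\<close>

definition pieces_measure :: "(nat \<times> (complex ^ 'm)) measure" where
  "pieces_measure = count_space UNIV \<Otimes>\<^sub>M lborel"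

definition coeff :: "('a, 'm) top_form \<Rightarrow> nat \<times> (complex ^ 'm) \<Rightarrow> complex" where
  "coeff \<omega> = (\<lambda>(k, z). indicator (chart_piece M A k) z *\<^sub>R \<omega> (chart_cover M A k) (chart_inv (chart_cover M A k) z))"

lemma chart_piece_eq:
  "chart_piece M A k = snd (chart_cover M A k) ` fst (chart_cover M A k) -
     snd (chart_cover M A k) ` (fst (chart_cover M A k) \<inter> (\<Union>i<k. fst (chart_cover M A i)))"
  unfolding chart_piece_def using chart_facts(4)[OF chart_cover_in, of k]
  by (subst inj_on_image_set_diff[symmetric]) (auto intro!: arg_cong2[where f = image])

lemma chart_piece_borel: "chart_piece M A k \<in> sets borel"
proof -
  have "openin M (\<Union>i<k. fst (chart_cover M A i))" by (intro openin_Union) (auto intro: chart_facts(1)[OF chart_cover_in])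
  then show ?thesis
    unfolding chart_piece_eq using chart_image_open[OF chart_cover_in] chart_facts(2)[OF chart_cover_in] by auto
qed

lemma coeff_measurable:
  assumes "holomorphic_top_form A \<omega>"
  shows "coeff \<omega> \<in> borel_measurable pieces_measure"
  unfolding pieces_measure_def
proof (rule measurable_pair_measure_countable1)
  fix k :: nat
  let ?c = "chart_cover M A k"
  let ?g = "\<lambda>z. indicator (snd ?c ` fst ?c) z *\<^sub>R \<omega> ?c (chart_inv ?c z)"
  have [measurable]: "?g \<in> borel_measurable lborel"
    by (rule holo_fun_indicator_measurable[OF holomorphic_top_form_holo_fun[OF assms chart_cover_in] chart_facts(2)[OF chart_cover_in]])
  have [measurable]: "chart_piece M A k \<in> sets borel" by (rule chart_piece_borel)
  have "(\<lambda>z. coeff \<omega> (k, z)) = (\<lambda>z. indicator (chart_piece M A k) z *\<^sub>R ?g z)"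
    by (auto simp: coeff_def fun_eq_iff indicator_def chart_piece_eq)
  moreover have "(\<lambda>z. indicator (chart_piece M A k) z *\<^sub>R ?g z) \<in> borel_measurable lborel" by measurable
  ultimately show "(\<lambda>z. coeff \<omega> (k, z)) \<in> borel_measurable lborel" by simp
qed simp

lemma nn_integral_pieces:
  assumes "f \<in> borel_measurable pieces_measure"
  shows "(\<integral>\<^sup>+p. f p \<partial>pieces_measure) = (\<Sum>k. \<integral>\<^sup>+z. f (k, z) \<partial>lborel)"
  using assms unfolding pieces_measure_def
  by (simp add: sigma_finite_measure.nn_integral_fst[OF sigma_finite_lborel, symmetric] nn_integral_count_space_nat)

lemma integral_pieces:
  fixes f :: "nat \<times> (complex ^ 'm) \<Rightarrow> complex"
  assumes f: "integrable pieces_measure f"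
  shows "(LINT p|pieces_measure. f p) = (\<Sum>k. LINT z|lborel. f (k, z))"
proof -
  interpret pair_sigma_finite "count_space (UNIV :: nat set)" "lborel :: (complex ^ 'm) measure"
    by (intro pair_sigma_finite.intro sigma_finite_measure_count_space sigma_finite_lborel)
  show ?thesis
    using integral_fst'[OF f[unfolded pieces_measure_def]] integral_count_space_nat[OF integrable_fst'[OF f[unfolded pieces_measure_def]]]
    unfolding pieces_measure_def by simp
qed

lemma coeff_square: "ennreal ((cmod (coeff \<omega> (k, z)))\<^sup>2) =
   ennreal (cmod (wedge_cnj \<omega> \<omega> (chart_cover M A k) (chart_inv (chart_cover M A k) z))) * indicator (chart_piece M A k) z"
  by (auto simp: coeff_def wedge_cnj_def indicator_def norm_mult power2_eq_square)

lemma manifold_A2_iff: "\<omega> \<in> manifold_A2 M A \<longleftrightarrow> holomorphic_top_form A \<omega> \<and> coeff \<omega> \<in> L2 pieces_measure"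
proof (cases "holomorphic_top_form A \<omega>")
  case True
  have m [measurable]: "coeff \<omega> \<in> borel_measurable pieces_measure" by (rule coeff_measurable[OF True])
  have m2: "(\<lambda>p. (cmod (coeff \<omega> p))\<^sup>2) \<in> borel_measurable pieces_measure" by measurable
  have "(\<integral>\<^sup>+p. ennreal ((cmod (coeff \<omega> p))\<^sup>2) \<partial>pieces_measure) = (\<Sum>k. \<integral>\<^sup>+z. ennreal ((cmod (coeff \<omega> (k, z)))\<^sup>2) \<partial>lborel)"
    by (intro nn_integral_pieces) measurable
  then show ?thesis
    using True m m2 unfolding manifold_A2_def form_integrable_def L2_def integrable_iff_bounded by (simp add: coeff_square)
qed (simp add: manifold_A2_def)

lemma manifold_inner_eq:
  assumes "\<omega> \<in> manifold_A2 M A" "\<eta> \<in> manifold_A2 M A"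
  shows "manifold_inner M A \<omega> \<eta> = complex_of_real (2 ^ CARD('m)) * (LINT p|pieces_measure. coeff \<omega> p * cnj (coeff \<eta> p))"
proof -
  have int: "integrable pieces_measure (\<lambda>p. coeff \<omega> p * cnj (coeff \<eta> p))"
    using assms L2_integrable_mult unfolding manifold_A2_iff by blast
  have "(LINT p|pieces_measure. coeff \<omega> p * cnj (coeff \<eta> p)) =
     (\<Sum>k. LINT z:chart_piece M A k|lborel. wedge_cnj \<omega> \<eta> (chart_cover M A k) (chart_inv (chart_cover M A k) z))"
    unfolding integral_pieces[OF int] set_lebesgue_integral_def
    by (intro arg_cong[where f = suminf] ext Bochner_Integration.integral_cong refl)
       (auto simp: coeff_def wedge_cnj_def indicator_def)
  then show ?thesis
    unfolding manifold_inner_def form_integral_def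
    using form_constant[of "CARD('m)"] by (simp add: mult.assoc[symmetric])
qed

text \<open>Forms take a chart and a point, while \<open>semi_inner\<close> is about functions of
  one argument; currying mediates between the two.\<close>

definition forms_A2 :: "(('a, 'm) chart \<times> 'a \<Rightarrow> complex) set" where
  "forms_A2 = {F. curry F \<in> manifold_A2 M A}"

definition forms_inner :: "(('a, 'm) chart \<times> 'a \<Rightarrow> complex) \<Rightarrow> (('a, 'm) chart \<times> 'a \<Rightarrow> complex) \<Rightarrow> complex" where
  "forms_inner F G = manifold_inner M A (curry F) (curry G)"

lemma semi_inner_forms: "semi_inner forms_A2 forms_inner"
proof (rule semi_inner_pullback[OF semi_inner_L2, where e = "\<lambda>F. coeff (curry F)" and k = "2 ^ CARD('m)"])
  fix F G :: "('a, 'm) chart \<times> 'a \<Rightarrow> complex" and c :: complex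
  assume F: "F \<in> forms_A2"
  then have F': "holomorphic_top_form A (curry F)" "coeff (curry F) \<in> L2 pieces_measure"
    by (auto simp: forms_A2_def manifold_A2_iff)
  then show "coeff (curry F) \<in> L2 pieces_measure" by simp
  show s: "coeff (curry (\<lambda>x. c * F x)) = (\<lambda>y. c * coeff (curry F) y)"
    by (auto simp: coeff_def fun_eq_iff)
  have "holomorphic_top_form A (curry (\<lambda>x. c * F x))"
    using holomorphic_top_form_scale[OF F'(1), of c] by (simp add: curry_def)
  moreover have "coeff (curry (\<lambda>x. c * F x)) \<in> L2 pieces_measure"
    unfolding s by (rule L2_scale[OF F'(2)])
  ultimately show "(\<lambda>x. c * F x) \<in> forms_A2" by (simp add: forms_A2_def manifold_A2_iff)
  assume G: "G \<in> forms_A2"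
  then have G': "holomorphic_top_form A (curry G)" "coeff (curry G) \<in> L2 pieces_measure"
    by (auto simp: forms_A2_def manifold_A2_iff)
  show a: "coeff (curry (\<lambda>x. F x + G x)) = (\<lambda>y. coeff (curry F) y + coeff (curry G) y)"
    by (auto simp: coeff_def fun_eq_iff scaleR_add_right)
  have "holomorphic_top_form A (curry (\<lambda>x. F x + G x))"
    using holomorphic_top_form_add[OF F'(1) G'(1)] by (simp add: curry_def)
  moreover have "coeff (curry (\<lambda>x. F x + G x)) \<in> L2 pieces_measure"
    unfolding a by (rule L2_add[OF F'(2) G'(2)])
  ultimately show "(\<lambda>x. F x + G x) \<in> forms_A2" by (simp add: forms_A2_def manifold_A2_iff)
  show "forms_inner F G = complex_of_real (2 ^ CARD('m)) * (LINT p|pieces_measure. coeff (curry F) p * cnj (coeff (curry G) p))"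
    using F G unfolding forms_A2_def forms_inner_def by (simp only: manifold_inner_eq mem_Collect_eq)
qed simp

definition manifold_basis :: "('a, 'm) top_form set" where
  "manifold_basis = (SOME B. complete_orthonormal_system (manifold_inner M A) (manifold_A2 M A) B)"

lemma manifold_basis: "complete_orthonormal_system (manifold_inner M A) (manifold_A2 M A) manifold_basis"
proof -
  interpret semi_inner forms_A2 forms_inner by (rule semi_inner_forms)
  have u: "case_prod \<omega> \<in> forms_A2 \<longleftrightarrow> \<omega> \<in> manifold_A2 M A" for \<omega> by (simp add: forms_A2_def)
  have i: "manifold_inner M A \<omega> \<eta> = forms_inner (case_prod \<omega>) (case_prod \<eta>)" for \<omega> \<eta> by (simp add: forms_inner_def)
  have sc: "case_prod (\<lambda>d x. c * \<omega> d x) = (\<lambda>p. c * case_prod \<omega> p)" for c and \<omega> :: "('a, 'm) top_form"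
    by (auto simp: fun_eq_iff)
  have "\<exists>B. complete_orthonormal_system (manifold_inner M A) (manifold_A2 M A) B"
  proof (rule maximal_orthonormal_system[where sc = "\<lambda>c \<omega> d x. c * \<omega> d x"])
    fix \<omega> \<eta> :: "('a, 'm) top_form" and c
    assume \<omega>: "\<omega> \<in> manifold_A2 M A"
    show "(\<lambda>d x. c * \<omega> d x) \<in> manifold_A2 M A"
      using scale_closed[of "case_prod \<omega>" c] \<omega> unfolding u[symmetric] sc by blast
    show "0 \<le> Re (manifold_inner M A \<omega> \<omega>)" using ip_nonneg[of "case_prod \<omega>"] \<omega> unfolding i u by blast
    assume \<eta>: "\<eta> \<in> manifold_A2 M A"
    show "manifold_inner M A (\<lambda>d x. c * \<omega> d x) \<eta> = c * manifold_inner M A \<omega> \<eta>"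
      using \<omega> \<eta> unfolding u[symmetric] i sc by (rule ip_scale)
    show "manifold_inner M A \<eta> \<omega> = cnj (manifold_inner M A \<omega> \<eta>)"
      using \<omega> \<eta> unfolding u[symmetric] i by (rule ip_cnj)
  qed
  then show ?thesis unfolding manifold_basis_def by (rule someI_ex)
qed

lemma manifold_kernel_eq:
  "manifold_kernel M A c d x y = (\<Sum>\<^sub>\<infinity>\<omega>\<in>manifold_basis. \<omega> c x * cnj (\<omega> d y))"
  unfolding manifold_kernel_def manifold_basis_def ..

text \<open>The first nonempty chart of the cover is a piece by itself, so the norm of a form controls
  its coefficient there without any change of coordinates.\<close>

proposition sq_bounded_family_manifold_basis:
  obtains c where "c \<in> A" "fst c \<noteq> {}"
    and "sq_bounded_family manifold_basis (\<lambda>\<omega> \<zeta>. \<omega> c (chart_inv c \<zeta>)) (snd c ` fst c)"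
proof -
  interpret semi_inner forms_A2 forms_inner by (rule semi_inner_forms)
  have "\<exists>k. fst (chart_cover M A k) \<noteq> {}" using chart_cover ne by (metis SUP_bot_conv(2))
  then obtain k where k: "fst (chart_cover M A k) \<noteq> {}" "\<And>i. i < k \<Longrightarrow> fst (chart_cover M A i) = {}"
    using exists_least_iff[of "\<lambda>k. fst (chart_cover M A k) \<noteq> {}"] by blast
  define c where "c = chart_cover M A k"
  define S where "S = snd c ` fst c"
  have cA: "c \<in> A" unfolding c_def by (rule chart_cover_in)
  have S: "open S" unfolding S_def by (rule chart_facts(2)[OF cA])
  have piece: "chart_piece M A k = S" unfolding chart_piece_def S_def c_def using k(2) by auto
  have bound: "set_integrable lborel S (\<lambda>z. (cmod (F (c, chart_inv c z)))\<^sup>2) \<and>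
      (LINT z:S|lborel. (cmod (F (c, chart_inv c z)))\<^sup>2) \<le> q F" if F: "F \<in> forms_A2" for F
  proof -
    have F': "curry F \<in> manifold_A2 M A" "coeff (curry F) \<in> L2 pieces_measure"
      using F by (auto simp: forms_A2_def manifold_A2_iff)
    let ?h = "\<lambda>p. (cmod (coeff (curry F) p))\<^sup>2"
    have h: "integrable pieces_measure ?h" using F'(2) by (simp add: L2_def)
    have hk: "?h (k, z) = indicator S z *\<^sub>R (cmod (F (c, chart_inv c z)))\<^sup>2" for z
      by (auto simp: coeff_def piece c_def indicator_def)
    have hm: "(\<lambda>p. ennreal (?h p)) \<in> borel_measurable pieces_measure" using h by measurable
    have "(\<integral>\<^sup>+z. ennreal (?h (k, z)) \<partial>lborel) \<le> (\<Sum>k. \<integral>\<^sup>+z. ennreal (?h (k, z)) \<partial>lborel)"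
      using sum_le_suminf[of "\<lambda>k. \<integral>\<^sup>+z. ennreal (?h (k, z)) \<partial>lborel" "{k}"] by simp
    also have "\<dots> = (\<integral>\<^sup>+p. ennreal (?h p) \<partial>pieces_measure)" using nn_integral_pieces[OF hm] by simp
    also have "\<dots> = ennreal (LINT p|pieces_measure. ?h p)" by (rule nn_integral_eq_integral[OF h]) simp
    finally have le: "(\<integral>\<^sup>+z. ennreal (?h (k, z)) \<partial>lborel) \<le> ennreal (LINT p|pieces_measure. ?h p)" .
    have m: "(\<lambda>z. ?h (k, z)) \<in> borel_measurable lborel"
    proof -
      have "(\<lambda>z. indicator S z *\<^sub>R F (c, chart_inv c z)) \<in> borel_measurable lborel"
      proof (rule holo_fun_indicator_measurable[OF _ S])
        show "holo_fun (\<lambda>z. F (c, chart_inv c z)) S"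
          using holomorphic_top_form_holo_fun[of A "curry F" c] F'(1) cA by (simp add: manifold_A2_def S_def)
      qed
      then have "(\<lambda>z. (cmod (indicator S z *\<^sub>R F (c, chart_inv c z)))\<^sup>2) \<in> borel_measurable lborel" by measurable
      also have "(\<lambda>z. (cmod (indicator S z *\<^sub>R F (c, chart_inv c z)))\<^sup>2) = (\<lambda>z. ?h (k, z))"
        unfolding hk by (auto simp: indicator_def fun_eq_iff)
      finally show ?thesis .
    qed
    have int: "integrable lborel (\<lambda>z. ?h (k, z))"
      by (rule integrableI_nonneg[OF m]) (use le in \<open>auto simp: order_le_less_trans\<close>)
    then have "ennreal (LINT z|lborel. ?h (k, z)) \<le> ennreal (LINT p|pieces_measure. ?h p)"
      using le nn_integral_eq_integral[OF int] by simp
    then have 1: "(LINT z|lborel. ?h (k, z)) \<le> (LINT p|pieces_measure. ?h p)"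
      by (subst (asm) ennreal_le_iff) (auto intro: Bochner_Integration.integral_nonneg)
    have "forms_inner F F = complex_of_real (2 ^ CARD('m)) * (LINT p|pieces_measure. complex_of_real (?h p))"
      unfolding forms_inner_def manifold_inner_eq[OF F'(1) F'(1)] complex_norm_square ..
    then have "q F = 2 ^ CARD('m) * (LINT p|pieces_measure. ?h p)"
      unfolding q_def integral_complex_of_real by (simp flip: of_real_mult)
    moreover have "1 * (LINT p|pieces_measure. ?h p) \<le> 2 ^ CARD('m) * (LINT p|pieces_measure. ?h p)"
      by (intro mult_right_mono Bochner_Integration.integral_nonneg) auto
    ultimately have "(LINT z|lborel. ?h (k, z)) \<le> q F" using 1 by simp
    then show ?thesis using int unfolding hk set_integrable_def set_lebesgue_integral_def by simp
  qed
  have ne: "forms_A2 \<noteq> {}"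
  proof -
    have "holomorphic_top_form A (\<lambda>c x. 0)" by (simp add: holomorphic_top_form_def o_def holo_fun_const)
    moreover have "coeff (\<lambda>c x. 0) \<in> L2 pieces_measure" by (simp add: coeff_def L2_def case_prod_unfold)
    ultimately have "(\<lambda>p. 0) \<in> forms_A2" by (simp add: forms_A2_def manifold_A2_iff curry_def)
    then show ?thesis by blast
  qed
  let ?B = "case_prod ` manifold_basis"
  have B: "?B \<subseteq> forms_A2"
    using manifold_basis unfolding complete_orthonormal_system_def forms_A2_def by auto
  have on: "forms_inner F G = (if F = G then 1 else 0)" if "F \<in> ?B" "G \<in> ?B" for F G
  proof -
    obtain \<omega> \<eta> where w: "\<omega> \<in> manifold_basis" "\<eta> \<in> manifold_basis" "F = case_prod \<omega>" "G = case_prod \<eta>"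
      using \<open>F \<in> ?B\<close> \<open>G \<in> ?B\<close> by blast
    have "F = G \<longleftrightarrow> \<omega> = \<eta>" using w(3,4) by (metis curry_case_prod)
    then show ?thesis using manifold_basis w unfolding complete_orthonormal_system_def forms_inner_def by simp
  qed
  have "sq_bounded_family manifold_basis (\<lambda>\<omega> \<zeta>. \<omega> c (chart_inv c \<zeta>)) S"
    unfolding sq_bounded_family_def
  proof (intro conjI ballI)
    show "holo_fun (\<lambda>\<zeta>. \<omega> c (chart_inv c \<zeta>)) S" if "\<omega> \<in> manifold_basis" for \<omega>
      unfolding S_def using manifold_basis that cA
      by (intro holomorphic_top_form_holo_fun) (auto simp: complete_orthonormal_system_def manifold_A2_def)
    fix x assume "x \<in> S"
    then obtain R C where RC: "R > 0" "C > 0" "ball x R \<subseteq> S"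
      and ev: "\<And>f y. holo_fun f S \<Longrightarrow> set_integrable lborel S (\<lambda>w. (cmod (f w))\<^sup>2) \<Longrightarrow> y \<in> ball x R \<Longrightarrow>
       (cmod (f y))\<^sup>2 \<le> C * (LINT w:S|lborel. (cmod (f w))\<^sup>2)"
      using point_evaluation_bound[OF S] by metis
    have "sq_bounded manifold_basis (\<lambda>\<omega>. \<omega> c (chart_inv c y)) C" if y: "y \<in> ball x R" for y
    proof -
      have "sq_bounded ?B (\<lambda>F. F (c, chart_inv c y)) C"
      proof (rule orthonormal_functional_bound[OF ne B on])
        fix F assume F: "F \<in> forms_A2"
        have "holo_fun (\<lambda>z. F (c, chart_inv c z)) S"
          using F holomorphic_top_form_holo_fun[of A "curry F" c] cA unfolding forms_A2_def manifold_A2_def S_def by simp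
        then have "(cmod (F (c, chart_inv c y)))\<^sup>2 \<le> C * (LINT z:S|lborel. (cmod (F (c, chart_inv c z)))\<^sup>2)"
          using bound[OF F] by (intro ev y) auto
        also have "\<dots> \<le> C * q F" using bound[OF F] RC(2) by (intro mult_left_mono) auto
        finally show "(cmod (F (c, chart_inv c y)))\<^sup>2 \<le> C * q F" .
      qed (use RC(2) in auto)
      note B' = this
      show ?thesis
        unfolding sq_bounded_def
      proof (intro allI impI)
        fix F assume F: "finite F" "F \<subseteq> manifold_basis"
        have inj: "inj_on case_prod F" by (rule inj_onI) (metis curry_case_prod)
        have "(\<Sum>\<omega>\<in>F. (cmod (\<omega> c (chart_inv c y)))\<^sup>2) = (\<Sum>G\<in>case_prod ` F. (cmod (G (c, chart_inv c y)))\<^sup>2)"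
          by (subst sum.reindex[OF inj]) simp
        also have "\<dots> \<le> C" using B' F unfolding sq_bounded_def by blast
        finally show "(\<Sum>\<omega>\<in>F. (cmod (\<omega> c (chart_inv c y)))\<^sup>2) \<le> C" .
      qed
    qed
    then show "\<exists>R>0. \<exists>C. ball x R \<subseteq> S \<and> (\<forall>y\<in>ball x R. sq_bounded manifold_basis (\<lambda>\<omega>. \<omega> c (chart_inv c y)) C)"
      using RC by blast
  qed
  then show thesis using that[OF cA] k(1) unfolding S_def c_def by blast
qed

end

section \<open>Kernels with the same metric\<close>

lemma bounded_linear_vpair:
  "bounded_linear (\<lambda>p. vpair (fst p :: complex ^ 'n::finite) (snd p :: complex ^ 'm::finite))"
  unfolding linear_conv_bounded_linear[symmetric]
  by (rule linearI) (auto simp: vpair_def vec_eq_iff split: sum.splits)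

lemma has_derivative_vpair:
  assumes "(F has_derivative F') (at x)" "(G has_derivative G') (at x)"
  shows "((\<lambda>x. vpair (F x :: complex ^ 'n::finite) (G x :: complex ^ 'm::finite)) has_derivative (\<lambda>v. vpair (F' v) (G' v))) (at x)"
  using bounded_linear.has_derivative[OF bounded_linear_vpair has_derivative_Pair[OF assms]] by simp

text \<open>Doubled balls form a neighbourhood basis at diagonal points, because the pairing is
  continuous on the product of the two copies.\<close>

lemma dbl_ball_subset:
  assumes W: "open W" "vdiag z \<in> W"
  obtains r where "r > 0" "dbl (ball (z :: complex ^ 'n::finite) r) \<subseteq> W"
proof -
  have "bounded_linear (\<lambda>p. vpair (fst p :: complex ^ 'n) (vcnj (snd p :: complex ^ 'n)))"
    unfolding linear_conv_bounded_linear[symmetric]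
    by (rule linearI) (auto simp: vpair_def vcnj_def vec_eq_iff scaleR_conv_of_real[where 'a = complex] split: sum.splits)
  then have "open ((\<lambda>p. vpair (fst p) (vcnj (snd p))) -` W)"
    by (intro open_vimage W linear_continuous_on)
  moreover have "(z, z) \<in> (\<lambda>p. vpair (fst p) (vcnj (snd p))) -` W" using W(2) by (simp add: vdiag_def)
  ultimately obtain A B where AB: "open A" "open B" "(z, z) \<in> A \<times> B"
    "A \<times> B \<subseteq> (\<lambda>p. vpair (fst p) (vcnj (snd p))) -` W"
    by (rule open_prod_elim)
  have "open (A \<inter> B)" "z \<in> A \<inter> B" using AB by auto
  then obtain r where r: "r > 0" "ball z r \<subseteq> A \<inter> B" by (rule openE)
  have "dbl (ball z r) \<subseteq> W"
  proof
    fix x assume "x \<in> dbl (ball z r)"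
    then have "(vfst x, vcnj (vsnd x)) \<in> A \<times> B" using r(2) unfolding dbl_def by blast
    then have "(vfst x, vcnj (vsnd x)) \<in> (\<lambda>p. vpair (fst p) (vcnj (snd p))) -` W" using AB(4) by blast
    then show "x \<in> W" by simp
  qed
  then show thesis using that r(1) by blast
qed

lemma polarized_vdiag:
  assumes "sq_bounded_family J g S" "z \<in> S"
  shows "((\<lambda>j. (cmod (g j z))\<^sup>2) has_sum Re (polarized J g (vdiag z))) J" "Im (polarized J g (vdiag z)) = 0"
proof -
  have "((\<lambda>j. g j z * cnj (g j z)) has_sum polarized J g (vdiag z)) J"
    unfolding polarized_def vdiag_def vpair_simps
    by (rule has_sum_infsum[OF sq_bounded_family_summable[OF assms assms(2)]])
  from has_sum_norm_square(2,3)[OF this]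
  show "((\<lambda>j. (cmod (g j z))\<^sup>2) has_sum Re (polarized J g (vdiag z))) J" "Im (polarized J g (vdiag z)) = 0" .
qed

lemma polarized_cnj: "polarized J g (vpair w (vcnj z)) = cnj (polarized J g (vpair z (vcnj w)))"
  unfolding polarized_def by (simp add: mult.commute flip: infsum_cnj)

lemma polarized_vdiag_pos:
  assumes "sq_bounded_family J g S" "z \<in> S" "polarized J g (vdiag z) \<noteq> 0"
  shows "polarized J g (vdiag z) = complex_of_real (Re (polarized J g (vdiag z)))" "Re (polarized J g (vdiag z)) > 0"
    "polarized J g (vdiag z) \<notin> \<real>\<^sub>\<le>\<^sub>0"
proof -
  note * = polarized_vdiag[OF assms(1,2)]
  show 1: "polarized J g (vdiag z) = complex_of_real (Re (polarized J g (vdiag z)))" using *(2) by (simp add: complex_eq_iff)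
  have "Re (polarized J g (vdiag z)) \<ge> 0" using *(1) by (rule has_sum_nonneg) simp
  moreover have "Re (polarized J g (vdiag z)) \<noteq> 0" using 1 assms(3) by (metis of_real_0)
  ultimately show 2: "Re (polarized J g (vdiag z)) > 0" by simp
  show "polarized J g (vdiag z) \<notin> \<real>\<^sub>\<le>\<^sub>0" by (subst 1) (use 2 in \<open>simp add: complex_nonpos_Reals_iff\<close>)
qed

text \<open>On the diagonal the kernel is a positive real wherever it is nonzero, hence off the
  branch cut; by continuity it stays off the cut on a doubled ball, where the principal logarithm is
  holomorphic.\<close>

lemma Ln_polarized_holo:
  assumes fam: "sq_bounded_family J g S" and S: "open S" and z: "z \<in> S" "polarized J g (vdiag z) \<noteq> 0"
  obtains r where "r > 0" "ball z r \<subseteq> S" "\<And>x. x \<in> dbl (ball z r) \<Longrightarrow> polarized J g x \<notin> \<real>\<^sub>\<le>\<^sub>0"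
    "holo_fun (\<lambda>x. Ln (polarized J g x)) (dbl (ball z r))"
proof -
  have hol: "holo_fun (polarized J g) (dbl S)" by (rule holo_fun_polarized[OF fam])
  define W where "W = dbl S \<inter> polarized J g -` (- \<real>\<^sub>\<le>\<^sub>0)"
  have "open W" unfolding W_def
    using continuous_open_preimage[OF holo_fun_continuous_on[OF hol] open_dbl[OF S], of "- \<real>\<^sub>\<le>\<^sub>0"] closed_nonpos_Reals_complex
    by (simp add: open_Compl)
  moreover have "vdiag z \<in> W" using polarized_vdiag_pos(3)[OF fam z] z by (simp add: W_def)
  ultimately obtain r where r: "r > 0" "dbl (ball z r) \<subseteq> W" using dbl_ball_subset by metis
  have sub: "ball z r \<subseteq> S"
  proof
    fix y assume "y \<in> ball z r"
    then have "vdiag y \<in> W" using r(2) by (metis subsetD vdiag_in_dbl)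
    then show "y \<in> S" by (simp add: W_def)
  qed
  have np: "polarized J g x \<notin> \<real>\<^sub>\<le>\<^sub>0" if "x \<in> dbl (ball z r)" for x using that r(2) by (auto simp: W_def)
  have "holo_fun (\<lambda>x. Ln (polarized J g x)) (dbl (ball z r))"
  proof (rule holo_fun_outer[of "polarized J g" _ "- \<real>\<^sub>\<le>\<^sub>0" Ln])
    show "holo_fun (polarized J g) (dbl (ball z r))" using hol dbl_mono[OF sub] by (rule holo_fun_subset)
    show "open (- \<real>\<^sub>\<le>\<^sub>0 :: complex set)" using closed_nonpos_Reals_complex by (simp add: open_Compl)
    show "Ln holomorphic_on - \<real>\<^sub>\<le>\<^sub>0" by (rule holomorphic_on_Ln) auto
    show "polarized J g ` dbl (ball z r) \<subseteq> - \<real>\<^sub>\<le>\<^sub>0" using np by auto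
  qed
  then show thesis using that r(1) sub np by blast
qed

lemma mixed_diff:
  assumes F: "holo_fun F (dbl U)" and G: "holo_fun G (dbl U)" and U: "open U" and x: "x \<in> dbl U"
  shows "mixed (\<lambda>x. F x - G x) x a b = mixed F x a b - mixed G x a b"
proof -
  have d: "fd (\<lambda>x. F x - G x) y v = fd F y v - fd G y v"
    if "holo_fun F (dbl U)" "holo_fun G (dbl U)" "y \<in> dbl U" for F G :: "complex ^ ('a + 'a) \<Rightarrow> complex" and y v
    using fun_cong[OF frechet_derivative_at[OF has_derivative_diff[OF holo_fun_has_derivative[OF that(1,3)]
      holo_fun_has_derivative[OF that(2,3)]], symmetric]] .
  have "fd (\<lambda>y. fd (\<lambda>x. F x - G x) y (vpair 0 b)) x = fd (\<lambda>y. fd F y (vpair 0 b) - fd G y (vpair 0 b)) x"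
    by (rule fd_cong[OF open_dbl[OF U] x]) (rule d[OF F G])
  then show ?thesis unfolding mixed_def
    using d[OF holo_fun_fd[OF F open_dbl[OF U]] holo_fun_fd[OF G open_dbl[OF U]] x] by simp
qed

lemma holo_fun_mixed:
  assumes "holo_fun F (dbl U)" "open U"
  shows "holo_fun (\<lambda>x. mixed F x a b) (dbl U)"
  unfolding mixed_def using assms by (intro holo_fun_fd open_dbl)

text \<open>The holomorphic map of doubled variables induced by \<open>h\<close>: it acts by
  \<open>h\<close> on the first block and by the conjugate of \<open>h\<close> on the
  second.\<close>

definition hpol :: "(complex ^ 'n \<Rightarrow> complex ^ 'm) \<Rightarrow> complex ^ ('n::finite + 'n) \<Rightarrow> complex ^ ('m::finite + 'm)" where
  "hpol h x = vpair (h (vfst x)) (vcnj (h (vcnj (vsnd x))))"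

lemma hpol_vpair: "hpol h (vpair z (vcnj w)) = vpair (h z) (vcnj (h w))"
  by (simp add: hpol_def)

lemma hpol_vdiag: "hpol h (vdiag z) = vdiag (h z)"
  by (simp add: hpol_def vdiag_def)

context
  fixes h :: "complex ^ 'n::finite \<Rightarrow> complex ^ 'm::finite" and U :: "(complex ^ 'n) set"
  assumes h: "holo_map h U" and U: "open U"
begin

lemma holo_map_hpol: "holo_map (hpol h) (dbl U)"
proof -
  have "holo_map (\<lambda>x. h (vfst x)) (dbl U)"
    unfolding holo_map_def
    using h by (intro allI holo_fun_compose(1)[OF holo_map_vfst]) (auto simp: holo_map_def dbl_def)
  moreover have "holo_map (\<lambda>x. vcnj (h (vcnj (vsnd x)))) (dbl U)"
    unfolding holo_map_def vpair_simps using h by (intro allI holo_fun_cnj_vcnj_vsnd) (simp add: holo_map_def)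
  ultimately show ?thesis unfolding hpol_def[abs_def] by (rule holo_map_vpair)
qed

lemma fd_hpol:
  assumes x: "x \<in> dbl U"
  shows "fd (hpol h) x v = vpair (fd h (vfst x) (vfst v)) (vcnj (fd h (vcnj (vsnd x)) (vcnj (vsnd v))))"
proof -
  have m: "vfst x \<in> U" "vcnj (vsnd x) \<in> U" using x by (auto simp: dbl_def)
  have 1: "((\<lambda>x. h (vfst x)) has_derivative (\<lambda>v. fd h (vfst x) (vfst v))) (at x)"
    using diff_chain_at[OF bounded_linear_imp_has_derivative[OF bounded_linear_vops(1)] holo_map_has_derivative(1)[OF h m(1)]]
    by (simp add: o_def)
  have "bounded_linear (\<lambda>x :: complex ^ ('n + 'n). vcnj (vsnd x))"
    using bounded_linear_compose[OF bounded_linear_vops(3,2)] .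
  from diff_chain_at[OF bounded_linear_imp_has_derivative[OF this] holo_map_has_derivative(1)[OF h m(2)]]
  have "((\<lambda>x. h (vcnj (vsnd x))) has_derivative (\<lambda>v. fd h (vcnj (vsnd x)) (vcnj (vsnd v)))) (at x)"
    by (simp add: o_def)
  then have 2: "((\<lambda>x. vcnj (h (vcnj (vsnd x)))) has_derivative (\<lambda>v. vcnj (fd h (vcnj (vsnd x)) (vcnj (vsnd v))))) (at x)"
    by (rule bounded_linear.has_derivative[OF bounded_linear_vops(3)])
  have "(hpol h has_derivative (\<lambda>v. vpair (fd h (vfst x) (vfst v)) (vcnj (fd h (vcnj (vsnd x)) (vcnj (vsnd v)))))) (at x)"
    unfolding hpol_def[abs_def] by (rule has_derivative_vpair[OF 1 2])
  from frechet_derivative_at[OF this, symmetric] show ?thesis by (rule fun_cong)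
qed

text \<open>No second derivative of \<open>h\<close> enters: moving in the first block leaves the
  conjugate block, and hence the derivative of its part of \<open>hpol h\<close>, unchanged. So the
  mixed derivative transforms like a tensor.\<close>

lemma mixed_compose:
  assumes G: "holo_fun G (dbl S)" and S: "open S" and hS: "h ` U \<subseteq> S" and z: "z \<in> U"
  shows "mixed (\<lambda>x. G (hpol h x)) (vdiag z) u (vcnj v) = mixed G (vdiag (h z)) (fd h z u) (vcnj (fd h z v))"
proof -
  have im: "hpol h ` dbl U \<subseteq> dbl S" using hS by (auto simp: hpol_def dbl_def)
  note c = holo_fun_compose[OF holo_map_hpol _ im]
  define b where "b = vcnj (fd h z v)"
  have hG': "holo_fun (\<lambda>y. fd G y (vpair 0 b)) (dbl S)" by (rule holo_fun_fd[OF G open_dbl[OF S]])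
  have hL: "holo_fun (\<lambda>y. fd (\<lambda>x. G (hpol h x)) y (vpair 0 (vcnj v))) (dbl U)"
    by (rule holo_fun_fd[OF c(1)[OF G] open_dbl[OF U]])
  define T where "T = {t. z + t *s u \<in> U}"
  have T: "open T" "0 \<in> T" unfolding T_def using open_line_set[OF U] z by auto
  have line: "vdiag z + t *s vpair u 0 = vpair (z + t *s u) (vcnj z)" for t
    by (simp add: vdiag_def vpair_arith)
  \<comment> \<open>Along this line the second block is constantly \<open>vcnj z\<close>, so the
    inner direction is the fixed vector \<open>vpair 0 b\<close> and the outer derivative sees a
    function of the form treated by \<open>holo_fun_compose\<close>.\<close>
  have eq: "fd (\<lambda>x. G (hpol h x)) (vdiag z + t *s vpair u 0) (vpair 0 (vcnj v)) = fd G (hpol h (vdiag z + t *s vpair u 0)) (vpair 0 b)"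
    if "t \<in> T" for t
  proof -
    have m: "vdiag z + t *s vpair u 0 \<in> dbl U" unfolding line using that z by (simp add: T_def)
    have "linear (fd h (z + t *s u))"
      using holo_map_has_derivative(1)[OF h] that has_derivative_linear unfolding T_def by blast
    then have "fd h (z + t *s u) 0 = 0" by (rule linear_0)
    then show ?thesis unfolding c(2)[OF G m] fd_hpol[OF m] unfolding line by (simp add: b_def)
  qed
  have "((\<lambda>t. fd (\<lambda>x. G (hpol h x)) (vdiag z + t *s vpair u 0) (vpair 0 (vcnj v))) has_field_derivative
     fd (\<lambda>y. fd (\<lambda>x. G (hpol h x)) y (vpair 0 (vcnj v))) (vdiag z) (vpair u 0)) (at 0)"
    using holo_fun_line[OF hL, of "vdiag z" 0 "vpair u 0"] z by simp
  then have 1: "((\<lambda>t. fd G (hpol h (vdiag z + t *s vpair u 0)) (vpair 0 b)) has_field_derivative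
     fd (\<lambda>y. fd (\<lambda>x. G (hpol h x)) y (vpair 0 (vcnj v))) (vdiag z) (vpair u 0)) (at 0)"
    by (rule has_field_derivative_transform_within_open[OF _ T]) (rule eq)
  have "((\<lambda>t. fd G (hpol h (vdiag z + t *s vpair u 0)) (vpair 0 b)) has_field_derivative
     fd (\<lambda>y. fd G (hpol h y) (vpair 0 b)) (vdiag z) (vpair u 0)) (at 0)"
    using holo_fun_line[OF c(1)[OF hG'], of "vdiag z" 0 "vpair u 0"] z by simp
  from DERIV_unique[OF 1 this]
  have "mixed (\<lambda>x. G (hpol h x)) (vdiag z) u (vcnj v) = fd (\<lambda>y. fd G (hpol h y) (vpair 0 b)) (vdiag z) (vpair u 0)"
    by (simp add: mixed_def)
  also have "\<dots> = fd (\<lambda>y. fd G y (vpair 0 b)) (hpol h (vdiag z)) (fd (hpol h) (vdiag z) (vpair u 0))"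
    using c(2)[OF hG'] z by simp
  also have "fd (hpol h) (vdiag z) (vpair u 0) = vpair (fd h z u) 0"
  proof -
    have "linear (fd h z)" using holo_map_has_derivative(1)[OF h z] has_derivative_linear by blast
    then have "fd h z 0 = 0" by (rule linear_0)
    then show ?thesis using fd_hpol[of "vdiag z"] z by (simp add: vdiag_def)
  qed
  finally show ?thesis by (simp add: mixed_def b_def hpol_vdiag)
qed

end

text \<open>Equality of the pulled back metrics says that the difference \<open>L\<close> of the polarized logarithms
  of the kernels has vanishing mixed derivatives on the diagonal, hence everywhere near it.\<close>

proposition kernels_proportional:
  fixes h :: "complex ^ 'n::finite \<Rightarrow> complex ^ 'm::finite"
  assumes \<phi>: "sq_bounded_family I \<phi> \<Omega>" and \<Omega>: "open \<Omega>"
    and g: "sq_bounded_family J g S" and S: "open S"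
    and U: "open U" "z0 \<in> U" "U \<subseteq> \<Omega>" and h: "holo_map h U" "h ` U \<subseteq> S"
    and K0: "polarized I \<phi> (vdiag z0) \<noteq> 0" and P0: "polarized J g (vdiag (h z0)) \<noteq> 0"
    and metric: "\<And>z u v. z \<in> U \<Longrightarrow>
      tensor_eval (complex_hessian (\<lambda>\<zeta>. Ln (polarized J g (vdiag \<zeta>))) (h z)) (fd h z u) (fd h z v)
      = tensor_eval (complex_hessian (\<lambda>z. Ln (polarized I \<phi> (vdiag z))) z) u v"
  obtains r l where "r > 0" "ball z0 r \<subseteq> U" "\<And>z. z \<in> ball z0 r \<Longrightarrow> l z \<noteq> 0"
    "\<And>z w. z \<in> ball z0 r \<Longrightarrow> w \<in> ball z0 r \<Longrightarrow>
       polarized J g (vpair (h z) (vcnj (h w))) = l z * cnj (l w) * polarized I \<phi> (vpair z (vcnj w))"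
proof -
  have z0: "z0 \<in> \<Omega>" "h z0 \<in> S" using U h by auto
  obtain r1 where r1: "r1 > 0" "ball z0 r1 \<subseteq> \<Omega>" "\<And>x. x \<in> dbl (ball z0 r1) \<Longrightarrow> polarized I \<phi> x \<notin> \<real>\<^sub>\<le>\<^sub>0"
    "holo_fun (\<lambda>x. Ln (polarized I \<phi> x)) (dbl (ball z0 r1))"
    using Ln_polarized_holo[OF \<phi> \<Omega> z0(1) K0] by blast
  obtain \<rho> where \<rho>: "\<rho> > 0" "ball (h z0) \<rho> \<subseteq> S" "\<And>x. x \<in> dbl (ball (h z0) \<rho>) \<Longrightarrow> polarized J g x \<notin> \<real>\<^sub>\<le>\<^sub>0"
    "holo_fun (\<lambda>x. Ln (polarized J g x)) (dbl (ball (h z0) \<rho>))"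
    using Ln_polarized_holo[OF g S z0(2) P0] by blast
  have "open (U \<inter> h -` ball (h z0) \<rho>)"
    by (rule continuous_open_preimage[OF holo_map_continuous_on[OF h(1)] U(1) open_ball])
  then have "open (U \<inter> h -` ball (h z0) \<rho> \<inter> ball z0 r1)" by (rule open_Int[OF _ open_ball])
  moreover have "z0 \<in> U \<inter> h -` ball (h z0) \<rho> \<inter> ball z0 r1" using U(2) \<rho>(1) r1(1) by simp
  ultimately obtain r where r: "r > 0" "ball z0 r \<subseteq> U \<inter> h -` ball (h z0) \<rho> \<inter> ball z0 r1" by (meson openE)
  define B where "B = ball z0 r"
  have B: "open B" "convex B" "B \<subseteq> U" "B \<subseteq> ball z0 r1" "h ` B \<subseteq> ball (h z0) \<rho>" "z0 \<in> B"
    using r by (auto simp: B_def)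
  have hB: "holo_map h B" using h(1) holo_fun_subset[OF _ B(3)] unfolding holo_map_def by blast
  define GK where "GK = (\<lambda>x. Ln (polarized I \<phi> x))"
  define GM where "GM = (\<lambda>x. Ln (polarized J g x))"
  have GK: "holo_fun GK (dbl B)" unfolding GK_def using r1(4) dbl_mono[OF B(4)] by (rule holo_fun_subset)
  have GM: "holo_fun GM (dbl (ball (h z0) \<rho>))" unfolding GM_def by (rule \<rho>(4))
  have im: "hpol h ` dbl B \<subseteq> dbl (ball (h z0) \<rho>)" using B(5) by (auto simp: hpol_def dbl_def)
  have GMH: "holo_fun (\<lambda>x. GM (hpol h x)) (dbl B)"
    by (rule holo_fun_compose(1)[OF holo_map_hpol[OF hB B(1)] GM im])
  define L where "L = (\<lambda>x. GM (hpol h x) - GK x)"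
  have L: "holo_fun L (dbl B)" unfolding L_def by (rule holo_fun_diff[OF GMH GK])
  have Ld: "mixed L (vdiag z) u (vcnj v) = 0" if z: "z \<in> B" for z u v
  proof -
    have "mixed (\<lambda>x. GM (hpol h x)) (vdiag z) u (vcnj v) = mixed GM (vdiag (h z)) (fd h z u) (vcnj (fd h z v))"
      by (rule mixed_compose[OF hB B(1) GM open_ball B(5) z])
    also have "\<dots> = tensor_eval (complex_hessian (\<lambda>\<zeta>. GM (vdiag \<zeta>)) (h z)) (fd h z u) (fd h z v)"
      using tensor_eval_complex_hessian[OF GM open_ball, of "h z"] z B(5) by auto
    also have "\<dots> = tensor_eval (complex_hessian (\<lambda>z. GK (vdiag z)) z) u v"
      unfolding GM_def GK_def using metric z B(3) by blast
    also have "\<dots> = mixed GK (vdiag z) u (vcnj v)" by (rule tensor_eval_complex_hessian[OF GK B(1) z])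
    finally show ?thesis unfolding L_def using mixed_diff[OF GMH GK B(1), of "vdiag z"] z by simp
  qed
  have L0: "mixed L x a b = 0" if "x \<in> dbl B" for x a b
  proof (rule polarization[OF holo_fun_mixed[OF L B(1)] B(1,2) _ that])
    show "mixed L (vdiag z) a b = 0" if "z \<in> B" for z using Ld[OF that, of a "vcnj b"] by simp
  qed
  \<comment> \<open>The quotient of the two kernels. Being an exponential it never vanishes, which
    later makes the factor \<open>l\<close> nonzero.\<close>
  define R where "R z w = exp (L (vpair z (vcnj w)))" for z w
  have RR: "polarized J g (vpair (h z) (vcnj (h w))) = R z w * polarized I \<phi> (vpair z (vcnj w))"
    if "z \<in> B" "w \<in> B" for z w
  proof -
    have "vpair z (vcnj w) \<in> dbl B" using that by simp
    then have "polarized I \<phi> (vpair z (vcnj w)) \<notin> \<real>\<^sub>\<le>\<^sub>0" "polarized J g (hpol h (vpair z (vcnj w))) \<notin> \<real>\<^sub>\<le>\<^sub>0"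
      using r1(3) \<rho>(3) dbl_mono[OF B(4)] im by blast+
    then have nz: "polarized I \<phi> (vpair z (vcnj w)) \<noteq> 0" "polarized J g (vpair (h z) (vcnj (h w))) \<noteq> 0"
      by (auto simp: hpol_def)
    then have "R z w = polarized J g (vpair (h z) (vcnj (h w))) / polarized I \<phi> (vpair z (vcnj w))"
      unfolding R_def L_def GM_def GK_def hpol_vpair by (simp add: exp_diff)
    then show ?thesis using nz by simp
  qed
  have nzK: "polarized I \<phi> (vpair z (vcnj w)) \<noteq> 0" if "z \<in> B" "w \<in> B" for z w
  proof -
    have "vpair z (vcnj w) \<in> dbl (ball z0 r1)" using that B(4) by auto
    then show ?thesis using r1(3) by fastforce
  qed
  have R_cnj: "R w z = cnj (R z w)" if "z \<in> B" "w \<in> B" for z w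
  proof -
    have "cnj (R z w) * polarized I \<phi> (vpair w (vcnj z)) = polarized J g (vpair (h w) (vcnj (h z)))"
      using RR[OF that] polarized_cnj[of I \<phi> w z] polarized_cnj[of J g "h w" "h z"] by simp
    also have "\<dots> = R w z * polarized I \<phi> (vpair w (vcnj z))" by (rule RR[OF that(2,1)])
    finally show ?thesis using nzK[OF that(2,1)] by simp
  qed
  \<comment> \<open>Additive separation of \<open>L\<close> becomes multiplicative separation of its
    exponential, with \<open>z0\<close> as base point.\<close>
  have R_mult: "R z w * R z0 z0 = R z z0 * R z0 w" if "z \<in> B" "w \<in> B" for z w
    unfolding R_def using mixed_zero_separates[OF L B(1,2) L0 that B(6) B(6)] by (simp flip: exp_add)
  have R00: "R z0 z0 = complex_of_real (Re (R z0 z0))" using R_cnj[OF B(6) B(6)] by (simp add: complex_eq_iff)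
  have pos: "Re (R z0 z0) > 0"
  proof -
    have "polarized J g (vdiag (h z0)) = R z0 z0 * polarized I \<phi> (vdiag z0)" using RR[OF B(6) B(6)] by (simp add: vdiag_def)
    then have "complex_of_real (Re (polarized J g (vdiag (h z0)))) = complex_of_real (Re (R z0 z0) * Re (polarized I \<phi> (vdiag z0)))"
      using polarized_vdiag_pos(1)[OF g z0(2) P0] polarized_vdiag_pos(1)[OF \<phi> z0(1) K0] R00 by (metis of_real_mult)
    then have "Re (polarized J g (vdiag (h z0))) = Re (R z0 z0) * Re (polarized I \<phi> (vdiag z0))"
      by (simp only: of_real_eq_iff)
    then show ?thesis using polarized_vdiag_pos(2)[OF g z0(2) P0] polarized_vdiag_pos(2)[OF \<phi> z0(1) K0]
      by (metis zero_less_mult_pos2)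
  qed
  \<comment> \<open>\<open>R z0 z0\<close> is a quotient of positive diagonal values. Its positive
    square root splits the normalization evenly between \<open>l z = R z z0 / s\<close> and
    \<open>cnj (l w) = R z0 w / s\<close>.\<close>
  define s where "s = complex_of_real (sqrt (Re (R z0 z0)))"
  have s: "s * s = R z0 z0" "cnj s = s" "s \<noteq> 0"
    using pos R00 by (auto simp: s_def simp flip: of_real_mult)
  show thesis
  proof (rule that[OF r(1), of "\<lambda>z. R z z0 / s"])
    show "ball z0 r \<subseteq> U" using B(3) by (simp add: B_def)
    show "R z z0 / s \<noteq> 0" if "z \<in> ball z0 r" for z using s(3) by (simp add: R_def)
    show "polarized J g (vpair (h z) (vcnj (h w))) = R z z0 / s * cnj (R w z0 / s) * polarized I \<phi> (vpair z (vcnj w))"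
      if "z \<in> ball z0 r" "w \<in> ball z0 r" for z w
    proof -
      have m: "z \<in> B" "w \<in> B" using that by (auto simp: B_def)
      have "R z z0 / s * cnj (R w z0 / s) = R z z0 * R z0 w / (s * s)"
        using R_cnj[OF m(2) B(6)] s(2) by simp
      also have "\<dots> = R z w" using R_mult[OF m] s(1,3) by (metis mult_eq_0_iff nonzero_mult_div_cancel_right)
      finally show ?thesis using RR[OF m] by simp
    qed
  qed
qed

section \<open>Isometries from bounded domains\<close>

text \<open>The squared norm of the vector with entries \<open>\<phi> i z - c * \<phi> i w\<close>
  is a combination of the four values of \<open>K\<close> at \<open>z\<close> and \<open>w\<close>.
  Proportionality of the other family makes this combination vanish, and the values are
  shared.\<close>

lemma kernel_transfer_points:
  assumes \<phi>: "\<And>x y. x \<in> {z, w} \<Longrightarrow> y \<in> {z, w} \<Longrightarrow> ((\<lambda>i. \<phi> i x * cnj (\<phi> i y)) has_sum K x y) I"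
    and \<xi>: "\<And>x y. x \<in> {z, w} \<Longrightarrow> y \<in> {z, w} \<Longrightarrow> ((\<lambda>j. \<xi> j x * cnj (\<xi> j y)) has_sum K x y) J"
    and rel: "\<And>j. j \<in> J \<Longrightarrow> \<xi> j z = c * \<xi> j w" and i: "i \<in> I"
  shows "\<phi> i z = c * \<phi> i w"
proof -
  have K: "K z y = c * K w y" if "y \<in> {z, w}" for y
  proof -
    have "((\<lambda>j. c * (\<xi> j w * cnj (\<xi> j y))) has_sum c * K w y) J"
      by (intro has_sum_cmult_right \<xi> that) simp
    then have "((\<lambda>j. \<xi> j z * cnj (\<xi> j y)) has_sum c * K w y) J"
      by (rule has_sum_cong[THEN iffD1, rotated]) (simp add: rel)
    then show ?thesis using \<xi>[OF _ that, of z] has_sum_unique by blast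
  qed
  have D: "((\<lambda>i. \<phi> i x * cnj (\<phi> i y) * a) has_sum K x y * a) I" if "x \<in> {z, w}" "y \<in> {z, w}" for x y a
    by (intro has_sum_cmult_left \<phi> that)
  have "((\<lambda>i. (\<phi> i z * cnj (\<phi> i z) * 1 + \<phi> i w * cnj (\<phi> i z) * (- c))
      + (\<phi> i z * cnj (\<phi> i w) * (- cnj c) + \<phi> i w * cnj (\<phi> i w) * (c * cnj c)))
    has_sum ((K z z * 1 + K w z * (- c)) + (K z w * (- cnj c) + K w w * (c * cnj c)))) I"
    by (intro has_sum_add D) auto
  also have "(K z z * 1 + K w z * (- c)) + (K z w * (- cnj c) + K w w * (c * cnj c)) = 0"
    using K[of z] K[of w] by simp
  also have "(\<lambda>i. (\<phi> i z * cnj (\<phi> i z) * 1 + \<phi> i w * cnj (\<phi> i z) * (- c))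
      + (\<phi> i z * cnj (\<phi> i w) * (- cnj c) + \<phi> i w * cnj (\<phi> i w) * (c * cnj c)))
    = (\<lambda>i. (\<phi> i z - c * \<phi> i w) * cnj (\<phi> i z - c * \<phi> i w))"
    by (simp add: fun_eq_iff algebra_simps)
  finally show ?thesis using has_sum_norm_square_0[of "\<lambda>i. \<phi> i z - c * \<phi> i w" I i] i by simp
qed

text \<open>The squared norm of the difference \<open>d\<close> would involve a second derivative of
  the kernel. Instead \<open>d\<close> is shown orthogonal to \<phi> at every point
  \<open>w\<close>, and this relation is then differentiated at \<open>z\<close>.\<close>

lemma kernel_transfer_tangents:
  fixes \<Omega> :: "(complex ^ 'n) set"
  assumes \<Omega>: "open \<Omega>" and \<phi>: "sq_bounded_family I \<phi> \<Omega>" and \<xi>: "sq_bounded_family J \<xi> \<Omega>"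
    and K\<phi>: "\<And>x y. x \<in> \<Omega> \<Longrightarrow> y \<in> \<Omega> \<Longrightarrow> ((\<lambda>i. \<phi> i x * cnj (\<phi> i y)) has_sum K x y) I"
    and K\<xi>: "\<And>x y. x \<in> \<Omega> \<Longrightarrow> y \<in> \<Omega> \<Longrightarrow> ((\<lambda>j. \<xi> j x * cnj (\<xi> j y)) has_sum K x y) J"
    and z: "z \<in> \<Omega>" and rel: "\<And>j. j \<in> J \<Longrightarrow> fd (\<xi> j) z v = c * \<xi> j z" and i: "i \<in> I"
  shows "fd (\<phi> i) z v = c * \<phi> i z"
proof -
  define d where "d i = fd (\<phi> i) z v - c * \<phi> i z" for i
  obtain C1 where C1: "sq_bounded I (\<lambda>i. fd (\<phi> i) z v) C1" using sq_bounded_fd[OF \<phi> z] .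
  obtain C2 where C2: "sq_bounded I (\<lambda>i. \<phi> i z) C2" using sq_bounded_family_at[OF \<phi> z] .
  have d: "sq_bounded I d (2 * C1 + 2 * (cmod c)\<^sup>2 * C2)"
    unfolding d_def by (rule sq_bounded_combination[OF C1 C2])
  \<comment> \<open>Both families have the same first derivative of the kernel in the first
    variable; the relation for \<xi> evaluates it to \<open>c * K z w\<close>.\<close>
  have orth: "((\<lambda>i. d i * cnj (\<phi> i w)) has_sum 0) I" if w: "w \<in> \<Omega>" for w
  proof -
    obtain A where A: "sq_bounded I (\<lambda>i. \<phi> i w) A" using sq_bounded_family_at[OF \<phi> w] .
    obtain B where B: "sq_bounded J (\<lambda>j. \<xi> j w) B" using sq_bounded_family_at[OF \<xi> w] .
    have e\<phi>: "fd (\<lambda>x. \<Sum>\<^sub>\<infinity>i\<in>I. \<phi> i x * cnj (\<phi> i w)) z = fd (\<lambda>x. K x w) z"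
      by (rule fd_cong[OF \<Omega> z]) (rule infsumI[OF K\<phi>[OF _ w]])
    have e\<xi>: "fd (\<lambda>x. \<Sum>\<^sub>\<infinity>j\<in>J. \<xi> j x * cnj (\<xi> j w)) z = fd (\<lambda>x. K x w) z"
      by (rule fd_cong[OF \<Omega> z]) (rule infsumI[OF K\<xi>[OF _ w]])
    have 1: "((\<lambda>i. fd (\<phi> i) z v * cnj (\<phi> i w)) has_sum fd (\<lambda>x. K x w) z v) I"
      using has_sum_fd_series[OF \<phi> A z] unfolding e\<phi> .
    have 2: "((\<lambda>j. fd (\<xi> j) z v * cnj (\<xi> j w)) has_sum fd (\<lambda>x. K x w) z v) J"
      using has_sum_fd_series[OF \<xi> B z] unfolding e\<xi> .
    have "((\<lambda>j. c * (\<xi> j z * cnj (\<xi> j w))) has_sum c * K z w) J"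
      by (intro has_sum_cmult_right K\<xi> z w)
    then have "((\<lambda>j. fd (\<xi> j) z v * cnj (\<xi> j w)) has_sum c * K z w) J"
      by (rule has_sum_cong[THEN iffD1, rotated]) (simp add: rel)
    then have eq: "fd (\<lambda>x. K x w) z v = c * K z w" using 2 has_sum_unique by blast
    have "((\<lambda>i. fd (\<phi> i) z v * cnj (\<phi> i w) + (- c) * (\<phi> i z * cnj (\<phi> i w))) has_sum (c * K z w + (- c) * K z w)) I"
      by (intro has_sum_add has_sum_cmult_right K\<phi> z w 1[unfolded eq])
    then show ?thesis by (simp add: d_def algebra_simps)
  qed
  have orth': "((\<lambda>i. \<phi> i w * cnj (d i)) has_sum 0) I" if w: "w \<in> \<Omega>" for w
  proof -
    have "((\<lambda>i. cnj (d i * cnj (\<phi> i w))) has_sum cnj 0) I" using orth[OF w] by (simp only: has_sum_cnj_iff)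
    then show ?thesis by (simp add: mult.commute)
  qed
  \<comment> \<open>The series is identically 0 on \<Omega>, so its termwise derivative at
    \<open>z\<close> vanishes too; together with the value at \<open>z\<close> this makes
    \<open>d\<close> orthogonal to itself.\<close>
  have "fd (\<lambda>x. \<Sum>\<^sub>\<infinity>i\<in>I. \<phi> i x * cnj (d i)) z = fd (\<lambda>x. 0) z"
    by (rule fd_cong[OF \<Omega> z]) (rule infsumI[OF orth'])
  then have "((\<lambda>i. fd (\<phi> i) z v * cnj (d i)) has_sum 0) I"
    using has_sum_fd_series[OF \<phi> d z, of v] by (simp add: fd_const)
  then have "((\<lambda>i. fd (\<phi> i) z v * cnj (d i) + (- c) * (\<phi> i z * cnj (d i))) has_sum (0 + (- c) * 0)) I"
    by (intro has_sum_add has_sum_cmult_right orth' z)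
  then have "((\<lambda>i. d i * cnj (d i)) has_sum 0) I" by (simp add: d_def algebra_simps)
  from has_sum_norm_square_0[OF this i] show ?thesis by (simp add: d_def)
qed

lemma fd_mult:
  assumes "holo_fun f S" "holo_fun g S" "x \<in> S"
  shows "fd (\<lambda>z. f z * g z) x v = f x * fd g x v + fd f x v * g x"
  using fun_cong[OF frechet_derivative_at[OF has_derivative_mult[OF holo_fun_has_derivative[OF assms(1,3)]
    holo_fun_has_derivative[OF assms(2,3)]], symmetric]] .

context
  fixes \<Omega> :: "(complex ^ 'n::finite) set" and M :: "'a topology" and A :: "('a, 'm::finite) chart set"
    and f :: "complex ^ 'n \<Rightarrow> 'a"
  assumes dom: "bounded_domain \<Omega>" and M: "complex_manifold M A" and bm: "has_bergman_metric M A"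
    and hol: "manifold_holomorphic (top_of_set \<Omega>) (domain_atlas \<Omega>) M A f"
    and surj: "f ` \<Omega> = topspace M"
    and pres: "preserves_bergman_metric \<Omega> M A f"
begin

lemma \<Omega>: "open \<Omega>" "connected \<Omega>" "bounded \<Omega>" and \<Omega>_ne: "\<Omega> \<noteq> {}" and ne: "topspace M \<noteq> {}"
  using dom surj by (auto simp: bounded_domain_def)

lemma open_preimage_chart:
  assumes "c \<in> A" shows "open (\<Omega> \<inter> f -` fst c)"
proof -
  have "continuous_map (top_of_set \<Omega>) M f" using hol by (simp add: manifold_holomorphic_def)
  then have "openin (top_of_set \<Omega>) {z \<in> topspace (top_of_set \<Omega>). f z \<in> fst c}"
    by (rule openin_continuous_map_preimage) (rule chart_facts(1)[OF M ne assms])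
  moreover have "{z \<in> topspace (top_of_set \<Omega>). f z \<in> fst c} = \<Omega> \<inter> f -` fst c" by auto
  ultimately show ?thesis using \<Omega>(1) openin_open_trans by metis
qed

lemma holo_map_chart:
  assumes "c \<in> A" shows "holo_map (snd c \<circ> f) (\<Omega> \<inter> f -` fst c)"
proof -
  obtain V \<psi> where c: "c = (V, \<psi>)" by (cases c)
  have h: "holo_map (\<psi> \<circ> f \<circ> inv_into \<Omega> id) (id ` (\<Omega> \<inter> f -` V))"
    using hol assms unfolding manifold_holomorphic_def domain_atlas_def c by auto
  have inv: "inv_into \<Omega> id z = z" if "z \<in> \<Omega>" for z
    using f_inv_into_f[of z id \<Omega>] that by simp
  show ?thesis
    unfolding holo_map_def
  proof
    fix i
    show "holo_fun (\<lambda>z. (snd c \<circ> f) z $ i) (\<Omega> \<inter> f -` fst c)"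
    proof (rule holo_fun_cong[OF _ open_preimage_chart[OF assms]])
      show "holo_fun (\<lambda>z. (\<psi> \<circ> f \<circ> inv_into \<Omega> id) z $ i) (\<Omega> \<inter> f -` fst c)"
        using h by (simp add: holo_map_def c)
    qed (simp add: inv c)
  qed
qed

lemma chart_around:
  assumes "x \<in> topspace M" obtains c where "c \<in> A" "x \<in> fst c"
proof -
  have "(\<Union>(U, \<phi>)\<in>A. U) = topspace M" using M by (simp add: complex_manifold_def)
  then show thesis using assms that by fastforce
qed

abbreviation "J \<equiv> manifold_basis M A"

lemma basis_form: "\<omega> \<in> J \<Longrightarrow> holomorphic_top_form A \<omega>"
  using manifold_basis[OF M ne] unfolding complete_orthonormal_system_def manifold_A2_def by auto

text \<open>The coefficient is composed with \<open>f\<close> as a function, without a Jacobian of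
  \<open>f\<close>; the two dimensions are not yet known to agree. The second claim is the chain
  rule for directions killed by the differential of \<open>f\<close>.\<close>

lemma holo_fun_pullback:
  assumes "\<omega> \<in> J" "c \<in> A"
  shows "holo_fun (\<lambda>z. \<omega> c (f z)) (\<Omega> \<inter> f -` fst c)"
    and "z \<in> \<Omega> \<inter> f -` fst c \<Longrightarrow> fd (snd c \<circ> f) z v = 0 \<Longrightarrow> fd (\<lambda>z. \<omega> c (f z)) z v = 0"
proof -
  let ?W = "\<Omega> \<inter> f -` fst c"
  have im: "(snd c \<circ> f) ` ?W \<subseteq> snd c ` fst c" by auto
  note h = holo_map_chart[OF assms(2)]
  have g: "holo_fun (\<lambda>\<zeta>. \<omega> c (chart_inv c \<zeta>)) (snd c ` fst c)"
    by (rule holomorphic_top_form_holo_fun[OF basis_form[OF assms(1)] assms(2)])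
  have eq: "\<omega> c (chart_inv c ((snd c \<circ> f) z)) = \<omega> c (f z)" if "z \<in> ?W" for z
    using that chart_inv_simps(1)[OF M ne assms(2)] by simp
  show "holo_fun (\<lambda>z. \<omega> c (f z)) ?W"
    by (rule holo_fun_cong[OF holo_fun_compose(1)[OF h g im] open_preimage_chart[OF assms(2)] eq])
  assume z: "z \<in> ?W" and 0: "fd (snd c \<circ> f) z v = 0"
  have "fd (\<lambda>z. \<omega> c (f z)) z = fd (\<lambda>z. \<omega> c (chart_inv c ((snd c \<circ> f) z))) z"
    by (rule fd_cong[OF open_preimage_chart[OF assms(2)] z]) (rule eq[symmetric])
  then have "fd (\<lambda>z. \<omega> c (f z)) z v = fd (\<lambda>\<zeta>. \<omega> c (chart_inv c \<zeta>)) ((snd c \<circ> f) z) 0"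
    using holo_fun_compose(2)[OF h g im z, of v] 0 by simp
  also have "\<dots> = 0" using holo_fun_fd_linear[OF g, of "(snd c \<circ> f) z"] z by (simp add: linear_0)
  finally show "fd (\<lambda>z. \<omega> c (f z)) z v = 0" .
qed

text \<open>Otherwise every term of the kernel at \<open>(x, x)\<close> would be 0.\<close>

lemma basis_nonvanishing:
  assumes "c \<in> A" "x \<in> fst c"
  obtains \<omega> where "\<omega> \<in> J" "\<omega> c x \<noteq> 0"
proof -
  have "manifold_kernel M A c c x x \<noteq> 0" using bm assms unfolding has_bergman_metric_def by blast
  then have "\<exists>\<omega>\<in>J. \<omega> c x \<noteq> 0"
    unfolding manifold_kernel_eq[OF M ne] by (metis (mono_tags, lifting) infsum_0 mult_zero_left)
  then show thesis using that by blast
qed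

abbreviation "K \<equiv> \<lambda>z w. \<Sum>\<^sub>\<infinity>\<phi>\<in>bergman_basis \<Omega>. \<phi> z * cnj (\<phi> w)"

lemma K_has_sum_bergman:
  assumes "z \<in> \<Omega>" "w \<in> \<Omega>"
  shows "((\<lambda>\<phi>. \<phi> z * cnj (\<phi> w)) has_sum K z w) (bergman_basis \<Omega>)"
  by (rule has_sum_infsum[OF sq_bounded_family_summable[OF sq_bounded_family_bergman_basis[OF \<Omega>(1)] assms]])

lemma K_diagonal_nonzero:
  assumes z: "z \<in> \<Omega>" shows "K z z \<noteq> 0"
proof
  assume 0: "K z z = 0"
  obtain \<phi> where "\<phi> \<in> bergman_basis \<Omega>" "\<phi> z \<noteq> 0" using bergman_basis_nonvanishing[OF \<Omega>(1,3) z] .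
  then show False using has_sum_norm_square_0[OF K_has_sum_bergman[OF z z, unfolded 0]] by blast
qed

text \<open>Comparison of kernels takes place in the one chart where square bounds for the basis of
  \<open>M\<close> are available. The last claim, cleared of denominators, is what remains
  meaningful in all other charts and at all other points of \<Omega>.\<close>

lemma extended_family:
  obtains \<xi> where "sq_bounded_family J \<xi> \<Omega>"
    and "\<And>z w. z \<in> \<Omega> \<Longrightarrow> w \<in> \<Omega> \<Longrightarrow> ((\<lambda>j. \<xi> j z * cnj (\<xi> j w)) has_sum K z w) J"
    and "\<And>z c j k. z \<in> \<Omega> \<Longrightarrow> c \<in> A \<Longrightarrow> f z \<in> fst c \<Longrightarrow> j \<in> J \<Longrightarrow> k \<in> J \<Longrightarrow> j c (f z) * \<xi> k z = k c (f z) * \<xi> j z"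
proof -
  obtain c0 where c0: "c0 \<in> A" "fst c0 \<noteq> {}"
    and fam: "sq_bounded_family J (\<lambda>\<omega> \<zeta>. \<omega> c0 (chart_inv c0 \<zeta>)) (snd c0 ` fst c0)"
    using sq_bounded_family_manifold_basis[OF M ne] by blast
  define S where "S = snd c0 ` fst c0"
  define g where "g = (\<lambda>(\<omega> :: ('a, 'm) top_form) \<zeta>. \<omega> c0 (chart_inv c0 \<zeta>))"
  define h where "h = snd c0 \<circ> f"
  define U where "U = \<Omega> \<inter> f -` fst c0"
  have fam': "sq_bounded_family J g S" using fam by (simp add: g_def S_def)
  obtain z0 where z0: "z0 \<in> U"
  proof -
    obtain x where x: "x \<in> fst c0" using c0 by blast
    then have "x \<in> topspace M" using openin_subset[OF chart_facts(1)[OF M ne c0(1)]] by blast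
    then obtain z where "z \<in> \<Omega>" "f z = x" using surj by (metis imageE)
    then show thesis using that[of z] x by (simp add: U_def)
  qed
  have hS: "h ` U \<subseteq> S" by (auto simp: h_def U_def S_def)
  have gh: "g j (h z) = j c0 (f z)" if "z \<in> U" for j z
    using chart_inv_simps(1)[OF M ne c0(1)] that by (simp add: g_def h_def U_def)
  have polK: "polarized (bergman_basis \<Omega>) (\<lambda>\<phi>. \<phi>) (vdiag z) = domain_kernel \<Omega> z z" for z
    by (simp add: polarized_def domain_kernel_eq vdiag_def)
  have polM: "polarized J g (vdiag \<zeta>) = manifold_kernel M A c0 c0 (chart_inv c0 \<zeta>) (chart_inv c0 \<zeta>)" for \<zeta>
    by (simp add: polarized_def manifold_kernel_eq[OF M ne] vdiag_def g_def)
  have S: "open S" unfolding S_def by (rule chart_facts(2)[OF M ne c0(1)])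
  have U: "open U" "U \<subseteq> \<Omega>" unfolding U_def using open_preimage_chart[OF c0(1)] by auto
  obtain r l where r: "r > 0" "ball z0 r \<subseteq> U" and l: "\<And>z. z \<in> ball z0 r \<Longrightarrow> l z \<noteq> 0"
    and rel: "\<And>z w. z \<in> ball z0 r \<Longrightarrow> w \<in> ball z0 r \<Longrightarrow>
       polarized J g (vpair (h z) (vcnj (h w))) = l z * cnj (l w) * polarized (bergman_basis \<Omega>) (\<lambda>\<phi>. \<phi>) (vpair z (vcnj w))"
  proof (rule kernels_proportional[OF sq_bounded_family_bergman_basis[OF \<Omega>(1)] \<Omega>(1) fam' S U(1) z0 U(2) _ hS])
    show "holo_map h U" unfolding h_def U_def by (rule holo_map_chart[OF c0(1)])
    show "polarized (bergman_basis \<Omega>) (\<lambda>\<phi>. \<phi>) (vdiag z0) \<noteq> 0"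
      unfolding polK domain_kernel_eq using K_diagonal_nonzero z0 U(2) by blast
    have "chart_inv c0 (h z0) = f z0" using chart_inv_simps(1)[OF M ne c0(1)] z0 by (simp add: h_def U_def)
    then show "polarized J g (vdiag (h z0)) \<noteq> 0"
      unfolding polM using bm c0(1) z0 unfolding has_bergman_metric_def U_def by auto
    fix z u v assume "z \<in> U"
    then have "z \<in> \<Omega>" "f z \<in> fst c0" by (auto simp: U_def)
    then have "tensor_eval (manifold_metric M A c0 (f z)) (fd (snd c0 \<circ> f) z u) (fd (snd c0 \<circ> f) z v)
        = tensor_eval (domain_metric \<Omega> z) u v"
      using pres c0(1) unfolding preserves_bergman_metric_def by blast
    then show "tensor_eval (complex_hessian (\<lambda>\<zeta>. Ln (polarized J g (vdiag \<zeta>))) (h z)) (fd h z u) (fd h z v)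
      = tensor_eval (complex_hessian (\<lambda>z. Ln (polarized (bergman_basis \<Omega>) (\<lambda>\<phi>. \<phi>) (vdiag z))) z) u v"
      unfolding polM polK manifold_metric_def domain_metric_def h_def by simp
  qed (rule that)
  define N where "N = ball z0 r"
  have N: "open N" "N \<noteq> {}" "N \<subseteq> \<Omega>" using r U(2) by (auto simp: N_def)
  \<comment> \<open>Division by \<open>l\<close> removes the rank-one quotient of the kernels, so
    this family has the kernel of \<Omega> on \<open>N\<close>.\<close>
  define b where "b = (\<lambda>j z. g j (h z) / l z)"
  have b: "((\<lambda>j. b j z * cnj (b j w)) has_sum K z w) J" if zw: "z \<in> N" "w \<in> N" for z w
  proof -
    have m: "h z \<in> S" "h w \<in> S" using zw r(2) hS unfolding N_def by blast+
    have n: "l z \<noteq> 0" "l w \<noteq> 0" using zw l by (auto simp: N_def)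
    have "((\<lambda>j. g j (h z) * cnj (g j (h w))) has_sum polarized J g (vpair (h z) (vcnj (h w)))) J"
      unfolding polarized_def vpair_simps by (rule has_sum_infsum[OF sq_bounded_family_summable[OF fam' m]])
    then have "((\<lambda>j. inverse (l z * cnj (l w)) * (g j (h z) * cnj (g j (h w)))) has_sum
        inverse (l z * cnj (l w)) * polarized J g (vpair (h z) (vcnj (h w)))) J"
      by (rule has_sum_cmult_right)
    moreover have "inverse (l z * cnj (l w)) * polarized J g (vpair (h z) (vcnj (h w))) = K z w"
    proof -
      have inv: "inverse x * (x * k) = k" if "x \<noteq> 0" for x k :: complex using that by (simp add: mult.assoc[symmetric])
      have nz: "l z * cnj (l w) \<noteq> 0" using n by simp
      have "polarized J g (vpair (h z) (vcnj (h w))) = l z * cnj (l w) * K z w"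
        using rel[of z w] zw by (simp add: N_def polarized_def[of "bergman_basis \<Omega>"])
      then show ?thesis using inv[OF nz] by (simp only:)
    qed
    moreover have "(\<lambda>j. inverse (l z * cnj (l w)) * (g j (h z) * cnj (g j (h w)))) = (\<lambda>j. b j z * cnj (b j w))"
      by (simp add: b_def divide_inverse mult_ac)
    ultimately show ?thesis by simp
  qed
  obtain \<xi> where \<xi>: "sq_bounded_family J \<xi> \<Omega>" "\<And>j z. j \<in> J \<Longrightarrow> z \<in> N \<Longrightarrow> \<xi> j z = b j z"
    "\<And>z w. z \<in> \<Omega> \<Longrightarrow> w \<in> \<Omega> \<Longrightarrow> ((\<lambda>j. \<xi> j z * cnj (\<xi> j w)) has_sum K z w) J"
    using kernel_family_extension[OF \<Omega>(1,2) N sq_bounded_family_bergman_basis[OF \<Omega>(1)] refl b] by blast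
  have h\<xi>: "holo_fun (\<xi> j) \<Omega>" if "j \<in> J" for j using \<xi>(1) that by (simp add: sq_bounded_family_def)
  define Z where "Z = {z. \<forall>c\<in>A. f z \<in> fst c \<longrightarrow> (\<forall>j\<in>J. \<forall>k\<in>J. j c (f z) * \<xi> k z = k c (f z) * \<xi> j z)}"
  \<comment> \<open>One chart around \<open>f z\<close> is enough: passing to another multiplies
    both sides by the same Jacobian determinant \<open>D\<close>.\<close>
  have change: "z \<in> Z" if d: "d \<in> A" "f z \<in> fst d" and eq: "\<And>j k. j \<in> J \<Longrightarrow> k \<in> J \<Longrightarrow> j d (f z) * \<xi> k z = k d (f z) * \<xi> j z" for z d
    unfolding Z_def
  proof (intro CollectI ballI impI)
    fix c j k assume c: "c \<in> A" "f z \<in> fst c" and jk: "j \<in> J" "k \<in> J"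
    define D where "D = det (matrix (frechet_derivative (snd d \<circ> chart_inv c) (at (snd c (f z)))))"
    have "j c (f z) = j d (f z) * D" "k c (f z) = k d (f z) * D"
      unfolding D_def using holomorphic_top_form_transition[OF basis_form c(1) d(1), of _ "f z"] c d jk by auto
    then show "j c (f z) * \<xi> k z = k c (f z) * \<xi> j z" using eq[OF jk] by (simp add: mult.assoc mult.left_commute[of _ D])
  qed
  have "\<Omega> \<subseteq> Z"
  proof (rule connected_propagation[OF \<Omega>(1,2) N])
    show "N \<subseteq> Z"
    proof
      fix z assume z: "z \<in> N"
      then have zU: "z \<in> U" using r(2) by (auto simp: N_def)
      show "z \<in> Z"
      proof (rule change[OF c0(1)])
        show "f z \<in> fst c0" using zU by (simp add: U_def)
        show "j c0 (f z) * \<xi> k z = k c0 (f z) * \<xi> j z" if "j \<in> J" "k \<in> J" for j k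
          using that z by (simp add: \<xi>(2) b_def gh[OF zU])
      qed
    qed
    fix x assume x: "x \<in> \<Omega>"
    then obtain c where c: "c \<in> A" "f x \<in> fst c" using chart_around surj by blast
    obtain r where r: "r > 0" "ball x r \<subseteq> \<Omega> \<inter> f -` fst c"
      using open_preimage_chart[OF c(1)] x c(2) by (meson IntI openE vimageI)
    \<comment> \<open>On this ball a single chart covers the image of \<open>f\<close>, so the
      minors are honest holomorphic functions there and the convex identity theorem applies.\<close>
    have "ball x r \<subseteq> Z" if V: "open V" "V \<noteq> {}" "V \<subseteq> ball x r" "V \<subseteq> Z" for V
    proof
      fix y assume y: "y \<in> ball x r"
      show "y \<in> Z"
      proof (rule change[OF c(1)])
        show "f y \<in> fst c" using y r(2) by auto
        fix j k assume jk: "j \<in> J" "k \<in> J"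
        have hp: "holo_fun (\<lambda>z. \<omega> c (f z)) (ball x r)" if "\<omega> \<in> J" for \<omega>
          using holo_fun_pullback(1)[OF that c(1)] r(2) by (rule holo_fun_subset)
        have hx: "holo_fun (\<xi> \<omega>) (ball x r)" if "\<omega> \<in> J" for \<omega>
          using h\<xi>[OF that] r(2) by (auto intro: holo_fun_subset)
        have "j c (f y) * \<xi> k y - k c (f y) * \<xi> j y = 0"
        proof (rule holo_fun_identity_convex[OF _ open_ball convex_ball V(1-3) _ y])
          show "holo_fun (\<lambda>y. j c (f y) * \<xi> k y - k c (f y) * \<xi> j y) (ball x r)"
            using jk by (intro holo_fun_diff holo_fun_mult hp hx)
          fix z assume z: "z \<in> V"
          then have "f z \<in> fst c" "z \<in> Z" using V r(2) by auto
          then show "j c (f z) * \<xi> k z - k c (f z) * \<xi> j z = 0" using c(1) jk by (simp add: Z_def)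
        qed
        then show "j c (f y) * \<xi> k y = k c (f y) * \<xi> j y" by simp
      qed
    qed
    then show "\<exists>r>0. ball x r \<subseteq> \<Omega> \<and> (\<forall>V. open V \<longrightarrow> V \<noteq> {} \<longrightarrow> V \<subseteq> ball x r \<longrightarrow> V \<subseteq> Z \<longrightarrow> ball x r \<subseteq> Z)"
      using r by (intro exI[of _ r]) auto
  qed
  then show thesis using that[OF \<xi>(1,3)] unfolding Z_def by blast
qed

lemma injective: "inj_on f \<Omega>"
proof (rule inj_onI)
  fix z w assume zw: "z \<in> \<Omega>" "w \<in> \<Omega>" and fzw: "f z = f w"
  obtain \<xi> where \<xi>: "sq_bounded_family J \<xi> \<Omega>"
    "\<And>z w. z \<in> \<Omega> \<Longrightarrow> w \<in> \<Omega> \<Longrightarrow> ((\<lambda>j. \<xi> j z * cnj (\<xi> j w)) has_sum K z w) J"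
    "\<And>z c j k. z \<in> \<Omega> \<Longrightarrow> c \<in> A \<Longrightarrow> f z \<in> fst c \<Longrightarrow> j \<in> J \<Longrightarrow> k \<in> J \<Longrightarrow> j c (f z) * \<xi> k z = k c (f z) * \<xi> j z"
    by (rule extended_family) (rule that)
  obtain c where c: "c \<in> A" "f w \<in> fst c" using chart_around surj zw by blast
  obtain j0 where j0: "j0 \<in> J" "j0 c (f w) \<noteq> 0" using basis_nonvanishing[OF c] .
  \<comment> \<open>Equal image points have the same nonzero coefficient vector in the chart
    \<open>c\<close>; both \<open>\<xi>(z)\<close> and \<open>\<xi>(w)\<close> are multiples of it,
    with factors \<alpha>.\<close>
  define \<alpha> where "\<alpha> x = \<xi> j0 x / j0 c (f w)" for x
  have \<alpha>: "\<xi> k x = \<alpha> x * k c (f w)" if "k \<in> J" "x \<in> {z, w}" for k x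
    using \<xi>(3)[of x c j0 k] that zw fzw c j0 by (auto simp: \<alpha>_def field_simps)
  have "\<alpha> w \<noteq> 0"
  proof
    assume "\<alpha> w = 0"
    then have "\<xi> k w = 0" if "k \<in> J" for k using \<alpha>[OF that] by simp
    then have "((\<lambda>j. \<xi> j w * cnj (\<xi> j w)) has_sum 0) J" by (intro has_sum_0) simp
    then show False using \<xi>(2)[OF zw(2) zw(2)] K_diagonal_nonzero[OF zw(2)] has_sum_unique by blast
  qed
  then have rel: "\<xi> k z = \<alpha> z / \<alpha> w * \<xi> k w" if "k \<in> J" for k using \<alpha>[OF that] by simp
  show "z = w"
  proof (rule bergman_basis_separates_points[OF \<Omega>(1,3) zw])
    have sub: "x \<in> \<Omega>" if "x \<in> {z, w}" for x using that zw by blast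
    show "\<phi> z = \<alpha> z / \<alpha> w * \<phi> w" if "\<phi> \<in> bergman_basis \<Omega>" for \<phi>
      by (rule kernel_transfer_points[OF K_has_sum_bergman[OF sub sub] \<xi>(2)[OF sub sub] rel that])
  qed
qed

text \<open>Differentiating the vanishing minors in direction \<open>v\<close> loses the terms with
  a derivative of the pulled back coefficients, as \<open>v\<close> is killed by the differential of
  \<open>f\<close>. What is left makes the derivative of \<xi> along \<open>v\<close> proportional
  to \<xi> itself.\<close>

lemma immersion:
  assumes z: "z \<in> \<Omega>" and c: "c \<in> A" "f z \<in> fst c" and v: "fd (snd c \<circ> f) z v = 0"
  shows "v = 0"
proof -
  obtain \<xi> where \<xi>: "sq_bounded_family J \<xi> \<Omega>"
    "\<And>z w. z \<in> \<Omega> \<Longrightarrow> w \<in> \<Omega> \<Longrightarrow> ((\<lambda>j. \<xi> j z * cnj (\<xi> j w)) has_sum K z w) J"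
    "\<And>z c j k. z \<in> \<Omega> \<Longrightarrow> c \<in> A \<Longrightarrow> f z \<in> fst c \<Longrightarrow> j \<in> J \<Longrightarrow> k \<in> J \<Longrightarrow> j c (f z) * \<xi> k z = k c (f z) * \<xi> j z"
    by (rule extended_family) (rule that)
  let ?W = "\<Omega> \<inter> f -` fst c"
  have zW: "z \<in> ?W" using z c by simp
  have h\<xi>: "holo_fun (\<xi> j) ?W" if "j \<in> J" for j
    using \<xi>(1) that unfolding sq_bounded_family_def by (blast intro: holo_fun_subset)
  obtain j0 where j0: "j0 \<in> J" "j0 c (f z) \<noteq> 0" using basis_nonvanishing[OF c] .
  define \<alpha> where "\<alpha> = \<xi> j0 z / j0 c (f z)"
  define \<beta> where "\<beta> = fd (\<xi> j0) z v / j0 c (f z)"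
  have \<alpha>: "\<xi> k z = \<alpha> * k c (f z)" if "k \<in> J" for k
    using \<xi>(3)[OF z c j0(1) that] j0 by (simp add: \<alpha>_def field_simps)
  have \<beta>: "fd (\<xi> k) z v = \<beta> * k c (f z)" if k: "k \<in> J" for k
  proof -
    have e1: "fd (\<lambda>x. j0 c (f x) * \<xi> k x) z = fd (\<lambda>x. k c (f x) * \<xi> j0 x) z"
      by (rule fd_cong[OF open_preimage_chart[OF c(1)] zW]) (use \<xi>(3) c j0 k in auto)
    have e2: "fd (\<lambda>x. j c (f x) * \<xi> k x) z v = j c (f z) * fd (\<xi> k) z v" if "j \<in> J" "k \<in> J" for j k
      using fd_mult[OF holo_fun_pullback(1)[OF that(1) c(1)] h\<xi>[OF that(2)] zW, of v]
        holo_fun_pullback(2)[OF that(1) c(1) zW v] by simp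
    have "j0 c (f z) * fd (\<xi> k) z v = fd (\<lambda>x. j0 c (f x) * \<xi> k x) z v" by (rule e2[OF j0(1) k, symmetric])
    also have "\<dots> = fd (\<lambda>x. k c (f x) * \<xi> j0 x) z v" by (rule fun_cong[OF e1])
    also have "\<dots> = k c (f z) * fd (\<xi> j0) z v" by (rule e2[OF k j0(1)])
    finally have "j0 c (f z) * fd (\<xi> k) z v = k c (f z) * fd (\<xi> j0) z v" .
    then show ?thesis using j0 by (simp add: \<beta>_def field_simps)
  qed
  have "\<alpha> \<noteq> 0"
  proof
    assume "\<alpha> = 0"
    then have "((\<lambda>j. \<xi> j z * cnj (\<xi> j z)) has_sum 0) J" using \<alpha> by (intro has_sum_0) simp
    then show False using \<xi>(2)[OF z z] K_diagonal_nonzero[OF z] has_sum_unique by blast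
  qed
  then have rel: "fd (\<xi> k) z v = \<beta> / \<alpha> * \<xi> k z" if "k \<in> J" for k using \<alpha>[OF that] \<beta>[OF that] by simp
  show ?thesis
  proof (rule bergman_basis_separates_tangents[OF \<Omega>(1,3) z])
    show "fd \<phi> z v = \<beta> / \<alpha> * \<phi> z" if "\<phi> \<in> bergman_basis \<Omega>" for \<phi>
      by (rule kernel_transfer_tangents[OF \<Omega>(1) sq_bounded_family_bergman_basis[OF \<Omega>(1)] \<xi>(1) K_has_sum_bergman \<xi>(2) z rel that])
  qed
qed

lemma linear_fd_chart:
  assumes "z \<in> \<Omega>" "c \<in> A" "f z \<in> fst c"
  shows "linear (fd (snd c \<circ> f) z)" "inj (fd (snd c \<circ> f) z)"
proof -
  have "z \<in> \<Omega> \<inter> f -` fst c" using assms by simp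
  then show l: "linear (fd (snd c \<circ> f) z)"
    using holo_map_has_derivative(1)[OF holo_map_chart[OF assms(2)]] has_derivative_linear by blast
  show "inj (fd (snd c \<circ> f) z)"
    unfolding linear_injective_0[OF l] using immersion[OF assms] by blast
qed

lemma image_chart:
  assumes "c \<in> A"
  shows "(snd c \<circ> f) ` (\<Omega> \<inter> f -` fst c) = snd c ` fst c"
proof -
  have "fst c \<subseteq> f ` \<Omega>" using openin_subset[OF chart_facts(1)[OF M ne assms]] surj by simp
  then have "f ` (\<Omega> \<inter> f -` fst c) = fst c" by blast
  then show ?thesis by (simp only: image_comp[symmetric])
qed

text \<open>A lower dimensional domain has negligible image in every chart.\<close>

lemma DIM_eq: "DIM(complex ^ 'm) = DIM(complex ^ 'n)"
proof (rule antisym)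
  obtain z where z: "z \<in> \<Omega>" using \<Omega>_ne by blast
  obtain c where c: "c \<in> A" "f z \<in> fst c" using chart_around surj z by blast
  let ?W = "\<Omega> \<inter> f -` fst c"
  show "DIM(complex ^ 'm) \<le> DIM(complex ^ 'n)"
  proof (rule ccontr)
    assume "\<not> DIM(complex ^ 'm) \<le> DIM(complex ^ 'n)"
    then have "negligible ((snd c \<circ> f) ` ?W)"
      using holo_map_has_derivative(1)[OF holo_map_chart[OF c(1)]]
      by (intro negligible_differentiable_image_lowdim)
         (auto simp: differentiable_on_def differentiable_def intro: has_derivative_at_withinI)
    then show False
      using open_not_negligible[OF chart_facts(2)[OF M ne c(1)]] c(2) unfolding image_chart[OF c(1)] by blast
  qed
  have "DIM(complex ^ 'n) = dim (fd (snd c \<circ> f) z ` UNIV)"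
    using dim_image_eq[of "fd (snd c \<circ> f) z" UNIV] linear_fd_chart[OF z c] by (simp add: span_UNIV)
  also have "\<dots> \<le> DIM(complex ^ 'm)" by (rule dim_subset_UNIV)
  finally show "DIM(complex ^ 'n) \<le> DIM(complex ^ 'm)" .
qed

text \<open>Invariance of domain, applicable because the real dimensions agree, gives continuity of
  the inverse; injectivity of the differential then gives differentiability, and complex linearity
  is inherited from the differential of \<open>h\<close>.\<close>

lemma inverse_chart:
  assumes c: "c \<in> A"
  shows "holo_map (inv_into \<Omega> f \<circ> chart_inv c) (snd c ` fst c)"
proof -
  let ?W = "\<Omega> \<inter> f -` fst c" and ?S = "snd c ` fst c"
  define h where "h = snd c \<circ> f"
  define k where "k = inv_into \<Omega> f \<circ> chart_inv c"
  have hh: "holo_map h ?W" unfolding h_def by (rule holo_map_chart[OF c])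
  have top: "fst c \<subseteq> f ` \<Omega>" using openin_subset[OF chart_facts(1)[OF M ne c]] surj by simp
  have kh: "k (h z) = z" if "z \<in> ?W" for z
    using that chart_inv_simps(1)[OF M ne c] inv_into_f_f[OF injective] by (simp add: k_def h_def)
  have kW: "k \<zeta> \<in> ?W" and hk: "h (k \<zeta>) = \<zeta>" if "\<zeta> \<in> ?S" for \<zeta>
  proof -
    have x: "chart_inv c \<zeta> \<in> fst c" "snd c (chart_inv c \<zeta>) = \<zeta>" using chart_inv_simps[OF M ne c] that by auto
    then have y: "chart_inv c \<zeta> \<in> f ` \<Omega>" using top by blast
    show "k \<zeta> \<in> ?W" using f_inv_into_f[OF y] inv_into_into[OF y] x by (simp add: k_def)
    show "h (k \<zeta>) = \<zeta>" using f_inv_into_f[OF y] x by (simp add: k_def h_def)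
  qed
  have S: "open ?S" by (rule chart_facts(2)[OF M ne c])
  have "continuous_on (h ` ?W) k"
    using open_preimage_chart[OF c] holo_map_continuous_on[OF hh] DIM_eq kh
    by (intro continuous_on_inverse_open) auto
  then have ck: "continuous_on ?S k" unfolding h_def image_chart[OF c] .
  have der: "\<exists>k'. (k has_derivative k') (at \<zeta>) \<and> (\<forall>a v. k' (a *s v) = a *s k' v)" if \<zeta>: "\<zeta> \<in> ?S" for \<zeta>
  proof -
    have kz: "k \<zeta> \<in> \<Omega>" "f (k \<zeta>) \<in> fst c" using kW[OF \<zeta>] by auto
    define h' where "h' = fd h (k \<zeta>)"
    have h': "linear h'" "inj h'" using linear_fd_chart[OF kz(1) c kz(2)] by (simp_all add: h'_def h_def)
    have hd: "(h has_derivative h') (at (k \<zeta>))" unfolding h'_def by (rule holo_map_has_derivative(1)[OF hh kW[OF \<zeta>]])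
    \<comment> \<open>Only a left inverse is at hand, since source and target are different types.
      That it is also a right inverse follows by differentiating
      \<open>h (k \<zeta>) = \<zeta>\<close>.\<close>
    obtain k' where k': "linear k'" "k' \<circ> h' = id" using linear_injective_left_inverse[OF h'] by blast
    have kd: "(k has_derivative k') (at \<zeta>)"
    proof (rule has_derivative_inverse_basic[where f = h and f' = h' and T = ?S])
      show "bounded_linear k'" using k'(1) by (simp add: linear_conv_bounded_linear)
      show "continuous (at \<zeta>) k" using ck \<zeta> unfolding continuous_on_eq_continuous_at[OF S] by (rule bspec)
    qed (fact hd k'(2) S \<zeta> hk)+
    have "((\<lambda>\<zeta>. h (k \<zeta>)) has_derivative (\<lambda>v. h' (k' v))) (at \<zeta>)"
      using diff_chain_at[OF kd hd] by (simp add: o_def)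
    then have "((\<lambda>\<zeta>. \<zeta>) has_derivative (\<lambda>v. h' (k' v))) (at \<zeta>)"
      by (rule has_derivative_transform_within_open[OF _ S \<zeta>]) (rule hk)
    then have inv: "h' (k' v) = v" for v using has_derivative_unique[OF _ has_derivative_ident] by metis
    have left: "k' (h' w) = w" for w using k'(2) by (metis comp_apply id_apply)
    have "k' (a *s v) = a *s k' v" for a v
    proof -
      have "a *s v = h' (a *s k' v)"
        unfolding h'_def holo_map_has_derivative(2)[OF hh kW[OF \<zeta>]] using inv by (simp add: h'_def)
      then show ?thesis using left by metis
    qed
    then show ?thesis using kd by blast
  qed
  show ?thesis
    unfolding holo_map_def k_def[symmetric]
  proof (intro allI holo_funI)
    fix i \<zeta> assume "\<zeta> \<in> ?S"
    then obtain k' where k': "(k has_derivative k') (at \<zeta>)" "\<And>a v. k' (a *s v) = a *s k' v" using der by blast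
    have "((\<lambda>\<zeta>. k \<zeta> $ i) has_derivative (\<lambda>v. k' v $ i)) (at \<zeta>)"
      by (rule bounded_linear.has_derivative[OF bounded_linear_vec_nth k'(1)])
    then show "\<exists>f'. ((\<lambda>\<zeta>. k \<zeta> $ i) has_derivative f') (at \<zeta>) \<and> (\<forall>a v. f' (a *s v) = a * f' v)"
      using k'(2) by (intro exI[of _ "\<lambda>v. k' v $ i"]) simp
  qed
qed

proposition biholomorphism_of_isometry: "biholomorphism (top_of_set \<Omega>) (domain_atlas \<Omega>) M A f"
proof -
  define g where "g = inv_into \<Omega> f"
  have gx: "g (f z) = z" if "z \<in> \<Omega>" for z using inv_into_f_f[OF injective that] by (simp add: g_def)
  have gy: "f (g y) = y" "g y \<in> \<Omega>" if "y \<in> topspace M" for y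
    using that surj f_inv_into_f[of y f \<Omega>] inv_into_into[of y f \<Omega>] by (simp_all add: g_def)
  have cont: "continuous_map M (top_of_set \<Omega>) g"
    unfolding continuous_map
  proof (intro conjI allI impI)
    show "g ` topspace M \<subseteq> topspace (top_of_set \<Omega>)" using gy by auto
    fix V assume "openin (top_of_set \<Omega>) V"
    then have V: "open V" using openin_open_trans \<Omega>(1) by blast
    show "openin M {y \<in> topspace M. g y \<in> V}"
    proof (subst openin_subopen, intro ballI)
      fix y assume y: "y \<in> {y \<in> topspace M. g y \<in> V}"
      then obtain c where c: "c \<in> A" "y \<in> fst c" using chart_around by blast
      \<comment> \<open>Continuity of the inverse is checked in a chart: \<open>Q\<close> is the
        preimage of \<open>V\<close> in coordinates, and the chart pulls it back to a neighbourhood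
        of \<open>y\<close>.\<close>
      define Q where "Q = snd c ` fst c \<inter> (g \<circ> chart_inv c) -` V"
      have "open Q" unfolding Q_def g_def
        by (rule continuous_open_preimage[OF holo_map_continuous_on[OF inverse_chart[OF c(1)]] chart_facts(2)[OF M ne c(1)] V])
      have top: "fst c \<subseteq> topspace M" by (rule openin_subset[OF chart_facts(1)[OF M ne c(1)]])
      have "continuous_map (subtopology M (fst c)) (top_of_set (snd c ` fst c)) (snd c)"
        using chart_facts(3)[OF M ne c(1)] by (rule homeomorphic_imp_continuous_map)
      moreover have "openin (top_of_set (snd c ` fst c)) Q"
        using \<open>open Q\<close> by (intro open_subset) (auto simp: Q_def)
      ultimately have "openin (subtopology M (fst c)) {x \<in> topspace (subtopology M (fst c)). snd c x \<in> Q}"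
        by (rule openin_continuous_map_preimage)
      moreover have "{x \<in> topspace (subtopology M (fst c)). snd c x \<in> Q} = {x \<in> fst c. g x \<in> V}"
      proof -
        have "snd c x \<in> Q \<longleftrightarrow> g x \<in> V" if "x \<in> fst c" for x
          using that chart_inv_simps(1)[OF M ne c(1) that] by (simp add: Q_def)
        then show ?thesis using top by auto
      qed
      ultimately have "openin M {x \<in> fst c. g x \<in> V}"
        using openin_trans_full[OF _ chart_facts(1)[OF M ne c(1)]] by metis
      then show "\<exists>T. openin M T \<and> y \<in> T \<and> T \<subseteq> {y \<in> topspace M. g y \<in> V}"
        using y c(2) top by (intro exI[of _ "{x \<in> fst c. g x \<in> V}"]) auto
    qed
  qed
  have "manifold_holomorphic M A (top_of_set \<Omega>) (domain_atlas \<Omega>) g"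
    unfolding manifold_holomorphic_def domain_atlas_def
  proof (intro conjI cont ballI, clarify)
    fix U \<phi> assume c: "(U, \<phi>) \<in> A"
    have "U \<subseteq> topspace M" using openin_subset[OF chart_facts(1)[OF M ne c]] by simp
    then have "U \<inter> g -` \<Omega> = U" using gy(2) by auto
    then show "holo_map (id \<circ> g \<circ> inv_into U \<phi>) (\<phi> ` (U \<inter> g -` \<Omega>))"
      using inverse_chart[OF c] by (simp add: g_def chart_inv_def[abs_def])
  qed
  then show ?thesis
    unfolding biholomorphism_def using hol gx gy(1) by (intro conjI exI[of _ g]) auto
qed

end

theorem theorem7p1:
  fixes \<Omega> :: "(complex ^ 'n) set"
    and M :: "'a topology"
    and A :: "('a, 'm::finite) chart set"
    and f :: "complex ^ 'n \<Rightarrow> 'a"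
  assumes "bounded_domain \<Omega>"
    and "complex_manifold M A"
    and "has_bergman_metric M A"
    and "\<exists>p. bochner_pole \<Omega> p"
    and "manifold_holomorphic (top_of_set \<Omega>) (domain_atlas \<Omega>) M A f"
    and "f ` \<Omega> = topspace M"
    and "preserves_bergman_metric \<Omega> M A f"
  shows "biholomorphism (top_of_set \<Omega>) (domain_atlas \<Omega>) M A f"
  using assms(1-3,5-7) by (rule biholomorphism_of_isometry)

end
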